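(* Let $(X_n,Y_n)_{n\ge 0}$ be a Markov chain in $E\times F$ ($E,F$ Polish) with transition kernel $P$ and invariant probability $\lambda$, and let $\mathcal{E}^0\subseteq\mathcal{B}(E)$ be a countably generated sub-$\sigma$-field. Suppose that: (Local ergodicity) $\|\mathbf{P}^{x,y}-\mathbf{P}\|_{\mathcal{F}^0_{n,\infty}}\to 0$ as $n\to\infty$ for $\lambda$-a.e. $(x,y)\in E\times F$. (Nondegeneracy) There exist Markov transition kernels $P_0:E\times\mathcal{B}(E)\to[0,1]$ and $Q:F\times\mathcal{B}(F)\to[0,1]$ such that $$P(x,y,dx',dy')=g(x,y,x',y')\,P_0(x,dx')\,Q(y,dy')$$ for some strictly positive measurable function $g:E\times F\times E\times F\to\,]0,\infty[$. Then for any initial probability $\mu\in\mathcal{P}(E\times F)$ such that $$\mu(E\times\cdot)\ll\lambda(E\times\cdot)\quad\text{and}\quad\|\Pi_0^\mu-\Pi_0\|_{\mathcal{F}^0_{n,\infty}}\to 0\ \text{ as }n\to\infty,\ \mathbf{P}^\mu\text{-a.s.},$$ we have $$\|\Pi_n^\mu-\Pi_n\|_{\mathcal{F}^0_{n-r,\infty}}\to 0\ \text{ as }n\to\infty,\ \mathbf{P}^\mu\text{-a.s., for any }r\in\mathbb{N}.$$ If $\mu(E\times\cdot)\sim\lambda(E\times\cdot)$, the convergence holds also $\mathbf{P}$-a.s.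
   Context: $E,F$ are Polish spaces; $\mathcal{B}(\cdot)$ is the Borel $\sigma$-field and $\mathcal{P}(\cdot)$ the set of Borel probability measures. $(X_n,Y_n)$ is the coordinate process on the canonical path space $E^{\mathbb{Z}}\times F^{\mathbb{Z}}$. $P:E\times F\times\mathcal{B}(E\times F)\to[0,1]$ is a Markov transition kernel, and $\mathbf{P}^\mu$ is the law (on $\sigma\{(X_k,Y_k):k\ge 0\}$) of the Markov chain $(X_n,Y_n)_{n\ge 0}$ with transition kernel $P$ and initial law $(X_0,Y_0)\sim\mu$; $\mathbf{P}^{x,y}=\mathbf{P}^{\delta_x\otimes\delta_y}$. $\lambda$ is a fixed invariant probability of $P$ ($\lambda P=\lambda$; uniqueness is not assumed), and $\mathbf{P}=\mathbf{P}^\lambda$. $\mathcal{F}^Y_{m,n}=\sigma\{Y_k:m\le k\le n\}$ and $\mathcal{F}^0_{m,n}=\mathcal{F}^Y_{m,n}\vee\bigvee_{m\le k\le n}X_k^{-1}(\mathcal{E}^0)$ for $m<n$ ($n=\infty$ allowed). $\Pi_n^\mu=\mathbf{P}^\mu[\,\cdot\,|\mathcal{F}^Y_{0,n}]$ (regular conditional probability, regarded as a kernel that is a function of the observations $Y_0,\ldots,Y_n$; versions are fixed arbitrarily), and $\Pi_n=\Pi_n^\lambda$. For probability measures $\rho,\rho'$ and a $\sigma$-field $\mathcal{G}$, $\|\rho-\rho'\|_{\mathcal{G}}=2\sup_{A\in\mathcal{G}}|\rho(A)-\rho'(A)|$. $\mu(E\times\cdot)$ is the marginal of $\mu$ on $F$;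 $\ll$ and $\sim$ denote absolute continuity and equivalence. *)

theory Defs
  imports "HOL-Probability.Probability" "HOL-Library.Extended_Nat"
begin

section \<open>The canonical chain\<close>

text \<open>Only times \<open>k \<ge> 0\<close> enter, so the path space is taken one-sided: a path of type
  \<open>nat \<Rightarrow> 'e \<times> 'f\<close> carries the pair \<open>(X\<^sub>k, Y\<^sub>k)\<close> at time \<open>k\<close>, and the product \<open>\<sigma>\<close>-field
  \<open>PiM UNIV (\<lambda>_. borel)\<close> is \<open>\<sigma>{(X\<^sub>k, Y\<^sub>k) : k \<ge> 0}\<close>.\<close>

definition coord_X :: "nat \<Rightarrow> (nat \<Rightarrow> 'e \<times> 'f) \<Rightarrow> 'e" where
  "coord_X k \<omega> = fst (\<omega> k)"

definition coord_Y :: "nat \<Rightarrow> (nat \<Rightarrow> 'e \<times> 'f) \<Rightarrow> 'f" where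
  "coord_Y k \<omega> = snd (\<omega> k)"

definition markov_kernel :: "('a::topological_space \<Rightarrow> 'b::topological_space measure) \<Rightarrow> bool" where
  "markov_kernel K \<longleftrightarrow> K \<in> borel \<rightarrow>\<^sub>M prob_algebra borel"

definition borel_prob :: "'a::topological_space measure \<Rightarrow> bool" where
  "borel_prob \<mu> \<longleftrightarrow> prob_space \<mu> \<and> sets \<mu> = sets borel"

text \<open>The conditional law of the coordinate at time \<open>n\<close> given the coordinates before \<open>n\<close>.\<close>

definition chain_step ::
  "('a \<Rightarrow> 'a measure) \<Rightarrow> 'a measure \<Rightarrow> nat \<Rightarrow> (nat \<Rightarrow> 'a) \<Rightarrow> 'a measure" where
  "chain_step P \<mu> n \<omega> = (case n of 0 \<Rightarrow> \<mu> | Suc k \<Rightarrow> P (\<omega> k))"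

text \<open>The law of the chain with transition kernel \<open>P\<close> and initial law \<open>\<mu>\<close>, as given by the
  Ionescu-Tulcea theorem. The constant is the global form of the limit measure \<open>PF.lim\<close> of the
  locale \<^locale>\<open>Ionescu_Tulcea\<close>, whose assumptions are discharged below.\<close>

definition chain_law ::
  "('a::topological_space \<Rightarrow> 'a measure) \<Rightarrow> 'a measure \<Rightarrow> (nat \<Rightarrow> 'a) measure" where
  "chain_law P \<mu> =
     projective_family.lim UNIV (Ionescu_Tulcea.CI (chain_step P \<mu>) (\<lambda>_. borel)) (\<lambda>_. borel)"

lemma Ionescu_Tulcea_chain_step:
  fixes P :: "'a::topological_space \<Rightarrow> 'a measure"
  assumes P: "markov_kernel P" and \<mu>: "borel_prob \<mu>"
  shows "Ionescu_Tulcea (chain_step P \<mu>) (\<lambda>_. borel)"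
proof (rule Ionescu_Tulcea.intro)
  have Pm: "P \<in> borel \<rightarrow>\<^sub>M prob_algebra borel"
    using P by (simp add: markov_kernel_def)
  have \<mu>m: "\<mu> \<in> space (prob_algebra borel)"
    using \<mu> by (simp add: borel_prob_def space_prob_algebra)
  have step: "chain_step P \<mu> n \<in> PiM {0..<n} (\<lambda>_. borel) \<rightarrow>\<^sub>M prob_algebra borel" for n
  proof (cases n)
    case 0
    then show ?thesis
      using \<mu>m by (simp add: chain_step_def[abs_def])
  next
    case (Suc k)
    have "(\<lambda>\<omega>. P (\<omega> k)) \<in> PiM {0..<n} (\<lambda>_. borel) \<rightarrow>\<^sub>M prob_algebra borel"
      by (rule measurable_compose[OF _ Pm], rule measurable_component_singleton) (simp add: Suc)
    then show ?thesis
      by (simp add: chain_step_def[abs_def] Suc)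
  qed
  fix n
  show "chain_step P \<mu> n \<in> PiM {0..<n} (\<lambda>_. borel) \<rightarrow>\<^sub>M subprob_algebra borel"
    by (rule measurable_prob_algebraD[OF step])
  fix \<omega> :: "nat \<Rightarrow> 'a"
  assume "\<omega> \<in> space (PiM {0..<n} (\<lambda>_. borel :: 'a measure))"
  then show "prob_space (chain_step P \<mu> n \<omega>)"
    using measurable_space[OF step] by (auto simp: space_prob_algebra)
qed


section \<open>The \<open>\<sigma>\<close>-fields\<close>

definition FY :: "nat \<Rightarrow> enat \<Rightarrow> (nat \<Rightarrow> 'e::polish_space \<times> 'f::polish_space) measure" where
  "FY m n = sigma UNIV {coord_Y k -` B | k B. m \<le> k \<and> enat k \<le> n \<and> B \<in> sets borel}"

definition F0 ::
  "'e set set \<Rightarrow> nat \<Rightarrow> enat \<Rightarrow> (nat \<Rightarrow> 'e::polish_space \<times> 'f::polish_space) measure" where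
  "F0 \<E> m n = sigma UNIV
     (sets (FY m n) \<union> {coord_X k -` A | k A. m \<le> k \<and> enat k \<le> n \<and> A \<in> \<E>})"


section \<open>Total variation and filters\<close>

definition tv_norm :: "'a measure \<Rightarrow> 'a measure \<Rightarrow> 'a measure \<Rightarrow> real" where
  "tv_norm G \<rho> \<rho>' = 2 * (SUP A\<in>sets G. \<bar>measure \<rho> A - measure \<rho>' A\<bar>)"

text \<open>\<open>K\<close> is a version of the regular conditional probability \<open>M[ \<sqdot> | G ]\<close>.\<close>

definition regular_cond_prob :: "'a measure \<Rightarrow> 'a measure \<Rightarrow> ('a \<Rightarrow> 'a measure) \<Rightarrow> bool" where
  "regular_cond_prob M G K \<longleftrightarrow>
     subalgebra M G \<and> K \<in> G \<rightarrow>\<^sub>M prob_algebra M \<and>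
     (\<forall>B\<in>sets M. AE \<omega> in M. measure (K \<omega>) B = real_cond_exp M G (indicator B) \<omega>)"

text \<open>\<open>K n\<close> is a version of \<open>\<Pi>\<^sub>n\<^sup>\<mu>\<close>. It is measurable with respect to
  \<open>\<sigma>{Y\<^sub>0, \<dots>, Y\<^sub>n}\<close> at every path, not just almost everywhere, and is therefore a function of the
  observations, which may be evaluated along paths drawn from any other law.\<close>

definition filter_version ::
  "('e::polish_space \<times> 'f::polish_space \<Rightarrow> ('e \<times> 'f) measure) \<Rightarrow> ('e \<times> 'f) measure \<Rightarrow>
   (nat \<Rightarrow> (nat \<Rightarrow> 'e \<times> 'f) \<Rightarrow> (nat \<Rightarrow> 'e \<times> 'f) measure) \<Rightarrow> bool" where
  "filter_version P \<mu> K \<longleftrightarrow>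
     (\<forall>n. regular_cond_prob (chain_law P \<mu>) (FY 0 (enat n)) (K n))"


section \<open>Hypotheses on the kernel\<close>

definition local_ergodicity ::
  "('e::polish_space \<times> 'f::polish_space \<Rightarrow> ('e \<times> 'f) measure) \<Rightarrow> ('e \<times> 'f) measure \<Rightarrow>
   'e set set \<Rightarrow> bool" where
  "local_ergodicity P lam \<E> \<longleftrightarrow>
     (AE (x, y) in lam.
        (\<lambda>n. tv_norm (F0 \<E> n \<infinity>) (chain_law P (return borel (x, y))) (chain_law P lam))
          \<longlonglongrightarrow> 0)"

definition nondegenerate ::
  "('e::polish_space \<times> 'f::polish_space \<Rightarrow> ('e \<times> 'f) measure) \<Rightarrow> bool" where
  "nondegenerate P \<longleftrightarrow>
     (\<exists>(P0 :: 'e \<Rightarrow> 'e measure) (Q :: 'f \<Rightarrow> 'f measure) (g :: 'e \<times> 'f \<times> 'e \<times> 'f \<Rightarrow> real).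
        markov_kernel P0 \<and> markov_kernel Q \<and>
        g \<in> borel_measurable borel \<and> (\<forall>z. 0 < g z) \<and>
        (\<forall>x y. P (x, y) =
           density (P0 x \<Otimes>\<^sub>M Q y) (\<lambda>(x', y'). ennreal (g (x, y, x', y')))))"

end

theory Submission
  imports Defs
begin

text \<open>
  Let \<open>A\<^sub>m\<close> be the \<open>\<sigma>\<close>-field generated by all observations and by the local events at the times
  \<open>k \<ge> m\<close>. If, on some \<open>A\<^sub>m\<close>, the law of the chain started at \<open>\<mu>\<close> had a density \<open>V\<close> with respect to
  the stationary law that depends on \<open>Y\<^sub>0, \<dots>, Y\<^sub>n\<close> only, then by Bayes' formula the two filters
  would agree on \<open>A\<^sub>m\<close> from time \<open>n\<close> on. The proof shows that this holds for large \<open>m\<close> up to an error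
  of small total mass, and converts the small mass into almost sure convergence by a maximal
  inequality. Three ideas carry the argument.

  \<^item> Transfer of singularity (\<open>singular_mass_le_tail_variation\<close>). By nondegeneracy, the two
    components of the chain are independent during the first \<open>m\<close> steps, up to equivalence of
    measures. Hence the observations strictly between the times \<open>0\<close> and \<open>m\<close> say nothing about \<open>X\<close> once \<open>Y\<^sub>0\<close> and \<open>Y\<^sub>m\<close> are known, and the part
    of one law that is singular to another law with the same \<open>Y\<^sub>0\<close> cannot be larger on \<open>A\<^sub>m\<close> than the
    total variation distance allows on the local tail after time \<open>m\<close>. For the filters at time 0
    this distance tends to 0 by assumption, so most of the law started at \<open>\<mu>\<close> has a bounded
    density on some \<open>A\<^sub>k\<close> (\<open>dominated_part\<close>).

  \<^item> Resampling (\<open>cond_exp_near_observable\<close>). Let \<open>W\<close> be the conditional expectation of a bounded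
    function given \<open>A\<^sub>m\<close> under the stationary law. It is close to a function \<open>C\<close> of the path
    before some time \<open>n\<close>. Replace \<open>X\<^sub>n\<close> by an independent sample from its law given \<open>Y\<^sub>n\<close> and
    restart the chain. By local ergodicity and transfer of singularity, what is unlikely for the true
    future remains unlikely for the resampled one, and by stationarity the quantitative form of this
    statement does not depend on \<open>n\<close>. So \<open>W\<close>, evaluated on the old past and the new future, is
    still close to \<open>C\<close>. But \<open>W\<close> sees the past only through the observations, and the new
    future depends on the past only through \<open>Y\<^sub>n\<close>: its average over the new future is
    a function of \<open>Y\<^sub>0, \<dots>, Y\<^sub>n\<close> that is close to \<open>C\<close> and therefore to \<open>W\<close>.

  \<^item> Bayes' formula with errors (\<open>maximal_bound\<close>). The integral of the difference of the filters over an
    event \<open>B\<close> observed up to time \<open>n\<close> is bounded by the error mass \<open>\<zeta> B\<close>, and \<open>\<zeta>\<close>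
    does not depend on \<open>n\<close>. Summation over the disjoint events on which the difference exceeds a
    level for the first time bounds the probability that it is ever exceeded.

  The convergence under the stationary law follows because divergence is an event of the
  observations: transfer of singularity, with the roles of the two laws exchanged, shows that such
  an event is null for the stationary law if it is null for the other one.
\<close>

section \<open>The law of the chain\<close>

fun cylinder_integral :: "('a \<Rightarrow> 'a measure) \<Rightarrow> ('a \<Rightarrow> ennreal) list \<Rightarrow> 'a \<Rightarrow> ennreal" where
  "cylinder_integral P [] z = 1"
| "cylinder_integral P (f # fs) z = f z * (\<integral>\<^sup>+z'. cylinder_integral P fs z' \<partial>P z)"

lemma markov_kernelD:
  assumes "markov_kernel P"
  shows "P \<in> borel \<rightarrow>\<^sub>M prob_algebra borel" "P \<in> borel \<rightarrow>\<^sub>M subprob_algebra borel"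
    "prob_space (P z)" "sets (P z) = sets borel" "space (P z) = UNIV"
proof -
  show P: "P \<in> borel \<rightarrow>\<^sub>M prob_algebra borel"
    using assms by (simp add: markov_kernel_def)
  then show "P \<in> borel \<rightarrow>\<^sub>M subprob_algebra borel"
    by (rule measurable_prob_algebraD)
  have "P z \<in> space (prob_algebra borel)"
    using measurable_space[OF P] by simp
  then show "prob_space (P z)" "sets (P z) = sets borel"
    by (simp_all add: space_prob_algebra)
  then show "space (P z) = UNIV"
    using sets_eq_imp_space_eq by fastforce
qed

lemma nn_integral_kernel_measurable:
  assumes P: "markov_kernel P" and f: "f \<in> borel_measurable borel"
  shows "(\<lambda>z. \<integral>\<^sup>+z'. f z' \<partial>P z) \<in> borel_measurable borel"
  using measurable_compose[OF markov_kernelD(2)[OF P] nn_integral_measurable_subprob_algebra[OF f]]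
  by simp

lemma cylinder_integral_measurable:
  assumes P: "markov_kernel P" and fs: "set fs \<subseteq> borel_measurable borel"
  shows "cylinder_integral P fs \<in> borel_measurable borel"
  using fs
proof (induction fs)
  case Nil
  have "cylinder_integral P [] = (\<lambda>_. 1)" by auto
  then show ?case by simp
next
  case (Cons f fs)
  have "cylinder_integral P (f # fs) = (\<lambda>z. f z * (\<integral>\<^sup>+z'. cylinder_integral P fs z' \<partial>P z))" by auto
  moreover have "(\<lambda>z. \<integral>\<^sup>+z'. cylinder_integral P fs z' \<partial>P z) \<in> borel_measurable borel"
    using Cons by (intro nn_integral_kernel_measurable[OF P]) auto
  ultimately show ?case using Cons.prems by (simp add: borel_measurable_times_ennreal)
qed

lemma cylinder_integral_singleton:
  assumes P: "markov_kernel P"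
  shows "cylinder_integral P [h] = h"
proof -
  have [simp]: "cylinder_integral P [] = (\<lambda>_. 1)" by auto
  show ?thesis
    by (intro ext) (simp add: prob_space.emeasure_space_1[OF markov_kernelD(3)[OF P]])
qed

lemma cylinder_integral_snoc:
  assumes P: "markov_kernel P" and "gs = fs @ [f, f']"
  shows "cylinder_integral P gs =
    cylinder_integral P (fs @ [\<lambda>z. f z * (\<integral>\<^sup>+z'. f' z' \<partial>P z)])"
  using assms(2)
proof (induction fs arbitrary: gs)
  case Nil
  have "cylinder_integral P [f, f'] x = f x * (\<integral>\<^sup>+z'. cylinder_integral P [f'] z' \<partial>P x)" for x
    by (rule cylinder_integral.simps(2))
  then have "cylinder_integral P [f, f'] = (\<lambda>x. f x * (\<integral>\<^sup>+z'. f' z' \<partial>P x))"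
    unfolding cylinder_integral_singleton[OF P] by (intro ext)
  then show ?case
    using Nil by (simp only: append_Nil cylinder_integral_singleton[OF P])
next
  case (Cons a fs)
  show ?case using Cons.IH[OF refl] Cons.prems by (intro ext) simp
qed

text \<open>The Ionescu-Tulcea construction integrates out the last coordinate first, whereas
  \<open>cylinder_integral\<close> conditions on the first one. The two orders agree because the last factor can be
  absorbed into the one before it.\<close>

lemma Ionescu_Tulcea_cylinder:
  fixes P :: "'a::topological_space \<Rightarrow> 'a measure"
  assumes kern: "markov_kernel P" and \<mu>: "borel_prob \<mu>"
    and fs: "set fs \<subseteq> borel_measurable borel" "fs \<noteq> []"
  shows "(\<integral>\<^sup>+\<omega>. (\<Prod>i<length fs. (fs ! i) (\<omega> i))
       \<partial>Ionescu_Tulcea.C (chain_step P \<mu>) (\<lambda>_. borel) 0 (length fs) (\<lambda>_. undefined)) =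
     (\<integral>\<^sup>+z. cylinder_integral P fs z \<partial>\<mu>)"
  using fs
proof (induction "length fs" arbitrary: fs)
  case 0
  then show ?case by simp
next
  case (Suc n)
  interpret Ionescu_Tulcea "chain_step P \<mu>" "\<lambda>_. borel :: 'a measure"
    by (rule Ionescu_Tulcea_chain_step[OF kern \<mu>])
  obtain gs f where fs: "fs = gs @ [f]" using Suc.prems(2) by (metis rev_exhaust)
  have len: "length gs = n" using Suc.hyps(2) fs by simp
  have f[measurable]: "f \<in> borel_measurable borel" using Suc.prems fs by auto
  have gsm: "gs ! i \<in> borel_measurable borel" if "i < n" for i
    using Suc.prems(1) fs len that nth_mem[of i gs] by auto
  have m: "(\<lambda>\<omega>. \<Prod>i<Suc n. (fs ! i) (\<omega> i)) \<in> borel_measurable (PiM {0..<Suc n} (\<lambda>_. borel))"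
  proof (intro borel_measurable_prod_ennreal)
    fix i assume "i \<in> {..<Suc n}"
    then have "fs ! i \<in> borel_measurable borel" using Suc.prems(1) Suc.hyps(2)[symmetric] nth_mem by auto
    then show "(\<lambda>\<omega>. (fs ! i) (\<omega> i)) \<in> borel_measurable (PiM {0..<Suc n} (\<lambda>_. borel))"
      by (rule measurable_compose[rotated])
        (use \<open>i \<in> {..<Suc n}\<close> in \<open>auto intro!: measurable_component_singleton\<close>)
  qed
  have fn: "fs ! i = gs ! i" if "i < n" for i using that fs len by (simp add: nth_append)
  have fl: "fs ! n = f" using fs len by (simp add: nth_append)
  have fsm: "chain_step P \<mu> n \<omega> \<in> space (subprob_algebra borel)" 
    if "\<omega> \<in> space (PiM {0..<n} (\<lambda>_. borel :: 'a measure))" for \<omega>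
    using measurable_space[OF P that] .
  have step: "(\<integral>\<^sup>+\<omega>. (\<Prod>i<Suc n. (fs ! i) (\<omega> i)) \<partial>C 0 (Suc n) (\<lambda>_. undefined))
    = (\<integral>\<^sup>+\<omega>. (\<Prod>i<n. (gs ! i) (\<omega> i)) * (\<integral>\<^sup>+z. f z \<partial>chain_step P \<mu> n \<omega>) \<partial>C 0 n (\<lambda>_. undefined))"
    (is "?l = ?r")
  proof -
    have 0: "(\<lambda>_. undefined) \<in> space (PiM {0..<(0::nat)} (\<lambda>_. borel :: 'a measure))"
      by (simp add: space_PiM PiE_iff)
    have "?l = (\<integral>\<^sup>+\<omega>. \<integral>\<^sup>+\<omega>'. (\<Prod>i<Suc n. (fs ! i) (\<omega>' i)) \<partial>eP n \<omega> \<partial>C 0 n (\<lambda>_. undefined))"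
      using m
      by (simp, intro nn_integral_bind[where B="PiM {0..<Suc n} (\<lambda>_. borel)"])
        (auto simp: measurable_cong_sets[OF sets_C[OF 0] refl])
    also have "\<dots> = ?r"
    proof (rule nn_integral_cong)
      fix \<omega> assume "\<omega> \<in> space (C 0 n (\<lambda>_. undefined :: 'a))"
      then have \<omega>: "\<omega> \<in> space (PiM {0..<n} (\<lambda>_. borel :: 'a measure))" using space_C[OF 0, of n] by simp
      have sets: "sets (chain_step P \<mu> n \<omega>) = sets borel" using sets_P[OF \<omega>] .
      have "(\<integral>\<^sup>+\<omega>'. (\<Prod>i<Suc n. (fs ! i) (\<omega>' i)) \<partial>eP n \<omega>)
        = (\<integral>\<^sup>+x. (\<Prod>i<Suc n. (fs ! i) (fun_upd \<omega> n x i)) \<partial>chain_step P \<mu> n \<omega>)"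
        by (rule nn_integral_eP[OF \<omega> m])
      also have "\<dots> = (\<integral>\<^sup>+x. (\<Prod>i<n. (gs ! i) (\<omega> i)) * f x \<partial>chain_step P \<mu> n \<omega>)"
        by (intro nn_integral_cong) (simp add: fl fn)
      also have "\<dots> = (\<Prod>i<n. (gs ! i) (\<omega> i)) * (\<integral>\<^sup>+z. f z \<partial>chain_step P \<mu> n \<omega>)"
        by (rule nn_integral_cmult) (simp add: measurable_cong_sets[OF sets refl])
      finally show "(\<integral>\<^sup>+\<omega>'. (\<Prod>i<Suc n. (fs ! i) (\<omega>' i)) \<partial>eP n \<omega>) = \<dots>" .
    qed
    finally show ?thesis .
  qed
  show ?case
  proof (cases n)
    case 0
    have "(\<integral>\<^sup>+\<omega>. (\<Prod>i<n. (gs ! i) (\<omega> i)) * (\<integral>\<^sup>+z. f z \<partial>chain_step P \<mu> n \<omega>) \<partial>C 0 n (\<lambda>_. undefined))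
      = (\<integral>\<^sup>+z. f z \<partial>\<mu>)"
      by (simp add: 0 chain_step_def nn_integral_return space_PiM sets_PiM_empty)
    moreover have "fs = [f]" using fs len 0 by simp
    ultimately show ?thesis
      using step Suc.hyps(2)[symmetric]
      by (simp only: cylinder_integral_singleton[OF kern])
  next
    case (Suc k)
    obtain hs h where gs: "gs = hs @ [h]" using len Suc by (metis length_0_conv nat.distinct(1) rev_exhaust)
    define h' where "h' = (\<lambda>z. h z * (\<integral>\<^sup>+z'. f z' \<partial>P z))"
    have hm[measurable]: "h \<in> borel_measurable borel" using Suc.prems fs gs by auto
    have h'm: "h' \<in> borel_measurable borel" unfolding h'_def
      using nn_integral_kernel_measurable[OF kern f] by simp
    have lenhs: "length hs = k" using len Suc gs by simp
    have "(\<integral>\<^sup>+\<omega>. (\<Prod>i<n. (gs ! i) (\<omega> i)) * (\<integral>\<^sup>+z. f z \<partial>chain_step P \<mu> n \<omega>) \<partial>C 0 n (\<lambda>_. undefined))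
      = (\<integral>\<^sup>+\<omega>. (\<Prod>i<length (hs @ [h']). ((hs @ [h']) ! i) (\<omega> i)) \<partial>C 0 (length (hs @ [h'])) (\<lambda>_. undefined))"
    proof -
      have "(\<Prod>i<n. (gs ! i) (\<omega> i)) * (\<integral>\<^sup>+z. f z \<partial>chain_step P \<mu> n \<omega>)
        = (\<Prod>i<length (hs @ [h']). ((hs @ [h']) ! i) (\<omega> i))" for \<omega>
        using lenhs Suc by (simp add: gs nth_append chain_step_def h'_def mult.assoc)
      then show ?thesis using lenhs Suc by simp
    qed
    also have "\<dots> = (\<integral>\<^sup>+z. cylinder_integral P (hs @ [h']) z \<partial>\<mu>)"
      using Suc.hyps(1)[of "hs @ [h']"] lenhs Suc h'm Suc.prems fs gs by simp
    also have "cylinder_integral P (hs @ [h']) = cylinder_integral P fs"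
      unfolding h'_def by (rule cylinder_integral_snoc[OF kern, symmetric]) (simp add: fs gs)
    finally show ?thesis using step Suc.hyps(2)[symmetric] by simp
  qed
qed

lemma chain_law_prob:
  fixes P :: "'a::topological_space \<Rightarrow> 'a measure"
  assumes kern: "markov_kernel P" and \<mu>: "borel_prob \<mu>"
  shows "sets (chain_law P \<mu>) = sets (PiM UNIV (\<lambda>_. borel))" "prob_space (chain_law P \<mu>)"
proof -
  interpret Ionescu_Tulcea "chain_step P \<mu>" "\<lambda>_. borel :: 'a measure"
    by (rule Ionescu_Tulcea_chain_step[OF kern \<mu>])
  show *: "sets (chain_law P \<mu>) = sets (PiM UNIV (\<lambda>_. borel))"
    unfolding chain_law_def by (rule PF.sets_lim)
  interpret prob_space "CI {}" by (rule PF.prob_space_P) simp_all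
  have "emeasure PF.lim (PF.emb UNIV {} (space (PiM {} (\<lambda>_. borel :: 'a measure)))) = emeasure (CI {}) (space (PiM {} (\<lambda>_. borel)))"
    by (rule lim) auto
  also have "\<dots> = 1" using emeasure_space_1 by (simp add: CI_def)
  also have "PF.emb UNIV {} (space (PiM {} (\<lambda>_. borel :: 'a measure))) = UNIV"
    by (auto simp: prod_emb_def space_PiM)
  finally have "emeasure (chain_law P \<mu>) UNIV = 1" by (simp add: chain_law_def)
  moreover have "space (chain_law P \<mu>) = UNIV" using sets_eq_imp_space_eq[OF *] by (simp add: space_PiM)
  ultimately show "prob_space (chain_law P \<mu>)" by (intro prob_spaceI) simp
qed

lemma chain_law_cylinder:
  fixes P :: "'a::topological_space \<Rightarrow> 'a measure"
  assumes kern: "markov_kernel P" and \<mu>: "borel_prob \<mu>" and B: "\<And>i. B i \<in> sets borel"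
  shows "emeasure (chain_law P \<mu>) {\<omega>. \<forall>i<n. \<omega> i \<in> B i} =
    (\<integral>\<^sup>+z. cylinder_integral P (map (\<lambda>i. indicator (B i)) [0..<n]) z \<partial>\<mu>)"
proof (cases "n = 0")
  case True
  then show ?thesis
    using prob_space.emeasure_space_1[OF chain_law_prob(2)[OF kern \<mu>]] 
      sets_eq_imp_space_eq[OF chain_law_prob(1)[OF kern \<mu>]] \<mu>
    by (simp add: space_PiM borel_prob_def prob_space.emeasure_space_1)
next
  case False
  interpret Ionescu_Tulcea "chain_step P \<mu>" "\<lambda>_. borel :: 'a measure"
    by (rule Ionescu_Tulcea_chain_step[OF kern \<mu>])
  let ?fs = "map (\<lambda>i. indicator (B i) :: 'a \<Rightarrow> ennreal) [0..<n]"
  let ?X = "PiE {0..<n} B"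
  have X: "?X \<in> sets (PiM {0..<n} (\<lambda>_. borel))" using B by (intro sets_PiM_I_finite) auto
  have 0: "(\<lambda>_. undefined) \<in> space (PiM {0..<(0::nat)} (\<lambda>_. borel :: 'a measure))"
    by (simp add: space_PiM PiE_iff)
  have "{\<omega>. \<forall>i<n. \<omega> i \<in> B i} = PF.emb UNIV {0..<n} ?X"
    by (auto simp: prod_emb_def PiE_iff space_PiM)
  then have "emeasure (chain_law P \<mu>) {\<omega>. \<forall>i<n. \<omega> i \<in> B i} = emeasure (CI {0..<n}) ?X"
    unfolding chain_law_def using lim[of "{0..<n}" ?X] X by simp
  also have "\<dots> = emeasure (C 0 n (\<lambda>_. undefined)) ?X"
    using X by (subst emeasure_CI[of _ n]) (auto simp: prod_emb_def PiE_iff space_PiM intro!: arg_cong2[where f=emeasure])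
  also have "\<dots> = (\<integral>\<^sup>+\<omega>. indicator ?X \<omega> \<partial>C 0 n (\<lambda>_. undefined))"
    using X sets_C[OF 0, of n] by simp
  also have "\<dots> = (\<integral>\<^sup>+\<omega>. (\<Prod>i<length ?fs. (?fs ! i) (\<omega> i)) \<partial>C 0 (length ?fs) (\<lambda>_. undefined))"
  proof -
    have "indicator ?X \<omega> = (\<Prod>i<n. indicator (B i) (\<omega> i) :: ennreal)" 
      if "\<omega> \<in> space (C 0 n (\<lambda>_. undefined))" for \<omega>
    proof -
      have "\<omega> \<in> extensional {0..<n}" using that space_C[OF 0, of n] by (simp add: space_PiM PiE_iff)
      then show ?thesis
        by (cases "\<forall>i<n. \<omega> i \<in> B i") (auto simp: indicator_def PiE_iff prod_zero_iff)
    qed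
    then show ?thesis by (auto intro!: nn_integral_cong)
  qed
  also have "\<dots> = (\<integral>\<^sup>+z. cylinder_integral P ?fs z \<partial>\<mu>)"
    using False B by (intro Ionescu_Tulcea_cylinder[OF kern \<mu>]) auto
  finally show ?thesis .
qed

lemma prod_emb_eq_cylinder:
  assumes J: "finite J" and E: "\<forall>i\<in>J. E i \<in> sets (borel :: 'a::topological_space measure)"
  shows "\<exists>n B. (\<forall>i. B i \<in> sets (borel :: 'a measure)) \<and>
    prod_emb UNIV (\<lambda>_. borel :: 'a measure) J (PiE J E) = {\<omega>. \<forall>i<n::nat. \<omega> i \<in> B i}"
proof -
  obtain n where n: "J \<subseteq> {..<n}" using J finite_nat_iff_bounded by auto
  let ?B = "\<lambda>i. if i \<in> J then E i else UNIV"
  have "prod_emb UNIV (\<lambda>_. borel :: 'a measure) J (PiE J E) = {\<omega>. \<forall>i<n. \<omega> i \<in> ?B i}"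
    using n by (auto simp: prod_emb_def PiE_iff space_PiM subset_iff)
  moreover have "\<forall>i. ?B i \<in> sets borel" using E by simp
  ultimately show ?thesis by (intro exI[of _ n] exI[of _ ?B] conjI)
qed

lemma path_measure_eqI:
  fixes M N :: "(nat \<Rightarrow> 'a::topological_space) measure"
  assumes "sets M = sets (PiM UNIV (\<lambda>_. borel))" "sets N = sets (PiM UNIV (\<lambda>_. borel))"
    and "finite_measure M"
    and eq: "\<And>n B. (\<And>i. B i \<in> sets borel) \<Longrightarrow>
      emeasure M {\<omega>. \<forall>i<n. \<omega> i \<in> B i} = emeasure N {\<omega>. \<forall>i<n. \<omega> i \<in> B i}"
  shows "M = N"
proof (rule measure_eqI_PiM_infinite[OF assms(1,2) _ assms(3)])
  fix E :: "nat \<Rightarrow> 'a set" and J assume "finite J" "\<And>i. i \<in> J \<Longrightarrow> E i \<in> sets borel"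
  then have JE: "finite J" "\<forall>i\<in>J. E i \<in> sets borel" by auto
  from prod_emb_eq_cylinder[of J E, OF JE] obtain n B where
    B: "\<forall>i. B i \<in> sets (borel :: 'a measure)"
    and *: "prod_emb UNIV (\<lambda>_. borel :: 'a measure) J (PiE J E) = {\<omega>. \<forall>i<n::nat. \<omega> i \<in> B i}"
    by (elim exE conjE) (rule that)
  show "emeasure M (prod_emb UNIV (\<lambda>_. borel) J (PiE J E)) =
    emeasure N (prod_emb UNIV (\<lambda>_. borel) J (PiE J E))"
    unfolding * using B by (intro eq[of B n]) simp
qed

definition chain_from :: "('a::topological_space \<Rightarrow> 'a measure) \<Rightarrow> 'a \<Rightarrow> (nat \<Rightarrow> 'a) measure" where
  "chain_from P z = chain_law P (return borel z)"

lemma borel_prob_return: "borel_prob (return borel z)"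
  by (simp add: borel_prob_def prob_space_return)

lemma chain_from_prob:
  assumes "markov_kernel P"
  shows "sets (chain_from P z) = sets (PiM UNIV (\<lambda>_. borel))" "prob_space (chain_from P z)"
  unfolding chain_from_def by (rule chain_law_prob[OF assms borel_prob_return])+

text \<open>Cylinder probabilities are measurable in the starting point and cylinders generate the
  path space, so the laws of the chains started at points form a kernel.\<close>

lemma chain_from_measurable:
  assumes P: "markov_kernel P"
  shows "chain_from P \<in> borel \<rightarrow>\<^sub>M prob_algebra (PiM UNIV (\<lambda>_. borel))"
proof (rule measurable_prob_algebra_generated[OF sets_PiM Int_stable_prod_algebra prod_algebra_sets_into_space])
  fix A :: "(nat \<Rightarrow> 'a) set" assume "A \<in> prod_algebra UNIV (\<lambda>_. borel)"
  then obtain J E where AE: "A = prod_emb UNIV (\<lambda>_. borel :: 'a measure) J (PiE J E)"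
    and "finite J" "\<And>i. i \<in> J \<Longrightarrow> E i \<in> sets (borel :: 'a measure)"
    by (rule prod_algebraE) (rule that, assumption, assumption, blast)
  then have JE: "finite J" "\<forall>i\<in>J. E i \<in> sets (borel :: 'a measure)" by auto
  from prod_emb_eq_cylinder[of J E, OF JE] obtain n B where
    B': "\<forall>i. B i \<in> sets (borel :: 'a measure)"
    and *: "prod_emb UNIV (\<lambda>_. borel :: 'a measure) J (PiE J E) = {\<omega>. \<forall>i<n::nat. \<omega> i \<in> B i}"
    by (elim exE conjE) (rule that)
  have A: "A = {\<omega>. \<forall>i<n. \<omega> i \<in> B i}" unfolding AE * ..
  from B' have B: "B i \<in> sets borel" for i by simp
  have m: "cylinder_integral P (map (\<lambda>i. indicator (B i)) [0..<n]) \<in> borel_measurable borel"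
    using B by (intro cylinder_integral_measurable[OF P]) auto
  have "emeasure (chain_from P z) A = cylinder_integral P (map (\<lambda>i. indicator (B i)) [0..<n]) z" for z
    unfolding chain_from_def A chain_law_cylinder[OF P borel_prob_return B]
    by (rule nn_integral_return) (use m in auto)
  then show "(\<lambda>z. emeasure (chain_from P z) A) \<in> borel_measurable borel" using m by simp
qed (use chain_from_prob[OF P] in auto)

lemma chain_from_measurable_subprob:
  assumes P: "markov_kernel P"
  shows "chain_from P \<in> borel \<rightarrow>\<^sub>M subprob_algebra (PiM UNIV (\<lambda>_. borel))"
  by (rule measurable_prob_algebraD[OF chain_from_measurable[OF P]])

lemma borel_probD:
  assumes "borel_prob \<mu>"
  shows "prob_space \<mu>" "sets \<mu> = sets borel" "space \<mu> = UNIV"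
  using assms sets_eq_imp_space_eq[of \<mu> borel] by (auto simp: borel_prob_def)

lemma chain_law_eq_bind:
  assumes P: "markov_kernel P" and \<mu>: "borel_prob \<mu>"
  shows "chain_law P \<mu> = \<mu> \<bind> chain_from P"
proof (rule path_measure_eqI)
  have m: "chain_from P \<in> \<mu> \<rightarrow>\<^sub>M subprob_algebra (PiM UNIV (\<lambda>_. borel))"
    using chain_from_measurable_subprob[OF P] by (simp add: measurable_cong_sets[OF borel_probD(2)[OF \<mu>] refl])
  show "sets (\<mu> \<bind> chain_from P) = sets (PiM UNIV (\<lambda>_. borel))"
    using chain_from_prob[OF P] borel_probD[OF \<mu>] by (intro sets_bind) auto
  show "finite_measure (chain_law P \<mu>)"
    using chain_law_prob[OF P \<mu>] by (simp add: prob_space_def)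
  fix n and B :: "nat \<Rightarrow> 'a set" assume B: "\<And>i. B i \<in> sets borel"
  have c: "{\<omega>. \<forall>i<n. \<omega> i \<in> B i} \<in> sets (PiM UNIV (\<lambda>_. borel))"
  proof -
    have "{\<omega> \<in> space (PiM UNIV (\<lambda>_. borel)). \<forall>i<n. \<omega> i \<in> B i} \<in> sets (PiM UNIV (\<lambda>_. borel))"
      using B by measurable
    then show ?thesis by (simp add: space_PiM)
  qed
  have m': "cylinder_integral P (map (\<lambda>i. indicator (B i)) [0..<n]) \<in> borel_measurable borel"
    using B by (intro cylinder_integral_measurable[OF P]) auto
  have "emeasure (chain_from P z) {\<omega>. \<forall>i<n. \<omega> i \<in> B i} = cylinder_integral P (map (\<lambda>i. indicator (B i)) [0..<n]) z" for z
    unfolding chain_from_def chain_law_cylinder[OF P borel_prob_return B]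
    by (rule nn_integral_return) (use m' in auto)
  then show "emeasure (chain_law P \<mu>) {\<omega>. \<forall>i<n. \<omega> i \<in> B i} = emeasure (\<mu> \<bind> chain_from P) {\<omega>. \<forall>i<n. \<omega> i \<in> B i}"
    unfolding chain_law_cylinder[OF P \<mu> B]
    by (subst emeasure_bind[OF _ m c]) (use borel_probD[OF \<mu>] in auto)
qed (rule chain_law_prob[OF P \<mu>])

lemma nn_integral_chain_law:
  assumes P: "markov_kernel P" and \<mu>: "borel_prob \<mu>" and F: "F \<in> borel_measurable (PiM UNIV (\<lambda>_. borel))"
  shows "(\<integral>\<^sup>+\<omega>. F \<omega> \<partial>chain_law P \<mu>) = (\<integral>\<^sup>+z. \<integral>\<^sup>+\<omega>. F \<omega> \<partial>chain_from P z \<partial>\<mu>)"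
  unfolding chain_law_eq_bind[OF P \<mu>]
  by (rule nn_integral_bind[OF F])
    (simp add: measurable_cong_sets[OF borel_probD(2)[OF \<mu>] refl] chain_from_measurable_subprob[OF P])

definition splice_at :: "nat \<Rightarrow> (nat \<Rightarrow> 'a) \<Rightarrow> (nat \<Rightarrow> 'a) \<Rightarrow> nat \<Rightarrow> 'a" where
  "splice_at n \<omega> \<omega>' k = (if k < n then \<omega> k else \<omega>' (k - n))"

lemma splice_at_measurable:
  "(\<lambda>p. splice_at n (fst p) (snd p)) \<in> (PiM UNIV (\<lambda>_. borel) \<Otimes>\<^sub>M PiM UNIV (\<lambda>_. borel)) \<rightarrow>\<^sub>M PiM UNIV (\<lambda>_. borel :: 'a::topological_space measure)"
proof (rule measurable_PiM_single')
  fix k :: nat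
  show "(\<lambda>p. splice_at n (fst p) (snd p) k) \<in> (PiM UNIV (\<lambda>_. borel) \<Otimes>\<^sub>M PiM UNIV (\<lambda>_. borel)) \<rightarrow>\<^sub>M (borel :: 'a measure)"
    by (cases "k < n") (simp_all add: splice_at_def)
qed (simp add: space_PiM)

lemma case_nat_measurable:
  "(\<lambda>p. case_nat (fst p) (snd p)) \<in> (borel \<Otimes>\<^sub>M PiM UNIV (\<lambda>_. borel)) \<rightarrow>\<^sub>M PiM UNIV (\<lambda>_. borel :: 'a::topological_space measure)"
proof (rule measurable_PiM_single')
  fix k :: nat
  show "(\<lambda>p. case_nat (fst p) (snd p) k) \<in> (borel \<Otimes>\<^sub>M PiM UNIV (\<lambda>_. borel)) \<rightarrow>\<^sub>M (borel :: 'a measure)"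
    by (cases k) simp_all
qed (simp add: space_PiM)

lemma case_nat_measurable1:
  "case_nat z \<in> PiM UNIV (\<lambda>_. borel) \<rightarrow>\<^sub>M PiM UNIV (\<lambda>_. borel :: 'a::topological_space measure)"
  using measurable_compose[OF measurable_Pair1' case_nat_measurable, of z] by simp

text \<open>The Markov property at time 1. Both sides have the same cylinder probabilities, since the recursion
  of \<open>cylinder_integral\<close> is precisely a first step.\<close>

lemma chain_from_eq_step:
  assumes P: "markov_kernel P"
  shows "chain_from P z = distr (P z \<bind> chain_from P) (PiM UNIV (\<lambda>_. borel)) (case_nat z)"
proof (rule path_measure_eqI)
  have Pz: "borel_prob (P z)" using markov_kernelD[OF P] by (simp add: borel_prob_def)
  note Pbind = chain_law_eq_bind[OF P Pz, symmetric]
  show "finite_measure (chain_from P z)"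
    using chain_from_prob[OF P] by (simp add: prob_space_def)
  fix n and B :: "nat \<Rightarrow> 'a set" assume B: "\<And>i. B i \<in> sets borel"
  have c: "{\<omega>. \<forall>i<n. \<omega> i \<in> B i} \<in> sets (PiM UNIV (\<lambda>_. borel))"
    if [measurable]: "\<And>i. B i \<in> sets borel" for n and B :: "nat \<Rightarrow> 'a set"
  proof -
    have "{\<omega> \<in> space (PiM UNIV (\<lambda>_. borel)). \<forall>i<n. \<omega> i \<in> B i} \<in> sets (PiM UNIV (\<lambda>_. borel))"
      by measurable
    then show ?thesis by (simp add: space_PiM)
  qed
  have m': "cylinder_integral P (map (\<lambda>i. indicator (B i)) [0..<n]) \<in> borel_measurable borel"
    using B by (intro cylinder_integral_measurable[OF P]) auto
  have 1: "emeasure (chain_from P z) {\<omega>. \<forall>i<n. \<omega> i \<in> B i} = cylinder_integral P (map (\<lambda>i. indicator (B i)) [0..<n]) z" for z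
    unfolding chain_from_def chain_law_cylinder[OF P borel_prob_return B]
    by (rule nn_integral_return) (use m' in auto)
  have distr_prob: "prob_space (distr (P z \<bind> chain_from P) (PiM UNIV (\<lambda>_. borel)) (case_nat z))"
    unfolding Pbind using chain_law_prob[OF P Pz]
    by (intro prob_space.prob_space_distr) (simp_all add: measurable_cong_sets[OF chain_law_prob(1)[OF P Pz] refl] case_nat_measurable1)
  show "emeasure (chain_from P z) {\<omega>. \<forall>i<n. \<omega> i \<in> B i} =
    emeasure (distr (P z \<bind> chain_from P) (PiM UNIV (\<lambda>_. borel)) (case_nat z)) {\<omega>. \<forall>i<n. \<omega> i \<in> B i}"
  proof (cases n)
    case 0
    have "space (chain_from P z) = UNIV"
      using sets_eq_imp_space_eq[OF chain_from_prob(1)[OF P, of z]] by (simp add: space_PiM)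
    then show ?thesis
      using prob_space.emeasure_space_1[OF chain_from_prob(2)[OF P, of z]] prob_space.emeasure_space_1[OF distr_prob]
      by (simp add: 0 space_PiM)
  next
    case (Suc m)
    let ?B = "\<lambda>i. B (Suc i)"
    have vimage: "case_nat z -` {\<omega>. \<forall>i<Suc m. \<omega> i \<in> B i} = (if z \<in> B 0 then {\<omega>. \<forall>i<m. \<omega> i \<in> ?B i} else {})"
      by (auto simp: less_Suc_eq_0_disj)
    have upt: "map (\<lambda>i. indicator (B i) :: 'a \<Rightarrow> ennreal) [0..<Suc m] = indicator (B 0) # map (\<lambda>i. indicator (?B i)) [0..<m]"
      by (simp only: map_upt_Suc)
    have sp: "space (P z \<bind> chain_from P) = UNIV"
      unfolding Pbind using sets_eq_imp_space_eq[OF chain_law_prob(1)[OF P Pz]] by (simp add: space_PiM)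
    have "emeasure (distr (P z \<bind> chain_from P) (PiM UNIV (\<lambda>_. borel)) (case_nat z)) {\<omega>. \<forall>i<n. \<omega> i \<in> B i}
       = emeasure (P z \<bind> chain_from P) (case_nat z -` {\<omega>. \<forall>i<n. \<omega> i \<in> B i})"
      unfolding Pbind using c[OF B] sp[unfolded Pbind]
      by (subst emeasure_distr) (simp_all add: measurable_cong_sets[OF chain_law_prob(1)[OF P Pz] refl] case_nat_measurable1)
    also have "\<dots> = indicator (B 0) z * emeasure (P z \<bind> chain_from P) {\<omega>. \<forall>i<m. \<omega> i \<in> ?B i}"
      unfolding Suc vimage by simp
    also have "\<dots> = indicator (B 0) z * (\<integral>\<^sup>+z'. cylinder_integral P (map (\<lambda>i. indicator (?B i)) [0..<m]) z' \<partial>P z)"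
      unfolding Pbind by (subst chain_law_cylinder[OF P Pz]) (use B in auto)
    also have "\<dots> = emeasure (chain_from P z) {\<omega>. \<forall>i<n. \<omega> i \<in> B i}"
      using 1[of z] unfolding Suc upt by simp
    finally show ?thesis by simp
  qed
qed (simp_all add: chain_from_prob[OF P])


abbreviation path_space :: "(nat \<Rightarrow> 'a::topological_space) measure" where
  "path_space \<equiv> PiM UNIV (\<lambda>_. borel)"

lemma space_path_space [simp]: "space path_space = UNIV"
  by (simp add: space_PiM)

lemma chain_from_space: "markov_kernel P \<Longrightarrow> space (chain_from P z) = UNIV"
  using sets_eq_imp_space_eq[OF chain_from_prob(1)[of P z]] by simp

lemma chain_law_space: "markov_kernel P \<Longrightarrow> borel_prob \<mu> \<Longrightarrow> space (chain_law P \<mu>) = UNIV"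
  using sets_eq_imp_space_eq[OF chain_law_prob(1)[of P \<mu>]] by simp

lemma nn_integral_chain_from_measurable:
  assumes P: "markov_kernel P" and F: "F \<in> borel_measurable (borel \<Otimes>\<^sub>M path_space)"
  shows "(\<lambda>z. \<integral>\<^sup>+\<omega>. F (z, \<omega>) \<partial>chain_from P z) \<in> borel_measurable borel"
  by (rule nn_integral_measurable_subprob_algebra2[OF _ chain_from_measurable_subprob[OF P]])
    (use F in simp)

lemma nn_integral_chain_from_step:
  assumes P: "markov_kernel P" and F[measurable]: "F \<in> borel_measurable path_space"
  shows "(\<integral>\<^sup>+\<omega>. F \<omega> \<partial>chain_from P z) = (\<integral>\<^sup>+z'. \<integral>\<^sup>+\<omega>. F (case_nat z \<omega>) \<partial>chain_from P z' \<partial>P z)"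
proof -
  have Pz: "borel_prob (P z)" using markov_kernelD[OF P] by (simp add: borel_prob_def)
  note Pbind = chain_law_eq_bind[OF P Pz, symmetric]
  note [measurable] = case_nat_measurable1[of z]
  have "(\<integral>\<^sup>+\<omega>. F \<omega> \<partial>chain_from P z) = (\<integral>\<^sup>+\<omega>. F (case_nat z \<omega>) \<partial>chain_law P (P z))"
    by (subst chain_from_eq_step[OF P], unfold Pbind, rule nn_integral_distr)
      (simp_all add: measurable_cong_sets[OF chain_law_prob(1)[OF P Pz] refl] case_nat_measurable1)
  also have "\<dots> = (\<integral>\<^sup>+z'. \<integral>\<^sup>+\<omega>. F (case_nat z \<omega>) \<partial>chain_from P z' \<partial>P z)"
    by (rule nn_integral_chain_law[OF P Pz]) simp
  finally show ?thesis .
qed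

lemma nn_integral_chain_from_start:
  assumes P: "markov_kernel P" and f[measurable]: "f \<in> borel_measurable borel"
  shows "(\<integral>\<^sup>+\<omega>. f (\<omega> 0) \<partial>chain_from P z) = f z"
proof -
  have "(\<integral>\<^sup>+\<omega>. f (\<omega> 0) \<partial>chain_from P z) = (\<integral>\<^sup>+z'. \<integral>\<^sup>+\<omega>. f z \<partial>chain_from P z' \<partial>P z)"
    by (subst nn_integral_chain_from_step[OF P]) simp_all
  also have "\<dots> = f z"
    by (simp add: prob_space.emeasure_space_1 markov_kernelD[OF P] chain_from_prob[OF P]
        prob_space.emeasure_space_1[OF chain_from_prob(2)[OF P], unfolded chain_from_space[OF P]]
        prob_space.emeasure_space_1[OF markov_kernelD(3)[OF P], unfolded markov_kernelD(5)[OF P]]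
        chain_from_space[OF P])
  finally show ?thesis .
qed

lemma nn_integral_chain_law_start:
  assumes P: "markov_kernel P" and \<mu>: "borel_prob \<mu>" and f[measurable]: "f \<in> borel_measurable borel"
  shows "(\<integral>\<^sup>+\<omega>. f (\<omega> 0) \<partial>chain_law P \<mu>) = (\<integral>\<^sup>+z. f z \<partial>\<mu>)"
  by (subst nn_integral_chain_law[OF P \<mu>]) (simp_all add: nn_integral_chain_from_start[OF P f])

lemma nn_integral_splice_measurable:
  assumes P: "markov_kernel P" and F[measurable]: "F \<in> borel_measurable path_space"
  shows "(\<lambda>\<omega>. \<integral>\<^sup>+\<omega>'. F (splice_at n \<omega> \<omega>') \<partial>chain_from P (\<omega> n)) \<in> borel_measurable path_space"
proof (rule nn_integral_measurable_subprob_algebra2[where N=path_space])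
  show "(\<lambda>(x, y). F (splice_at n x y)) \<in> borel_measurable (path_space \<Otimes>\<^sub>M path_space)"
    using measurable_compose[OF splice_at_measurable F] by (simp add: case_prod_beta')
  show "(\<lambda>\<omega>. chain_from P (\<omega> n)) \<in> path_space \<rightarrow>\<^sub>M subprob_algebra path_space"
    by (rule measurable_compose[OF _ chain_from_measurable_subprob[OF P]]) simp
qed

lemma nn_integral_chain_from_splice:
  assumes P: "markov_kernel P" and F: "F \<in> borel_measurable path_space"
  shows "(\<integral>\<^sup>+\<omega>. F \<omega> \<partial>chain_from P z) =
    (\<integral>\<^sup>+\<omega>. \<integral>\<^sup>+\<omega>'. F (splice_at n \<omega> \<omega>') \<partial>chain_from P (\<omega> n) \<partial>chain_from P z)"
  using F
proof (induction n arbitrary: F z)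
  case 0
  have s: "splice_at 0 \<omega> \<omega>' = \<omega>'" for \<omega> \<omega>' :: "nat \<Rightarrow> 'a" by (intro ext) (simp add: splice_at_def)
  have "(\<lambda>z. \<integral>\<^sup>+\<omega>'. F \<omega>' \<partial>chain_from P z) \<in> borel_measurable borel"
    using nn_integral_chain_from_measurable[OF P, of "\<lambda>(z, \<omega>). F \<omega>"] 0 by simp
  from nn_integral_chain_from_start[OF P this]
  show ?case by (simp add: s)
next
  case (Suc n)
  note [measurable] = Suc.prems case_nat_measurable1
  have s: "splice_at (Suc n) (case_nat z \<omega>) \<omega>' = case_nat z (splice_at n \<omega> \<omega>')" for \<omega> \<omega>' :: "nat \<Rightarrow> 'a" and z
    by (rule ext) (simp add: splice_at_def split: nat.split)
  have "(\<integral>\<^sup>+\<omega>. F \<omega> \<partial>chain_from P z) = (\<integral>\<^sup>+z'. \<integral>\<^sup>+\<omega>. F (case_nat z \<omega>) \<partial>chain_from P z' \<partial>P z)"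
    by (rule nn_integral_chain_from_step[OF P Suc.prems])
  also have "\<dots> = (\<integral>\<^sup>+z'. \<integral>\<^sup>+\<omega>. \<integral>\<^sup>+\<omega>'. F (case_nat z (splice_at n \<omega> \<omega>')) \<partial>chain_from P (\<omega> n) \<partial>chain_from P z' \<partial>P z)"
    by (intro nn_integral_cong Suc.IH) simp
  also have "\<dots> = (\<integral>\<^sup>+\<omega>. \<integral>\<^sup>+\<omega>'. F (splice_at (Suc n) \<omega> \<omega>') \<partial>chain_from P (\<omega> (Suc n)) \<partial>chain_from P z)"
    using nn_integral_chain_from_step[OF P nn_integral_splice_measurable[OF P Suc.prems, of "Suc n"], of z]
    by (simp add: s)
  finally show ?case .
qed

text \<open>The Markov property at time \<open>n\<close>, in the form needed to compare the true future with a resampled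
  one: only the inner law is exchanged, the past is left alone.\<close>

lemma nn_integral_chain_law_splice:
  assumes P: "markov_kernel P" and \<mu>: "borel_prob \<mu>" and F: "F \<in> borel_measurable path_space"
  shows "(\<integral>\<^sup>+\<omega>. F \<omega> \<partial>chain_law P \<mu>) =
    (\<integral>\<^sup>+\<omega>. \<integral>\<^sup>+\<omega>'. F (splice_at n \<omega> \<omega>') \<partial>chain_from P (\<omega> n) \<partial>chain_law P \<mu>)"
  unfolding nn_integral_chain_law[OF P \<mu> F]
    nn_integral_chain_law[OF P \<mu> nn_integral_splice_measurable[OF P F]]
  by (intro nn_integral_cong nn_integral_chain_from_splice[OF P F])

lemma nn_integral_chain_law_marginal:
  assumes P: "markov_kernel P" and lam: "borel_prob lam" "lam \<bind> P = lam"
    and f: "f \<in> borel_measurable borel"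
  shows "(\<integral>\<^sup>+\<omega>. f (\<omega> n) \<partial>chain_law P lam) = (\<integral>\<^sup>+z. f z \<partial>lam)"
proof (induction n)
  case 0
  show ?case by (rule nn_integral_chain_law_start[OF P lam(1) f])
next
  case (Suc n)
  note [measurable] = f
  have Pm: "P \<in> lam \<rightarrow>\<^sub>M subprob_algebra borel"
    using markov_kernelD(2)[OF P] by (simp add: measurable_cong_sets[OF borel_probD(2)[OF lam(1)] refl])
  have m: "(\<lambda>z. \<integral>\<^sup>+\<omega>. f (\<omega> n) \<partial>chain_from P z) \<in> borel_measurable borel"
    using nn_integral_chain_from_measurable[OF P, of "\<lambda>(z, \<omega>). f (\<omega> n)"] by simp
  have "(\<integral>\<^sup>+\<omega>. f (\<omega> (Suc n)) \<partial>chain_law P lam)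
    = (\<integral>\<^sup>+z. \<integral>\<^sup>+z'. \<integral>\<^sup>+\<omega>. f (\<omega> n) \<partial>chain_from P z' \<partial>P z \<partial>lam)"
  proof (subst nn_integral_chain_law[OF P lam(1)])
    show "(\<integral>\<^sup>+z. \<integral>\<^sup>+\<omega>. f (\<omega> (Suc n)) \<partial>chain_from P z \<partial>lam)
      = (\<integral>\<^sup>+z. \<integral>\<^sup>+z'. \<integral>\<^sup>+\<omega>. f (\<omega> n) \<partial>chain_from P z' \<partial>P z \<partial>lam)"
      by (intro nn_integral_cong, subst nn_integral_chain_from_step[OF P]) simp_all
  qed simp
  also have "\<dots> = (\<integral>\<^sup>+z. \<integral>\<^sup>+\<omega>. f (\<omega> n) \<partial>chain_from P z \<partial>(lam \<bind> P))"
    by (rule nn_integral_bind[OF m Pm, symmetric])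
  also have "\<dots> = (\<integral>\<^sup>+\<omega>. f (\<omega> n) \<partial>chain_law P lam)"
    unfolding lam(2) by (simp add: nn_integral_chain_law[OF P lam(1)])
  finally show ?case using Suc by simp
qed

section \<open>Generating algebras, total variation and Lebesgue decomposition\<close>

text \<open>The sets that can be approximated for both measures at once form a \<open>\<sigma>\<close>-field. Both
  measures are approximated by the same set because total variation compares two laws on one event.\<close>

lemma algebra_approximation:
  assumes "finite_measure M" "finite_measure N" "space M = UNIV" "space N = UNIV"
    and alg: "algebra UNIV \<C>" and sub: "\<C> \<subseteq> sets M" "\<C> \<subseteq> sets N"
    and A: "A \<in> sigma_sets UNIV \<C>" and e: "0 < (e::real)"
  shows "\<exists>C\<in>\<C>. measure M ((A - C) \<union> (C - A)) < e \<and> measure N ((A - C) \<union> (C - A)) < e"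
proof -
  interpret M: finite_measure M by fact
  interpret N: finite_measure N by fact
  interpret algebra UNIV \<C> by fact
  have AM: "B \<in> sets M" "B \<in> sets N" if "B \<in> sigma_sets UNIV \<C>" for B
    using that sets.sigma_sets_subset[OF sub(1)] sets.sigma_sets_subset[OF sub(2)] assms(3,4) by auto
  show ?thesis using A e
  proof (induction A arbitrary: e)
    case (Basic a)
    then show ?case by (intro bexI[of _ a]) auto
  next
    case Empty
    then show ?case by (intro bexI[of _ "{}"]) auto
  next
    case (Compl a)
    then obtain C where "C \<in> \<C>" and *: "measure M ((a - C) \<union> (C - a)) < e \<and> measure N ((a - C) \<union> (C - a)) < e"
      by blast
    have "(UNIV - a) - (UNIV - C) \<union> ((UNIV - C) - (UNIV - a)) = (a - C) \<union> (C - a)" by auto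
    with * \<open>C \<in> \<C>\<close> show ?case by (intro bexI[of _ "UNIV - C"]) auto
  next
    case (Union a)
    let ?U = "\<Union>i. a i" and ?V = "\<lambda>n. \<Union>i<n. a i"
    have tail: "\<exists>n0. \<forall>n\<ge>n0. measure L (?U - ?V n) < e/2" if "finite_measure L" and L: "range a \<subseteq> sets L" for L
    proof -
      interpret L: finite_measure L by fact
      have "(\<lambda>n. measure L (?U - ?V n)) \<longlonglongrightarrow> measure L (\<Inter>n. ?U - ?V n)"
      proof (rule L.finite_Lim_measure_decseq)
        show "range (\<lambda>n. ?U - ?V n) \<subseteq> sets L" using L by auto
        show "antimono (\<lambda>n. ?U - ?V n)" by (rule antimonoI) fastforce
      qed
      also have "(\<Inter>n. ?U - ?V n) = {}" by auto
      finally have "(\<lambda>n. measure L (?U - ?V n)) \<longlonglongrightarrow> 0" by simp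
      from order_tendstoD(2)[OF this, of "e/2"] Union.prems show ?thesis
        by (simp add: eventually_sequentially)
    qed
    have aM: "range a \<subseteq> sets M" "range a \<subseteq> sets N" using AM Union.hyps by auto
    (* finitely many sets exhaust the union up to e/2 for both measures; the remaining e/2 is shared out *)
    obtain n1 n2 where n: "\<forall>n\<ge>n1. measure M (?U - ?V n) < e/2" "\<forall>n\<ge>n2. measure N (?U - ?V n) < e/2"
      using tail[OF assms(1) aM(1)] tail[OF assms(2) aM(2)] by blast
    define n where "n = Suc (max n1 n2)"
    have n': "measure M (?U - ?V n) < e/2" "measure N (?U - ?V n) < e/2" "0 < n"
      using n by (auto simp: n_def)
    have "0 < e / (2 * n)" using Union.prems n' by simp
    then have "\<exists>C\<in>\<C>. measure M ((a i - C) \<union> (C - a i)) < e/(2*n) \<and> measure N ((a i - C) \<union> (C - a i)) < e/(2*n)" for i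
      using Union.IH by blast
    then obtain C where C: "\<And>i. C i \<in> \<C>" "\<And>i. measure M ((a i - C i) \<union> (C i - a i)) < e/(2*n)"
      "\<And>i. measure N ((a i - C i) \<union> (C i - a i)) < e/(2*n)" by metis
    let ?C = "\<Union>i<n. C i"
    have CC: "?C \<in> \<C>" using C(1) by (intro finite_UN) auto
    have bound: "measure L ((?U - ?C) \<union> (?C - ?U)) < e"
      if "finite_measure L" and L: "range a \<subseteq> sets L" "\<C> \<subseteq> sets L" "measure L (?U - ?V n) < e/2"
        "\<And>i. measure L ((a i - C i) \<union> (C i - a i)) < e/(2*n)" for L
    proof -
      interpret L: finite_measure L by fact
      have [measurable]: "a i \<in> sets L" "C i \<in> sets L" for i using L C(1) by auto
      let ?D = "\<lambda>i. (a i - C i) \<union> (C i - a i)"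
      have "(?U - ?C) \<union> (?C - ?U) \<subseteq> (?U - ?V n) \<union> (\<Union>i<n. ?D i)" by auto
      then have "measure L ((?U - ?C) \<union> (?C - ?U)) \<le> measure L ((?U - ?V n) \<union> (\<Union>i<n. ?D i))"
        by (intro L.finite_measure_mono) auto
      also have "\<dots> \<le> measure L (?U - ?V n) + measure L (\<Union>i<n. ?D i)"
        by (intro measure_Un_le) auto
      also have "measure L (\<Union>i<n. ?D i) \<le> (\<Sum>i<n. measure L (?D i))"
        by (intro measure_UNION_le) auto
      also have "\<dots> \<le> (\<Sum>i<n. e/(2*n))" using L(4) by (intro sum_mono less_imp_le) auto
      also have "\<dots> = e/2" using n' by simp
      finally show ?thesis using L(3) by linarith
    qed
    show ?case
      using bound[OF assms(1) aM(1) sub(1) n'(1) C(2)] bound[OF assms(2) aM(2) sub(2) n'(2) C(3)] CC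
      by blast
  qed
qed

lemma countable_generating_algebra:
  fixes G :: "'a measure"
  assumes "countable C" "sets G = sigma_sets UNIV C"
  obtains \<C> where "countable \<C>" "algebra UNIV \<C>" "sets G = sigma_sets UNIV \<C>"
proof -
  define step :: "'a set set \<Rightarrow> 'a set set" where
    "step S = S \<union> (\<lambda>A. UNIV - A) ` S \<union> (\<lambda>(A, B). A \<union> B) ` (S \<times> S)" for S
  define \<C> where "\<C> = (\<Union>n. (step ^^ n) (insert {} C))"
  have c: "countable ((step ^^ n) (insert {} C))" for n
    by (induction n) (use assms(1) in \<open>auto simp: step_def\<close>)
  have mono: "(step ^^ n) (insert {} C) \<subseteq> (step ^^ m) (insert {} C)" if "n \<le> m" for n m
    using that by (induction rule: dec_induct) (auto simp: step_def)
  have "algebra UNIV \<C>"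
    unfolding algebra_iff_Un
  proof (intro conjI ballI)
    show "{} \<in> \<C>" unfolding \<C>_def by (rule UN_I[of 0]) auto
    show "UNIV - A \<in> \<C>" if A: "A \<in> \<C>" for A
    proof -
      obtain n where "A \<in> (step ^^ n) (insert {} C)" using A unfolding \<C>_def by blast
      then have "UNIV - A \<in> (step ^^ Suc n) (insert {} C)" by (auto simp: step_def)
      then show ?thesis unfolding \<C>_def by blast
    qed
    show "A \<union> B \<in> \<C>" if AB: "A \<in> \<C>" "B \<in> \<C>" for A B
    proof -
      obtain n m where "A \<in> (step ^^ n) (insert {} C)" "B \<in> (step ^^ m) (insert {} C)"
        using AB unfolding \<C>_def by blast
      then have "A \<in> (step ^^ (max n m)) (insert {} C)" "B \<in> (step ^^ (max n m)) (insert {} C)"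
        using mono[of n "max n m"] mono[of m "max n m"] by auto
      then have "A \<union> B \<in> (step ^^ Suc (max n m)) (insert {} C)" by (force simp: step_def)
      then show ?thesis unfolding \<C>_def by blast
    qed
  qed auto
  moreover have "(step ^^ n) (insert {} C) \<subseteq> sigma_sets UNIV C" for n
  proof (induction n)
    case (Suc n)
    interpret sigma_algebra UNIV "sigma_sets UNIV C" by (rule sigma_algebra_sigma_sets) simp
    show ?case using Suc by (auto simp: step_def)
  qed (auto intro: sigma_sets.intros)
  then have "\<C> \<subseteq> sigma_sets UNIV C" unfolding \<C>_def by blast
  then have "sigma_sets UNIV \<C> \<subseteq> sigma_sets UNIV C" by (rule sigma_sets_mono)
  moreover have "C \<subseteq> \<C>" unfolding \<C>_def by (rule subsetI, rule UN_I[of 0]) auto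
  then have "sigma_sets UNIV C \<subseteq> sigma_sets UNIV \<C>" by (rule sigma_sets_mono')
  ultimately show thesis using c assms(2) by (intro that[of \<C>]) (auto simp: \<C>_def)
qed

lemma tv_norm_upper:
  assumes "prob_space \<rho>" "prob_space \<rho>'" "A \<in> sets G"
  shows "\<bar>measure \<rho> A - measure \<rho>' A\<bar> \<le> tv_norm G \<rho> \<rho>' / 2"
proof -
  have "\<bar>measure \<rho> B - measure \<rho>' B\<bar> \<le> 1" for B
    using prob_space.prob_le_1[OF assms(1), of B] prob_space.prob_le_1[OF assms(2), of B]
      measure_nonneg[of \<rho> B] measure_nonneg[of \<rho>' B] by linarith
  then have "bdd_above ((\<lambda>A. \<bar>measure \<rho> A - measure \<rho>' A\<bar>) ` sets G)" by (intro bdd_aboveI2[of _ _ 1]) auto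
  from cSUP_upper[OF assms(3) this] show ?thesis by (simp add: tv_norm_def)
qed

lemma tv_norm_least:
  assumes "\<And>A. A \<in> sets G \<Longrightarrow> \<bar>measure \<rho> A - measure \<rho>' A\<bar> \<le> c"
  shows "tv_norm G \<rho> \<rho>' \<le> 2 * c"
  unfolding tv_norm_def using assms sets.empty_sets[of G] by (intro mult_left_mono cSUP_least) auto

lemma tv_norm_nonneg:
  assumes "prob_space \<rho>" "prob_space \<rho>'"
  shows "0 \<le> tv_norm G \<rho> \<rho>'"
  using tv_norm_upper[OF assms sets.empty_sets[of G]] by simp

lemma tv_norm_le_2:
  assumes "prob_space \<rho>" "prob_space \<rho>'"
  shows "tv_norm G \<rho> \<rho>' \<le> 2"
proof -
  have "\<bar>measure \<rho> B - measure \<rho>' B\<bar> \<le> 1" for B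
    using prob_space.prob_le_1[OF assms(1), of B] prob_space.prob_le_1[OF assms(2), of B]
      measure_nonneg[of \<rho> B] measure_nonneg[of \<rho>' B] by linarith
  then show ?thesis using tv_norm_least[of G \<rho> \<rho>' 1] by simp
qed

lemma tv_norm_mono:
  assumes "prob_space \<rho>" "prob_space \<rho>'" "sets G \<subseteq> sets G'"
  shows "tv_norm G \<rho> \<rho>' \<le> tv_norm G' \<rho> \<rho>'"
  using tv_norm_least[of G \<rho> \<rho>' "tv_norm G' \<rho> \<rho>' / 2"] tv_norm_upper[OF assms(1,2), of _ G'] assms(3) by force

text \<open>The events of a generating algebra approximate all others, so they determine the supremum; with a countable
  algebra, total variation distances between kernels become measurable.\<close>

lemma tv_norm_le_algebra:
  assumes "prob_space \<rho>" "prob_space \<rho>'" "space \<rho> = UNIV" "space \<rho>' = UNIV"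
    and "sets G \<subseteq> sets \<rho>" "sets G \<subseteq> sets \<rho>'"
    and \<C>: "algebra UNIV \<C>" "sets G = sigma_sets UNIV \<C>"
    and le: "\<And>A. A \<in> \<C> \<Longrightarrow> \<bar>measure \<rho> A - measure \<rho>' A\<bar> \<le> c"
  shows "tv_norm G \<rho> \<rho>' \<le> 2 * c"
proof (rule tv_norm_least, rule field_le_epsilon)
  fix A and e :: real assume A: "A \<in> sets G" and e: "0 < e"
  interpret \<rho>: prob_space \<rho> by fact
  interpret \<rho>': prob_space \<rho>' by fact
  have sub: "\<C> \<subseteq> sets G" using \<C>(2) by auto
  have "\<exists>C\<in>\<C>. measure \<rho> ((A - C) \<union> (C - A)) < e/2 \<and> measure \<rho>' ((A - C) \<union> (C - A)) < e/2"
    using A e \<C> assms sub by (intro algebra_approximation) (auto simp: \<rho>.finite_measure_axioms \<rho>'.finite_measure_axioms)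
  then obtain C where C: "C \<in> \<C>" "measure \<rho> ((A - C) \<union> (C - A)) < e/2" "measure \<rho>' ((A - C) \<union> (C - A)) < e/2"
    by blast
  have s: "A \<in> sets \<rho>" "C \<in> sets \<rho>" "A \<in> sets \<rho>'" "C \<in> sets \<rho>'" using A C sub assms by auto
  have "measure \<rho> A \<le> measure \<rho> C + e/2" "measure \<rho> C \<le> measure \<rho> A + e/2"
  proof -
    have "measure \<rho> A \<le> measure \<rho> (C \<union> ((A - C) \<union> (C - A)))" using s by (intro \<rho>.finite_measure_mono) auto
    also have "\<dots> \<le> measure \<rho> C + measure \<rho> ((A - C) \<union> (C - A))" using s by (intro measure_Un_le) auto
    finally show "measure \<rho> A \<le> measure \<rho> C + e/2" using C by linarith
    have "measure \<rho> C \<le> measure \<rho> (A \<union> ((A - C) \<union> (C - A)))" using s by (intro \<rho>.finite_measure_mono) auto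
    also have "\<dots> \<le> measure \<rho> A + measure \<rho> ((A - C) \<union> (C - A))" using s by (intro measure_Un_le) auto
    finally show "measure \<rho> C \<le> measure \<rho> A + e/2" using C by linarith
  qed
  moreover have "measure \<rho>' A \<le> measure \<rho>' C + e/2" "measure \<rho>' C \<le> measure \<rho>' A + e/2"
  proof -
    have "measure \<rho>' A \<le> measure \<rho>' (C \<union> ((A - C) \<union> (C - A)))" using s by (intro \<rho>'.finite_measure_mono) auto
    also have "\<dots> \<le> measure \<rho>' C + measure \<rho>' ((A - C) \<union> (C - A))" using s by (intro measure_Un_le) auto
    finally show "measure \<rho>' A \<le> measure \<rho>' C + e/2" using C by linarith
    have "measure \<rho>' C \<le> measure \<rho>' (A \<union> ((A - C) \<union> (C - A)))" using s by (intro \<rho>'.finite_measure_mono) auto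
    also have "\<dots> \<le> measure \<rho>' A + measure \<rho>' ((A - C) \<union> (C - A))" using s by (intro measure_Un_le) auto
    finally show "measure \<rho>' C \<le> measure \<rho>' A + e/2" using C by linarith
  qed
  ultimately show "\<bar>measure \<rho> A - measure \<rho>' A\<bar> \<le> c + e" using le[OF C(1)] by linarith
qed

lemma tv_norm_measurable:
  fixes \<Omega> :: "'b measure" and N G :: "'a measure"
  assumes K: "K \<in> \<Omega> \<rightarrow>\<^sub>M prob_algebra N" "K' \<in> \<Omega> \<rightarrow>\<^sub>M prob_algebra N"
    and N: "space N = UNIV" and G: "sets G \<subseteq> sets N" "countable C" "sets G = sigma_sets UNIV C"
  shows "(\<lambda>\<omega>. tv_norm G (K \<omega>) (K' \<omega>)) \<in> borel_measurable \<Omega>"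
proof -
  obtain \<C> where \<C>: "countable \<C>" "algebra UNIV \<C>" "sets G = sigma_sets UNIV \<C>"
    by (rule countable_generating_algebra[OF G(2,3)])
  have Kp: "prob_space (K \<omega>)" "sets (K \<omega>) = sets N" "prob_space (K' \<omega>)" "sets (K' \<omega>) = sets N"
    if "\<omega> \<in> space \<Omega>" for \<omega>
    using measurable_space[OF K(1) that] measurable_space[OF K(2) that] by (auto simp: space_prob_algebra)
  have sub: "\<C> \<subseteq> sets G" using \<C>(3) by auto
  have ne: "\<C> \<noteq> {}" using \<C>(2) by (auto simp: algebra_iff_Un)
  have "tv_norm G (K \<omega>) (K' \<omega>) = 2 * (SUP A\<in>\<C>. \<bar>measure (K \<omega>) A - measure (K' \<omega>) A\<bar>)" (is "_ = 2 * ?S")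
    if w: "\<omega> \<in> space \<Omega>" for \<omega>
  proof (rule antisym)
    have up: "\<bar>measure (K \<omega>) A - measure (K' \<omega>) A\<bar> \<le> tv_norm G (K \<omega>) (K' \<omega>) / 2" if "A \<in> \<C>" for A
      using sub that by (intro tv_norm_upper Kp[OF w]) auto
    show "tv_norm G (K \<omega>) (K' \<omega>) \<le> 2 * ?S"
    proof (rule tv_norm_le_algebra[OF Kp(1,3)[OF w] _ _ _ _ \<C>(2,3)])
      show "\<bar>measure (K \<omega>) A - measure (K' \<omega>) A\<bar> \<le> ?S" if "A \<in> \<C>" for A
        by (rule cSUP_upper[OF that], rule bdd_aboveI2[of _ _ "tv_norm G (K \<omega>) (K' \<omega>) / 2"], rule up)
    qed (use Kp[OF w] G(1) sets_eq_imp_space_eq[of "K \<omega>" N] sets_eq_imp_space_eq[of "K' \<omega>" N] N in auto)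
    have "?S \<le> tv_norm G (K \<omega>) (K' \<omega>) / 2" using ne up by (intro cSUP_least) auto
    then show "2 * ?S \<le> tv_norm G (K \<omega>) (K' \<omega>)" by simp
  qed
  moreover have "(\<lambda>\<omega>. 2 * (SUP A\<in>\<C>. \<bar>measure (K \<omega>) A - measure (K' \<omega>) A\<bar>)) \<in> borel_measurable \<Omega>"
  proof (intro borel_measurable_times borel_measurable_const borel_measurable_cSUP[OF \<C>(1)])
    fix A assume "A \<in> \<C>"
    then have [measurable]: "A \<in> sets N" using sub G(1) by auto
    note [measurable] = K
    show "(\<lambda>\<omega>. \<bar>measure (K \<omega>) A - measure (K' \<omega>) A\<bar>) \<in> borel_measurable \<Omega>" 
      using measurable_compose[OF K(1) measurable_measure_prob_algebra] measurable_compose[OF K(2) measurable_measure_prob_algebra] by simp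
  next
    fix \<omega> assume w: "\<omega> \<in> space \<Omega>"
    show "bdd_above ((\<lambda>A. \<bar>measure (K \<omega>) A - measure (K' \<omega>) A\<bar>) ` \<C>)"
      using tv_norm_upper[OF Kp(1,3)[OF w], where G=G] sub by (intro bdd_aboveI2[of _ _ "tv_norm G (K \<omega>) (K' \<omega>) / 2"]) auto
  qed
  ultimately show ?thesis by (subst measurable_cong) auto
qed

text \<open>The singular set is found by exhaustion: a null set of \<open>N\<close> of maximal \<open>M\<close>-mass. Off this set
  \<open>M\<close> is absolutely continuous, and the Radon-Nikodym theorem applies.\<close>

lemma Lebesgue_decomposition_finite:
  assumes "finite_measure M" "finite_measure N" and sets: "sets M = sets N"
  obtains D f where "D \<in> sets N" "emeasure N D = 0" "f \<in> borel_measurable N"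
    "\<And>A. A \<in> sets N \<Longrightarrow> emeasure M (A - D) = (\<integral>\<^sup>+x\<in>A. f x \<partial>N)"
proof -
  interpret M: finite_measure M by fact
  interpret N: finite_measure N by fact
  define Z where "Z = {D \<in> sets N. emeasure N D = 0}"
  define s where "s = (SUP D\<in>Z. measure M D)"
  have ne: "Z \<noteq> {}" unfolding Z_def by (auto intro: exI[of _ "{}"])
  have bdd: "bdd_above (measure M ` Z)" by (rule bdd_aboveI2, rule M.bounded_measure)
  have "\<exists>D. D \<in> Z \<and> s - 1 / Suc n < measure M D" for n :: nat
  proof -
    have "s - 1 / Suc n < s" by simp
    then show ?thesis unfolding s_def less_cSUP_iff[OF ne bdd] by blast
  qed
  then have "\<exists>E. \<forall>n. E n \<in> Z \<and> s - 1 / Suc n < measure M (E n)" by (intro choice) blast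
  then obtain E where E: "\<And>n. E n \<in> Z" "\<And>n. s - 1 / Suc n < measure M (E n)" by blast
  define D where "D = (\<Union>n. E n)"
  have D: "D \<in> Z" using E(1) emeasure_UN_eq_0[of N E] by (auto simp: D_def Z_def)
  have Dmax: "measure M (E n) \<le> measure M D" for n
    using E(1) D sets by (intro M.finite_measure_mono) (auto simp: D_def Z_def)
  have s_le: "s \<le> measure M D"
  proof (rule field_le_epsilon)
    fix e :: real assume "0 < e"
    then obtain n where "1 / Suc n < e" using nat_approx_posE by blast
    then show "s \<le> measure M D + e" using E(2)[of n] Dmax[of n] by linarith
  qed
  let ?M = "density M (indicator (space M - D))"
  have Dm: "D \<in> sets M" using D sets by (simp add: Z_def)
  have em: "emeasure ?M A = emeasure M (A - D)" if "A \<in> sets N" for A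
  proof -
    have "A \<in> sets M" using that sets by simp
    then have "emeasure ?M A = (\<integral>\<^sup>+x. indicator (space M - D) x * indicator A x \<partial>M)"
      using Dm by (intro emeasure_density) auto
    also have "\<dots> = (\<integral>\<^sup>+x. indicator (A - D) x \<partial>M)"
      by (intro nn_integral_cong) (auto split: split_indicator)
    finally show ?thesis using \<open>A \<in> sets M\<close> Dm by simp
  qed
  (* a null set with positive mass off D could be joined to D and would contradict maximality *)
  have "absolutely_continuous N ?M"
    unfolding absolutely_continuous_def
  proof
    fix A assume "A \<in> null_sets N"
    then have A: "A \<in> sets N" "emeasure N A = 0" by auto
    have "D \<in> null_sets N" "A \<in> null_sets N" using D A by (auto simp: Z_def intro: null_setsI)
    then have "D \<union> A \<in> null_sets N" by (rule null_sets.Un)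
    then have "D \<union> A \<in> Z" by (auto simp: Z_def)
    then have "measure M (D \<union> A) \<le> measure M D" using cSUP_upper[OF _ bdd, of "D \<union> A"] s_le unfolding s_def by simp
    moreover have "measure M (D \<union> A) = measure M D + measure M (A - D)"
      using A Dm sets by (subst M.finite_measure_Union[symmetric]) (auto intro!: arg_cong[where f="measure M"])
    ultimately have "measure M (A - D) = 0" using measure_nonneg[of M "A - D"] by linarith
    then show "A \<in> null_sets ?M" using em[OF A(1)] A(1) sets by (auto simp: M.emeasure_eq_measure null_sets_def)
  qed
  from N.density_RN_deriv[OF this] have RN: "density N (RN_deriv N ?M) = ?M" using sets by simp
  show thesis
  proof
    show "D \<in> sets N" "emeasure N D = 0" using D by (auto simp: Z_def)
    show "RN_deriv N ?M \<in> borel_measurable N" by simp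
    fix A assume A: "A \<in> sets N"
    then show "emeasure M (A - D) = (\<integral>\<^sup>+x\<in>A. RN_deriv N ?M x \<partial>N)"
      using em[OF A] emeasure_density[of "RN_deriv N ?M" N A] RN by simp
  qed
qed

section \<open>The \<sigma>-fields of observations and local tail coordinates\<close>

text \<open>One family covers all \<open>\<sigma>\<close>-fields in use: the observations at the times in \<open>I\<close> together with the local
  events at the times in \<open>J\<close>. The observation filtration, the local tails and their joins are
  the special cases below.\<close>

definition coord_field ::
  "'e set set \<Rightarrow> nat set \<Rightarrow> nat set \<Rightarrow> (nat \<Rightarrow> 'e::polish_space \<times> 'f::polish_space) measure" where
  "coord_field \<E> I J = sigma UNIV
     ({coord_Y k -` B | k B. k \<in> I \<and> B \<in> sets borel} \<union> {coord_X k -` A | k A. k \<in> J \<and> A \<in> \<E>})"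

lemma space_coord_field [simp]: "space (coord_field \<E> I J) = UNIV"
  by (simp add: coord_field_def)

lemma sets_coord_field:
  "sets (coord_field \<E> I J) = sigma_sets UNIV
     ({coord_Y k -` B | k B. k \<in> I \<and> B \<in> sets borel} \<union> {coord_X k -` A | k A. k \<in> J \<and> A \<in> \<E>})"
  by (simp add: coord_field_def)

lemma sigma_sets_Un_sigma_sets: "sigma_sets UNIV (sigma_sets UNIV A \<union> B) = sigma_sets UNIV (A \<union> B)"
proof (rule antisym)
  show "sigma_sets UNIV (sigma_sets UNIV A \<union> B) \<subseteq> sigma_sets UNIV (A \<union> B)"
    by (rule sigma_sets_mono) (auto intro: sigma_sets.Basic dest: sigma_sets_mono'[of A "A \<union> B", THEN subsetD, rotated])
qed (rule sigma_sets_mono', auto)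

lemma FY_eq_coord_field:
  "FY m n = (coord_field \<E> {k. m \<le> k \<and> enat k \<le> n} {} :: (nat \<Rightarrow> 'e::polish_space \<times> 'f::polish_space) measure)"
  unfolding FY_def coord_field_def by (rule arg_cong[where f="sigma UNIV"]) auto

lemma sets_F0_eq_coord_field:
  "sets (F0 \<E> m n :: (nat \<Rightarrow> 'e::polish_space \<times> 'f::polish_space) measure) =
    sets (coord_field \<E> {k. m \<le> k \<and> enat k \<le> n} {k. m \<le> k \<and> enat k \<le> n})"
proof -
  have "sets (FY m n :: (nat \<Rightarrow> 'e \<times> 'f) measure) =
    sigma_sets UNIV {coord_Y k -` B | k B. m \<le> k \<and> enat k \<le> n \<and> B \<in> sets borel}"
    unfolding FY_def by simp
  then have "sets (F0 \<E> m n :: (nat \<Rightarrow> 'e \<times> 'f) measure) =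
    sigma_sets UNIV ({coord_Y k -` B | k B. m \<le> k \<and> enat k \<le> n \<and> B \<in> sets borel} \<union>
     {coord_X k -` A | k A. m \<le> k \<and> enat k \<le> n \<and> A \<in> \<E>})"
    unfolding F0_def by (simp add: sigma_sets_Un_sigma_sets)
  also have "\<dots> = sets (coord_field \<E> {k. m \<le> k \<and> enat k \<le> n} {k. m \<le> k \<and> enat k \<le> n})"
    unfolding sets_coord_field by (rule arg_cong[where f="sigma_sets UNIV"]) auto
  finally show ?thesis .
qed

lemma sets_F0_infinity:
  "sets (F0 \<E> m \<infinity> :: (nat \<Rightarrow> 'e::polish_space \<times> 'f::polish_space) measure) = sets (coord_field \<E> {m..} {m..})"
  unfolding sets_F0_eq_coord_field by (simp add: atLeast_def)

lemma tv_norm_cong_sets: "sets G = sets G' \<Longrightarrow> tv_norm G \<rho> \<rho>' = tv_norm G' \<rho> \<rho>'"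
  by (simp add: tv_norm_def)

lemma coord_field_mono:
  "I \<subseteq> I' \<Longrightarrow> J \<subseteq> J' \<Longrightarrow> sets (coord_field \<E> I J) \<subseteq> sets (coord_field \<E> I' J')"
  unfolding sets_coord_field by (intro sigma_sets_mono' Un_mono Collect_mono) (force simp: subset_iff)+

lemma coord_Y_measurable_coord_field:
  "k \<in> I \<Longrightarrow> coord_Y k \<in> coord_field \<E> I J \<rightarrow>\<^sub>M borel"
  by (rule measurableI) (auto simp: sets_coord_field intro!: sigma_sets.Basic)

lemma coord_X_in_coord_field:
  "k \<in> J \<Longrightarrow> A \<in> \<E> \<Longrightarrow> coord_X k -` A \<in> sets (coord_field \<E> I J)"
  by (auto simp: sets_coord_field intro!: sigma_sets.Basic)

lemma measurable_coord_fieldI: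
  fixes f :: "'a \<Rightarrow> nat \<Rightarrow> 'e::polish_space \<times> 'f::polish_space"
  assumes Y: "\<And>k. k \<in> I \<Longrightarrow> (\<lambda>x. coord_Y k (f x)) \<in> M \<rightarrow>\<^sub>M borel"
    and X: "\<And>k A. k \<in> J \<Longrightarrow> A \<in> \<E> \<Longrightarrow> {x \<in> space M. coord_X k (f x) \<in> A} \<in> sets M"
  shows "f \<in> M \<rightarrow>\<^sub>M coord_field \<E> I J"
  unfolding coord_field_def
proof (rule measurable_measure_of)
  fix S :: "(nat \<Rightarrow> 'e \<times> 'f) set"
  assume "S \<in> {coord_Y k -` B | k B. k \<in> I \<and> B \<in> sets borel} \<union> {coord_X k -` A | k A. k \<in> J \<and> A \<in> \<E>}"
  then consider k B where "S = coord_Y k -` B" "k \<in> I" "B \<in> sets borel" | k A where "S = coord_X k -` A" "k \<in> J" "A \<in> \<E>"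
    by blast
  then show "f -` S \<inter> space M \<in> sets M"
  proof cases
    case 1
    have "f -` S \<inter> space M = (\<lambda>x. coord_Y k (f x)) -` B \<inter> space M" using 1 by auto
    then show ?thesis using measurable_sets[OF Y[OF 1(2)] 1(3)] by simp
  next
    case 2
    have "f -` S \<inter> space M = {x \<in> space M. coord_X k (f x) \<in> A}" using 2 by auto
    then show ?thesis using X[OF 2(2,3)] by simp
  qed
qed auto

lemma coord_Y_measurable: "coord_Y k \<in> (path_space :: (nat \<Rightarrow> 'e::polish_space \<times> 'f::polish_space) measure) \<rightarrow>\<^sub>M borel"
  unfolding coord_Y_def[abs_def] borel_prod[symmetric] by measurable

lemma coord_X_measurable: "coord_X k \<in> (path_space :: (nat \<Rightarrow> 'e::polish_space \<times> 'f::polish_space) measure) \<rightarrow>\<^sub>M borel"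
  unfolding coord_X_def[abs_def] borel_prod[symmetric] by measurable

lemma coord_field_subset_path_space:
  fixes \<E> :: "'e::polish_space set set"
  assumes "\<E> \<subseteq> sets borel"
  shows "sets (coord_field \<E> I J :: (nat \<Rightarrow> 'e \<times> 'f::polish_space) measure) \<subseteq> sets path_space"
proof -
  have "(\<lambda>\<omega>. \<omega>) \<in> (path_space :: (nat \<Rightarrow> 'e \<times> 'f) measure) \<rightarrow>\<^sub>M coord_field \<E> I J"
    using assms measurable_sets[OF coord_X_measurable]
    by (intro measurable_coord_fieldI coord_Y_measurable) (auto simp: vimage_def)
  from measurable_sets[OF this] show ?thesis by auto
qed

text \<open>Events only see the coordinates that generate them. This is what allows the evaluation of functions of
  the observations along arbitrary paths with the same observations.\<close>

lemma coord_field_saturated: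
  assumes "A \<in> sets (coord_field \<E> I J)"
    and "\<And>k. k \<in> I \<Longrightarrow> coord_Y k \<omega> = coord_Y k \<omega>'" "\<And>k. k \<in> J \<Longrightarrow> coord_X k \<omega> = coord_X k \<omega>'"
  shows "\<omega> \<in> A \<longleftrightarrow> \<omega>' \<in> A"
  using assms(1) unfolding sets_coord_field
  by induction (use assms(2,3) in auto)

lemma coord_field_countably_generated:
  fixes \<E> :: "'e::polish_space set set"
  assumes C: "countable C" "\<E> = sigma_sets UNIV C"
  shows "\<exists>C'. countable C' \<and> sets (coord_field \<E> I J :: (nat \<Rightarrow> 'e \<times> 'f::polish_space) measure) = sigma_sets UNIV C'"
proof -
  obtain \<B> :: "'f set set" where B: "countable \<B>" "topological_basis \<B>" using ex_countable_basis by blast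
  have bB: "(borel :: 'f measure) = sigma UNIV \<B>" by (rule borel_eq_countable_basis[OF B])
  let ?g = "{coord_Y k -` B | k B. k \<in> I \<and> B \<in> \<B>} \<union> {coord_X k -` A | k A. k \<in> J \<and> A \<in> C} :: (nat \<Rightarrow> 'e \<times> 'f) set set"
  have "?g = (\<lambda>(k, B). coord_Y k -` B) ` (I \<times> \<B>) \<union> (\<lambda>(k, A). coord_X k -` A) ` (J \<times> C)" by auto
  then have cg: "countable ?g" using B C by auto
  have Y: "coord_Y k \<in> sigma UNIV ?g \<rightarrow>\<^sub>M borel" if "k \<in> I" for k
    unfolding bB by (rule measurable_measure_of) (use that in \<open>auto intro!: sigma_sets.Basic\<close>)
  have X: "coord_X k \<in> sigma UNIV ?g \<rightarrow>\<^sub>M sigma UNIV C" if "k \<in> J" for k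
    by (rule measurable_measure_of) (use that in \<open>auto intro!: sigma_sets.Basic\<close>)
  have "sets (coord_field \<E> I J) = sigma_sets UNIV ?g"
  proof (rule antisym)
    show "sets (coord_field \<E> I J) \<subseteq> sigma_sets UNIV ?g"
      unfolding sets_coord_field
    proof (rule sigma_sets_mono, rule subsetI)
      fix S :: "(nat \<Rightarrow> 'e \<times> 'f) set"
      assume "S \<in> {coord_Y k -` B | k B. k \<in> I \<and> B \<in> sets borel} \<union> {coord_X k -` A | k A. k \<in> J \<and> A \<in> \<E>}"
      then consider k B where "S = coord_Y k -` B" "k \<in> I" "B \<in> sets borel" | k A where "S = coord_X k -` A" "k \<in> J" "A \<in> \<E>"
        by blast
      then show "S \<in> sigma_sets UNIV ?g"
      proof cases
        case 1
        then show ?thesis using measurable_sets[OF Y[OF 1(2)] 1(3)] by simp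
      next
        case 2
        then show ?thesis using measurable_sets[OF X[OF 2(2)], of A] C(2) by simp
      qed
    qed
    show "sigma_sets UNIV ?g \<subseteq> sets (coord_field \<E> I J)"
      unfolding sets_coord_field
    proof (rule sigma_sets_mono')
      have "\<B> \<subseteq> sets borel" unfolding bB by auto
      moreover have "C \<subseteq> \<E>" unfolding C(2) by auto
      ultimately show "?g \<subseteq> {coord_Y k -` B | k B. k \<in> I \<and> B \<in> sets borel} \<union> {coord_X k -` A | k A. k \<in> J \<and> A \<in> \<E>}"
        by (intro Un_mono Collect_mono) (force simp: subset_iff)+
    qed
  qed
  then show ?thesis using cg by blast
qed

lemma coord_splice_at:
  "coord_Y k (splice_at n \<omega> \<omega>') = (if k < n then coord_Y k \<omega> else coord_Y (k - n) \<omega>')"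
  "coord_X k (splice_at n \<omega> \<omega>') = (if k < n then coord_X k \<omega> else coord_X (k - n) \<omega>')"
  by (simp_all add: coord_Y_def coord_X_def splice_at_def)

text \<open>Before time \<open>n\<close> only observations enter, so the past is needed through its observations only;
  this makes the resampled averages below functions of the observations.\<close>

lemma splice_at_measurable_coord_field:
  fixes \<E> :: "'e::polish_space set set"
  shows "(\<lambda>p. splice_at n (fst p) (snd p)) \<in>
    (coord_field \<E> {..<n} {} \<Otimes>\<^sub>M coord_field \<E> UNIV {m..}) \<rightarrow>\<^sub>M
      (coord_field \<E> UNIV {n + m..} :: (nat \<Rightarrow> 'e \<times> 'f::polish_space) measure)"
proof (rule measurable_coord_fieldI)
  fix k
  show "(\<lambda>p. coord_Y k (splice_at n (fst p) (snd p))) \<in>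
    (coord_field \<E> {..<n} {} \<Otimes>\<^sub>M coord_field \<E> UNIV {m..}) \<rightarrow>\<^sub>M (borel :: 'f measure)"
  proof (cases "k < n")
    case True
    then show ?thesis
      by (simp add: coord_splice_at measurable_compose[OF measurable_fst coord_Y_measurable_coord_field[of k "{..<n}"]])
  next
    case False
    then show ?thesis
      by (simp add: coord_splice_at measurable_compose[OF measurable_snd coord_Y_measurable_coord_field[of "k - n" UNIV]])
  qed
next
  fix k A assume k: "k \<in> {n + m..}" and A: "A \<in> \<E>"
  have "{p \<in> space (coord_field \<E> {..<n} {} \<Otimes>\<^sub>M coord_field \<E> UNIV {m..}). coord_X k (splice_at n (fst p) (snd p)) \<in> A}
    = snd -` (coord_X (k - n) -` A) \<inter> space (coord_field \<E> {..<n} {} \<Otimes>\<^sub>M (coord_field \<E> UNIV {m..} :: (nat \<Rightarrow> 'e \<times> 'f) measure))"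
    using k by (auto simp: coord_splice_at)
  also have "\<dots> \<in> sets (coord_field \<E> {..<n} {} \<Otimes>\<^sub>M coord_field \<E> UNIV {m..})"
    using k A by (intro measurable_sets[OF measurable_snd] coord_X_in_coord_field) auto
  finally show "{p \<in> space (coord_field \<E> {..<n} {} \<Otimes>\<^sub>M (coord_field \<E> UNIV {m..} :: (nat \<Rightarrow> 'e \<times> 'f) measure)).
     coord_X k (splice_at n (fst p) (snd p)) \<in> A} \<in> sets (coord_field \<E> {..<n} {} \<Otimes>\<^sub>M coord_field \<E> UNIV {m..})" .
qed

lemma case_nat_measurable_coord_field:
  fixes \<E> :: "'e::polish_space set set"
  shows "case_nat z \<in> coord_field \<E> UNIV {m..} \<rightarrow>\<^sub>M
      (coord_field \<E> UNIV {Suc m..} :: (nat \<Rightarrow> 'e \<times> 'f::polish_space) measure)"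
proof -
  have "case_nat z = splice_at (Suc 0) (\<lambda>_. z)"
    by (intro ext) (simp add: splice_at_def split: nat.split)
  then show ?thesis
    using measurable_compose[OF measurable_Pair1' splice_at_measurable_coord_field[of 1 \<E> m], of "\<lambda>_. z"] by simp
qed

lemma shift_measurable_coord_field:
  fixes \<E> :: "'e::polish_space set set"
  shows "(\<lambda>\<omega> k. \<omega> (k + m)) \<in> coord_field \<E> {m..} {m..} \<rightarrow>\<^sub>M
      (coord_field \<E> UNIV {0..} :: (nat \<Rightarrow> 'e \<times> 'f::polish_space) measure)"
proof (rule measurable_coord_fieldI)
  fix k
  show "(\<lambda>\<omega>. coord_Y k (\<lambda>k. \<omega> (k + m) :: 'e \<times> 'f)) \<in> coord_field \<E> {m..} {m..} \<rightarrow>\<^sub>M borel"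
    using coord_Y_measurable_coord_field[of "k + m" "{m..}" \<E> "{m..}"] by (simp add: coord_Y_def[abs_def])
next
  fix k A assume "A \<in> \<E>"
  then show "{\<omega> \<in> space (coord_field \<E> {m..} {m..}). coord_X k (\<lambda>k. \<omega> (k + m) :: 'e \<times> 'f) \<in> A} \<in> sets (coord_field \<E> {m..} {m..})"
    using coord_X_in_coord_field[of "k + m" "{m..}" A \<E> "{m..}"] by (simp add: coord_X_def[abs_def] vimage_def)
qed

lemma shift_measurable: "(\<lambda>\<omega> k. \<omega> (k + m)) \<in> path_space \<rightarrow>\<^sub>M (path_space :: (nat \<Rightarrow> 'a::topological_space) measure)"
  by (rule measurable_PiM_single') simp_all

section \<open>Transfer of singularity from the local tail to the observations\<close>

text \<open>Given \<open>Y\<^sub>0 = y\<close>, the filter at time 0 is the law of a chain of this kind: the observed component starts at a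
  known point, the other one is random.\<close>

definition law_from :: "('e \<times> 'f \<Rightarrow> ('e \<times> 'f) measure) \<Rightarrow> 'e measure \<Rightarrow> 'f \<Rightarrow>
    (nat \<Rightarrow> 'e::polish_space \<times> 'f::polish_space) measure" where
  "law_from P \<alpha> y = \<alpha> \<bind> (\<lambda>x. chain_from P (x, y))"

lemma borel_Pair_measurable [measurable]:
  "(\<lambda>x. (x, y)) \<in> borel \<rightarrow>\<^sub>M (borel :: ('e::polish_space \<times> 'f::polish_space) measure)"
  "(\<lambda>y. (x, y)) \<in> borel \<rightarrow>\<^sub>M (borel :: ('e::polish_space \<times> 'f::polish_space) measure)"
  unfolding borel_prod[symmetric] by simp_all

lemma law_from_kernel:
  fixes P :: "'e::polish_space \<times> 'f::polish_space \<Rightarrow> ('e \<times> 'f) measure"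
  assumes P: "markov_kernel P"
  shows "(\<lambda>x. chain_from P (x, y)) \<in> borel \<rightarrow>\<^sub>M prob_algebra path_space"
  by (rule measurable_compose[OF borel_Pair_measurable(1) chain_from_measurable[OF P]])

lemma law_from_prob:
  fixes P :: "'e::polish_space \<times> 'f::polish_space \<Rightarrow> ('e \<times> 'f) measure"
  assumes P: "markov_kernel P" and \<alpha>: "borel_prob \<alpha>"
  shows "prob_space (law_from P \<alpha> y)" "sets (law_from P \<alpha> y) = sets path_space" "space (law_from P \<alpha> y) = UNIV"
proof -
  have \<alpha>': "\<alpha> \<in> space (prob_algebra borel)" using \<alpha> by (simp add: borel_prob_def space_prob_algebra)
  show "prob_space (law_from P \<alpha> y)" "sets (law_from P \<alpha> y) = sets path_space"
    unfolding law_from_def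
    using prob_space_bind'[OF \<alpha>' law_from_kernel[OF P]] sets_bind'[OF \<alpha>' law_from_kernel[OF P]] by auto
  from sets_eq_imp_space_eq[OF this(2)] show "space (law_from P \<alpha> y) = UNIV" by simp
qed

lemma nn_integral_law_from:
  fixes P :: "'e::polish_space \<times> 'f::polish_space \<Rightarrow> ('e \<times> 'f) measure"
  assumes P: "markov_kernel P" and \<alpha>: "borel_prob \<alpha>" and F: "F \<in> borel_measurable path_space"
  shows "(\<integral>\<^sup>+\<omega>. F \<omega> \<partial>law_from P \<alpha> y) = (\<integral>\<^sup>+x. \<integral>\<^sup>+\<omega>. F \<omega> \<partial>chain_from P (x, y) \<partial>\<alpha>)"
  unfolding law_from_def
  by (rule nn_integral_bind[OF F])
    (simp add: measurable_cong_sets[OF borel_probD(2)[OF \<alpha>] refl] measurable_prob_algebraD[OF law_from_kernel[OF P]])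

lemma emeasure_law_from:
  fixes P :: "'e::polish_space \<times> 'f::polish_space \<Rightarrow> ('e \<times> 'f) measure"
  assumes P: "markov_kernel P" and \<alpha>: "borel_prob \<alpha>" and N: "N \<in> sets path_space"
  shows "emeasure (law_from P \<alpha> y) N = (\<integral>\<^sup>+x. emeasure (chain_from P (x, y)) N \<partial>\<alpha>)"
  using nn_integral_law_from[OF P \<alpha>, of "indicator N" y] N
  by (simp add: law_from_prob[OF P \<alpha>] chain_from_prob[OF P])

lemma law_from_measurable:
  fixes P :: "'e::polish_space \<times> 'f::polish_space \<Rightarrow> ('e \<times> 'f) measure"
  assumes P: "markov_kernel P" and \<alpha>: "borel_prob \<alpha>"
  shows "law_from P \<alpha> \<in> borel \<rightarrow>\<^sub>M prob_algebra path_space"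
  unfolding law_from_def[abs_def]
proof (rule measurable_bind_prob_space2[where N=borel])
  show "(\<lambda>x. \<alpha>) \<in> borel \<rightarrow>\<^sub>M prob_algebra borel"
    using \<alpha> by (simp add: borel_prob_def space_prob_algebra)
  have "(\<lambda>p. (snd p, fst p)) \<in> borel \<Otimes>\<^sub>M borel \<rightarrow>\<^sub>M (borel :: ('e \<times> 'f) measure)"
    unfolding borel_prod[symmetric] by simp
  from measurable_compose[OF this chain_from_measurable[OF P]]
  show "(\<lambda>(x, y). chain_from P (y, x)) \<in> borel \<Otimes>\<^sub>M borel \<rightarrow>\<^sub>M prob_algebra path_space"
    by (simp add: case_prod_beta')
qed

lemma markov_kernel_bind_borel_prob:
  assumes "markov_kernel P0" "borel_prob \<alpha>"
  shows "borel_prob (\<alpha> \<bind> P0)"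
proof -
  have "\<alpha> \<in> space (prob_algebra borel)" using assms(2) by (simp add: borel_prob_def space_prob_algebra)
  from prob_space_bind'[OF this markov_kernelD(1)[OF assms(1)]] sets_bind'[OF this markov_kernelD(1)[OF assms(1)]]
  show ?thesis by (auto simp: borel_prob_def)
qed

text \<open>Nondegeneracy makes one step of the chain equivalent to independent moves of the two components.
  If the event depends on \<open>X\<^sub>0\<close> no longer, then a null set after a mixed start is described by the
  moves of \<open>Y\<close> alone, with \<open>X\<^sub>1\<close> averaged out. Only null sets are compared, so that the density \<open>g\<close>
  disappears after each step.\<close>

lemma law_from_null_step:
  fixes P :: "'e::polish_space \<times> 'f::polish_space \<Rightarrow> ('e \<times> 'f) measure"
  assumes P: "markov_kernel P" and P0: "markov_kernel P0" and Q: "markov_kernel Q"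
    and g: "g \<in> borel_measurable borel" "\<And>z. 0 < (g z :: real)"
    and dens: "\<And>x y. P (x, y) = density (P0 x \<Otimes>\<^sub>M Q y) (\<lambda>(x', y'). ennreal (g (x, y, x', y')))"
    and \<alpha>: "borel_prob \<alpha>"
    and N: "N \<in> sets path_space" and sec: "\<And>x. case_nat (x, y) -` N = S"
  shows "emeasure (law_from P \<alpha> y) N = 0 \<longleftrightarrow> (AE y' in Q y. emeasure (law_from P (\<alpha> \<bind> P0) y') S = 0)"
proof -
  have S: "S \<in> sets path_space"
    using measurable_sets[OF case_nat_measurable1 N, of "(undefined, y)"] sec by simp
  define \<phi> where "\<phi> z = emeasure (chain_from P z) S" for z
  have \<phi>[measurable]: "\<phi> \<in> borel_measurable borel"
    unfolding \<phi>_def by (rule measurable_compose[OF chain_from_measurable_subprob[OF P] measurable_emeasure_subprob_algebra[OF S]])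
  have \<phi>2[measurable]: "\<phi> \<in> borel_measurable (borel \<Otimes>\<^sub>M borel)" using \<phi> by (simp add: borel_prod)
  let ?R = "\<alpha> \<bind> P0"
  have R: "borel_prob ?R" by (rule markov_kernel_bind_borel_prob[OF P0 \<alpha>])
  interpret R: prob_space ?R using borel_probD(1)[OF R] .
  interpret Qy: prob_space "Q y" using markov_kernelD(3)[OF Q] .
  interpret pair_sigma_finite ?R "Q y" ..
  have [measurable_cong]: "sets (Q y) = sets borel" for y using markov_kernelD(4)[OF Q] .
  have [measurable_cong]: "sets (P0 x) = sets borel" for x using markov_kernelD(4)[OF P0] .
  have [measurable_cong]: "sets ?R = sets borel" using borel_probD(2)[OF R] .
  have [measurable_cong]: "sets \<alpha> = sets borel" using borel_probD(2)[OF \<alpha>] .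
  have inner: "(\<integral>\<^sup>+z. \<phi> z \<partial>P (x, y)) = 0 \<longleftrightarrow> (\<integral>\<^sup>+z. \<phi> z \<partial>(P0 x \<Otimes>\<^sub>M Q y)) = 0" for x
  proof -
    have gm: "(\<lambda>(x', y'). ennreal (g (x, y, x', y'))) \<in> borel_measurable (P0 x \<Otimes>\<^sub>M Q y)"
    proof -
      have "(\<lambda>p. (x, y, fst p, snd p)) \<in> borel \<Otimes>\<^sub>M borel \<rightarrow>\<^sub>M (borel :: ('e \<times> 'f \<times> 'e \<times> 'f) measure)"
        unfolding borel_prod[symmetric] by simp
      from measurable_compose[OF this g(1)] show ?thesis by (simp add: case_prod_beta')
    qed
    then have gm': "(\<lambda>p. ennreal (g (x, y, p))) \<in> borel_measurable (P0 x \<Otimes>\<^sub>M Q y)"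
      by (simp add: case_prod_beta')
    have "(\<integral>\<^sup>+z. \<phi> z \<partial>P (x, y)) = (\<integral>\<^sup>+z. (case z of (x', y') \<Rightarrow> ennreal (g (x, y, x', y'))) * \<phi> z \<partial>(P0 x \<Otimes>\<^sub>M Q y))"
      unfolding dens by (rule nn_integral_density[OF gm]) simp
    also have "\<dots> = 0 \<longleftrightarrow> (AE z in P0 x \<Otimes>\<^sub>M Q y. (case z of (x', y') \<Rightarrow> ennreal (g (x, y, x', y'))) * \<phi> z = 0)"
      using gm' by (intro nn_integral_0_iff_AE borel_measurable_times_ennreal) (simp_all add: case_prod_beta')
    also have "\<dots> \<longleftrightarrow> (AE z in P0 x \<Otimes>\<^sub>M Q y. \<phi> z = 0)"
    proof (intro AE_cong)
      have gpos: "ennreal (g z) \<noteq> 0" for z using g(2)[of z] by simp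
      show "(case z of (x', y') \<Rightarrow> ennreal (g (x, y, x', y'))) * \<phi> z = 0 \<longleftrightarrow> \<phi> z = 0" for z
        using gpos by (cases z) (simp add: gpos)
    qed
    also have "\<dots> \<longleftrightarrow> (\<integral>\<^sup>+z. \<phi> z \<partial>(P0 x \<Otimes>\<^sub>M Q y)) = 0"
      by (intro nn_integral_0_iff_AE[symmetric]) simp
    finally show ?thesis .
  qed
  have P0m: "P0 \<in> \<alpha> \<rightarrow>\<^sub>M subprob_algebra borel"
    using markov_kernelD(2)[OF P0] by (simp add: measurable_cong_sets[OF borel_probD(2)[OF \<alpha>] refl])
  have h: "(\<lambda>x'. \<integral>\<^sup>+y'. \<phi> (x', y') \<partial>Q y) \<in> borel_measurable borel"
    by (rule Qy.borel_measurable_nn_integral) (simp add: case_prod_beta')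
  have step: "emeasure (chain_from P (x, y)) N = (\<integral>\<^sup>+z. \<phi> z \<partial>P (x, y))" for x
  proof -
    have "emeasure (chain_from P (x, y)) N = (\<integral>\<^sup>+\<omega>. indicator N \<omega> \<partial>chain_from P (x, y))"
      using N by (simp add: chain_from_prob[OF P])
    also have "\<dots> = (\<integral>\<^sup>+z. \<integral>\<^sup>+\<omega>. indicator N (case_nat (x, y) \<omega>) \<partial>chain_from P z \<partial>P (x, y))"
      by (rule nn_integral_chain_from_step[OF P]) (use N in simp)
    also have "\<dots> = (\<integral>\<^sup>+z. \<integral>\<^sup>+\<omega>. indicator S \<omega> \<partial>chain_from P z \<partial>P (x, y))"
      using sec[of x] by (intro nn_integral_cong) (auto split: split_indicator)
    finally show ?thesis using S by (simp add: chain_from_prob[OF P] \<phi>_def)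
  qed
  have m1: "(\<lambda>x. \<integral>\<^sup>+z. \<phi> z \<partial>P (x, y)) \<in> borel_measurable \<alpha>"
    using measurable_compose[OF borel_Pair_measurable(1) nn_integral_kernel_measurable[OF P \<phi>], of y]
    by (simp add: measurable_cong_sets[OF borel_probD(2)[OF \<alpha>] refl])
  have eq2: "(\<integral>\<^sup>+z. \<phi> z \<partial>(P0 x \<Otimes>\<^sub>M Q y)) = (\<integral>\<^sup>+x'. \<integral>\<^sup>+y'. \<phi> (x', y') \<partial>Q y \<partial>P0 x)" for x
    by (rule Qy.nn_integral_fst[symmetric]) simp
  have m2: "(\<lambda>x. \<integral>\<^sup>+z. \<phi> z \<partial>(P0 x \<Otimes>\<^sub>M Q y)) \<in> borel_measurable \<alpha>"
    unfolding eq2 using nn_integral_kernel_measurable[OF P0 h]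
    by (simp add: measurable_cong_sets[OF borel_probD(2)[OF \<alpha>] refl])
  have "emeasure (law_from P \<alpha> y) N = 0 \<longleftrightarrow> (AE x in \<alpha>. (\<integral>\<^sup>+z. \<phi> z \<partial>P (x, y)) = 0)"
    unfolding emeasure_law_from[OF P \<alpha> N] step by (rule nn_integral_0_iff_AE[OF m1])
  also have "\<dots> \<longleftrightarrow> (\<integral>\<^sup>+x. \<integral>\<^sup>+z. \<phi> z \<partial>(P0 x \<Otimes>\<^sub>M Q y) \<partial>\<alpha>) = 0"
    unfolding inner by (rule nn_integral_0_iff_AE[OF m2, symmetric])
  also have "(\<integral>\<^sup>+x. \<integral>\<^sup>+z. \<phi> z \<partial>(P0 x \<Otimes>\<^sub>M Q y) \<partial>\<alpha>) = (\<integral>\<^sup>+x'. \<integral>\<^sup>+y'. \<phi> (x', y') \<partial>Q y \<partial>?R)"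
    unfolding eq2 by (rule nn_integral_bind[OF h P0m, symmetric])
  also have "\<dots> = (\<integral>\<^sup>+y'. \<integral>\<^sup>+x'. \<phi> (x', y') \<partial>?R \<partial>Q y)"
    by (rule Fubini'[symmetric]) (simp add: case_prod_beta')
  also have "\<dots> = (\<integral>\<^sup>+y'. emeasure (law_from P ?R y') S \<partial>Q y)"
    unfolding emeasure_law_from[OF P R S] \<phi>_def ..
  also have "\<dots> = 0 \<longleftrightarrow> (AE y' in Q y. emeasure (law_from P ?R y') S = 0)"
    using measurable_compose[OF measurable_prob_algebraD[OF law_from_measurable[OF P R]] measurable_emeasure_subprob_algebra[OF S]]
    by (intro nn_integral_0_iff_AE) simp
  finally show ?thesis .
qed

primrec kernel_iter :: "('a::topological_space \<Rightarrow> 'a measure) \<Rightarrow> nat \<Rightarrow> 'a \<Rightarrow> 'a measure" where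
  "kernel_iter Q 0 y = return borel y"
| "kernel_iter Q (Suc m) y = Q y \<bind> kernel_iter Q m"

primrec law_iter :: "('a::topological_space \<Rightarrow> 'a measure) \<Rightarrow> nat \<Rightarrow> 'a measure \<Rightarrow> 'a measure" where
  "law_iter P 0 \<alpha> = \<alpha>"
| "law_iter P (Suc m) \<alpha> = law_iter P m (\<alpha> \<bind> P)"

lemma markov_kernel_iter: "markov_kernel Q \<Longrightarrow> markov_kernel (kernel_iter Q m)"
proof (induction m)
  case 0
  have "kernel_iter Q 0 = return borel" by (rule ext) simp
  then show ?case by (simp add: markov_kernel_def)
next
  case (Suc m)
  have e: "kernel_iter Q (Suc m) = (\<lambda>y. Q y \<bind> kernel_iter Q m)" by (rule ext) simp
  show ?case
    unfolding markov_kernel_def e using Suc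
    by (intro measurable_bind_prob_space[where N=borel]) (auto simp: markov_kernel_def)
qed

lemma borel_prob_law_iter: "markov_kernel P \<Longrightarrow> borel_prob \<alpha> \<Longrightarrow> borel_prob (law_iter P m \<alpha>)"
  by (induction m arbitrary: \<alpha>) (auto intro: markov_kernel_bind_borel_prob)

lemma AE_kernel_iter_Suc:
  assumes Q: "markov_kernel Q" and p: "Measurable.pred borel p"
  shows "(AE y' in kernel_iter Q (Suc m) y. p y') \<longleftrightarrow> (AE y1 in Q y. AE y' in kernel_iter Q m y1. p y')"
  unfolding kernel_iter.simps
  by (rule AE_bind[OF _ p])
    (simp add: measurable_cong_sets[OF markov_kernelD(4)[OF Q] refl] markov_kernelD(2)[OF markov_kernel_iter[OF Q]])

lemma AE_kernel_iter_0:
  assumes p: "Measurable.pred borel p"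
  shows "(AE y' in kernel_iter Q 0 y. p y') \<longleftrightarrow> p y"
  unfolding kernel_iter.simps by (rule AE_return[OF _ p]) simp

lemma emeasure_law_from_measurable:
  fixes P :: "'e::polish_space \<times> 'f::polish_space \<Rightarrow> ('e \<times> 'f) measure"
  assumes P: "markov_kernel P" and \<alpha>: "borel_prob \<alpha>" and K: "K \<in> sets path_space"
  shows "(\<lambda>y. emeasure (law_from P \<alpha> y) K) \<in> borel_measurable borel"
  by (rule measurable_compose[OF measurable_prob_algebraD[OF law_from_measurable[OF P \<alpha>]] measurable_emeasure_subprob_algebra[OF K]])

lemma nn_integral_law_from_start:
  fixes P :: "'e::polish_space \<times> 'f::polish_space \<Rightarrow> ('e \<times> 'f) measure" and h :: "'f \<Rightarrow> ennreal"
  assumes P: "markov_kernel P" and \<alpha>: "borel_prob \<alpha>" and F[measurable]: "F \<in> borel_measurable path_space" and h[measurable]: "h \<in> borel_measurable borel"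
  shows "(\<integral>\<^sup>+\<omega>. h (coord_Y 0 \<omega>) * F \<omega> \<partial>law_from P \<alpha> y) = h y * (\<integral>\<^sup>+\<omega>. F \<omega> \<partial>law_from P \<alpha> y)"
proof -
  have Y[measurable]: "coord_Y 0 \<in> (path_space :: (nat \<Rightarrow> 'e \<times> 'f) measure) \<rightarrow>\<^sub>M borel" by (rule coord_Y_measurable)
  have m: "(\<lambda>\<omega>. h (coord_Y 0 \<omega>) * F \<omega>) \<in> borel_measurable path_space" by measurable
  have "(\<integral>\<^sup>+\<omega>. h (coord_Y 0 \<omega>) * F \<omega> \<partial>chain_from P (x, y)) = h y * (\<integral>\<^sup>+\<omega>. F \<omega> \<partial>chain_from P (x, y))" for x
  proof -
    have m2: "(\<lambda>\<omega>. h y * F \<omega>) \<in> borel_measurable path_space" by measurable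
    have "(\<integral>\<^sup>+\<omega>. h (coord_Y 0 \<omega>) * F \<omega> \<partial>chain_from P (x, y)) = (\<integral>\<^sup>+\<omega>. h y * F \<omega> \<partial>chain_from P (x, y))"
      unfolding nn_integral_chain_from_step[OF P m, of "(x, y)"] nn_integral_chain_from_step[OF P m2, of "(x, y)"]
      by (simp add: coord_Y_def)
    also have "\<dots> = h y * (\<integral>\<^sup>+\<omega>. F \<omega> \<partial>chain_from P (x, y))"
      by (rule nn_integral_cmult) (simp add: measurable_cong_sets[OF chain_from_prob(1)[OF P] refl])
    finally show ?thesis .
  qed
  moreover have "(\<lambda>x. \<integral>\<^sup>+\<omega>. F \<omega> \<partial>chain_from P (x, y)) \<in> borel_measurable \<alpha>"
    using measurable_compose[OF measurable_prob_algebraD[OF law_from_kernel[OF P]] nn_integral_measurable_subprob_algebra[OF F], of y]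
    by (simp add: measurable_cong_sets[OF borel_probD(2)[OF \<alpha>] refl])
  ultimately show ?thesis
    unfolding nn_integral_law_from[OF P \<alpha> m] nn_integral_law_from[OF P \<alpha> F]
    by (simp add: nn_integral_cmult)
qed

lemma nn_integral_eq_on_sets_imp_AE:
  assumes "sigma_finite_measure M" "u \<in> borel_measurable M" "v \<in> borel_measurable M"
    and eq: "\<And>A. A \<in> sets M \<Longrightarrow> (\<integral>\<^sup>+x. u x * indicator A x \<partial>M) = (\<integral>\<^sup>+x. v x * indicator A x \<partial>M)"
  shows "AE x in M. (u x :: ennreal) = v x"
proof (rule sigma_finite_measure.density_unique[OF assms(1-3)])
  show "density M u = density M v"
    by (rule measure_eqI) (simp_all add: emeasure_density assms)
qed

context
  fixes P :: "'e::polish_space \<times> 'f::polish_space \<Rightarrow> ('e \<times> 'f) measure" and P0 Q and g :: "'e \<times> 'f \<times> 'e \<times> 'f \<Rightarrow> real"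
  assumes P: "markov_kernel P" and P0: "markov_kernel P0" and Q: "markov_kernel Q"
    and g: "g \<in> borel_measurable borel" "\<And>z. 0 < g z"
    and dens: "\<And>x y. P (x, y) = density (P0 x \<Otimes>\<^sub>M Q y) (\<lambda>(x', y'). ennreal (g (x, y, x', y')))"
begin

lemmas null_step = law_from_null_step[OF P P0 Q g dens]

text \<open>Iterating the previous step: up to equivalence, \<open>Y\<^sub>m\<close> moves by the \<open>m\<close>-fold kernel \<open>Q\<close> and \<open>X\<^sub>m\<close> has,
  independently, the law \<open>\<alpha> P\<^sub>0\<^sup>m\<close>.\<close>

lemma law_from_null_shift:
  assumes \<alpha>: "borel_prob \<alpha>" and K: "K \<in> sets path_space"
  shows "emeasure (law_from P \<alpha> y) {\<omega>. (\<lambda>k. \<omega> (k + m)) \<in> K} = 0 \<longleftrightarrow>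
    (AE y' in kernel_iter Q m y. emeasure (law_from P (law_iter P0 m \<alpha>) y') K = 0)"
  using \<alpha>
proof (induction m arbitrary: \<alpha> y)
  case 0
  have "Measurable.pred borel (\<lambda>y'. emeasure (law_from P \<alpha> y') K = 0)"
    using emeasure_law_from_measurable[OF P 0 K] by simp
  from AE_kernel_iter_0[OF this, of Q y] show ?case by simp
next
  case (Suc m)
  let ?N = "\<lambda>m. {\<omega>. (\<lambda>k. \<omega> (k + m)) \<in> K}"
  have N: "?N m \<in> sets path_space" for m
    using measurable_sets[OF shift_measurable K, of m] by (simp add: vimage_def)
  note \<alpha>' = markov_kernel_bind_borel_prob[OF P0 Suc.prems]
  have "emeasure (law_from P \<alpha> y) (?N (Suc m)) = 0 \<longleftrightarrow> (AE y' in Q y. emeasure (law_from P (\<alpha> \<bind> P0) y') (?N m) = 0)"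
    by (rule null_step[OF Suc.prems N]) auto
  also have "\<dots> \<longleftrightarrow> (AE y' in kernel_iter Q (Suc m) y. emeasure (law_from P (law_iter P0 (Suc m) \<alpha>) y') K = 0)"
    unfolding Suc.IH[OF \<alpha>'] law_iter.simps
    using emeasure_law_from_measurable[OF P borel_prob_law_iter[OF P0 \<alpha>'] K]
    by (intro AE_kernel_iter_Suc[OF Q, symmetric]) simp
  finally show ?case .
qed

text \<open>Absolute continuity after time \<open>m\<close>, known for almost every value of \<open>Y\<^sub>m\<close>, is carried back through the
  first \<open>m\<close> steps. At each step the section of the event at the current observation is again an event
  of the same kind, one step shorter, and the intermediate observations have the same law under both starts.\<close>

lemma law_from_null_transfer:
  assumes \<E>: "\<E> \<subseteq> sets borel"
    and D: "D \<in> sets path_space" and U: "U \<in> sets borel"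
    and ac: "\<And>y' K. y' \<in> U \<Longrightarrow> K \<in> sets (coord_field \<E> UNIV {0..}) \<Longrightarrow>
      emeasure (law_from P \<beta>' y') K = 0 \<Longrightarrow> emeasure (law_from P \<alpha>' y') (K - D) = 0"
    and \<alpha>: "borel_prob \<alpha>" "law_iter P0 m \<alpha> = \<alpha>'" and \<beta>: "borel_prob \<beta>" "law_iter P0 m \<beta> = \<beta>'"
    and AE: "AE y' in kernel_iter Q m y. y' \<in> U"
    and N: "N \<in> sets (coord_field \<E> UNIV {m..})" "emeasure (law_from P \<beta> y) N = 0"
  shows "emeasure (law_from P \<alpha> y) (N - {\<omega>. (\<lambda>k. \<omega> (k + m)) \<in> D}) = 0"
  using \<alpha> \<beta> AE N
proof (induction m arbitrary: \<alpha> \<beta> y N)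
  case 0
  have "Measurable.pred borel (\<lambda>y'. y' \<in> U)" using U by simp
  from AE_kernel_iter_0[OF this, of Q y] 0 have "y \<in> U" by simp
  with ac[OF this, of N] 0 show ?case by simp
next
  case (Suc m)
  let ?D = "\<lambda>m. {\<omega>. (\<lambda>k. \<omega> (k + m)) \<in> D}"
  define S where "S = case_nat (undefined, y) -` N"
  have sec: "case_nat (x, y) -` N = S" for x
  proof -
    have "case_nat (x, y) \<omega> \<in> N \<longleftrightarrow> case_nat (undefined, y) \<omega> \<in> N" for \<omega>
      by (rule coord_field_saturated[OF Suc.prems(6)]) (auto simp: coord_X_def coord_Y_def split: nat.split)
    then show ?thesis by (auto simp: S_def)
  qed
  have S: "S \<in> sets (coord_field \<E> UNIV {m..})"
    using measurable_sets[OF case_nat_measurable_coord_field Suc.prems(6)] by (simp add: S_def)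
  have Dm: "?D m \<in> sets path_space" for m
    using measurable_sets[OF shift_measurable D, of m] by (simp add: vimage_def)
  have Np: "N \<in> sets path_space" using coord_field_subset_path_space[OF \<E>] Suc.prems(6) by blast
  note \<alpha>' = markov_kernel_bind_borel_prob[OF P0 Suc.prems(1)]
  note \<beta>' = markov_kernel_bind_borel_prob[OF P0 Suc.prems(3)]
  have 1: "AE y1 in Q y. emeasure (law_from P (\<beta> \<bind> P0) y1) S = 0"
    using null_step[OF Suc.prems(3) Np sec] Suc.prems(7) by simp
  have 2: "AE y1 in Q y. AE y' in kernel_iter Q m y1. y' \<in> U"
    using AE_kernel_iter_Suc[OF Q, of "\<lambda>y'. y' \<in> U" m y] Suc.prems(5) U by simp
  have "AE y1 in Q y. emeasure (law_from P (\<alpha> \<bind> P0) y1) (S - ?D m) = 0"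
    using 1 2
  proof eventually_elim
    case (elim y1)
    show ?case
      by (rule Suc.IH[OF \<alpha>' _ \<beta>' _ elim(2) S elim(1)]) (use Suc.prems in simp_all)
  qed
  moreover have "case_nat (x, y) -` (N - ?D (Suc m)) = S - ?D m" for x
    using sec[of x] by auto
  ultimately show ?case
    using null_step[OF Suc.prems(1) sets.Diff[OF Np Dm[of "Suc m"]], of y "S - ?D m"] by blast
qed

text \<open>Let \<open>D\<close> carry the part of the first law that is singular to the second one after time \<open>m\<close>, where only
  \<open>Y\<^sub>m\<close> and the local future are visible. Its mass is at most half the total variation distance on the local tail,
  as it is null for the second law. Off \<open>D\<close> there is a density, and disintegration over \<open>Y\<^sub>m\<close> turns it into
  absolute continuity for almost every value of \<open>Y\<^sub>m\<close>; by \<open>law_from_null_transfer\<close> this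
  persists when all of \<open>Y\<^sub>0, \<dots>, Y\<^sub>m\<close> is observed.\<close>

theorem singular_mass_le_tail_variation:
  assumes \<E>: "\<E> \<subseteq> sets borel" and C: "countable C" "\<E> = sigma_sets UNIV C"
    and \<alpha>: "borel_prob \<alpha>" and \<beta>: "borel_prob \<beta>"
    and N: "N \<in> sets (coord_field \<E> UNIV {m..})" "emeasure (law_from P \<beta> y) N = 0"
  shows "measure (law_from P \<alpha> y) N \<le>
    tv_norm (coord_field \<E> {m..} {m..}) (law_from P \<alpha> y) (law_from P \<beta> y) / 2"
proof -
  define T where "T = (coord_field \<E> UNIV {0..} :: (nat \<Rightarrow> 'e \<times> 'f) measure)"
  let ?q = "kernel_iter Q m y"
  define \<alpha>' \<beta>' where "\<alpha>' = law_iter P0 m \<alpha>" and "\<beta>' = law_iter P0 m \<beta>"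
  have p: "borel_prob \<alpha>'" "borel_prob \<beta>'"
    unfolding \<alpha>'_def \<beta>'_def by (intro borel_prob_law_iter P0 \<alpha> \<beta>)+
  have q: "prob_space ?q" "sets ?q = sets borel" using markov_kernelD[OF markov_kernel_iter[OF Q]] by auto
  interpret q: prob_space ?q by (rule q)
  have Tsub: "sets (coord_field \<E> I J :: (nat \<Rightarrow> 'e \<times> 'f) measure) \<subseteq> sets path_space" for I J
    by (rule coord_field_subset_path_space[OF \<E>])
  have TT: "sets T \<subseteq> sets path_space" and spT [simp]: "space T = UNIV" unfolding T_def by (rule Tsub) simp
  have kern: "law_from P a \<in> ?q \<rightarrow>\<^sub>M subprob_algebra path_space" if "borel_prob a" for a
    using measurable_prob_algebraD[OF law_from_measurable[OF P that]] by (simp add: measurable_cong_sets[OF q(2) refl])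
  have kernp: "law_from P a \<in> ?q \<rightarrow>\<^sub>M prob_algebra path_space" if "borel_prob a" for a
    using law_from_measurable[OF P that] by (simp add: measurable_cong_sets[OF q(2) refl])
  define ra rb where "ra = ?q \<bind> law_from P \<alpha>'" and "rb = ?q \<bind> law_from P \<beta>'"
  have qsp: "?q \<in> space (prob_algebra ?q)" using q by (simp add: space_prob_algebra)
  have r: "prob_space ra" "sets ra = sets path_space" "prob_space rb" "sets rb = sets path_space"
    unfolding ra_def rb_def
    using prob_space_bind'[OF qsp kernp[OF p(1)]] sets_bind'[OF qsp kernp[OF p(1)]]
      prob_space_bind'[OF qsp kernp[OF p(2)]] sets_bind'[OF qsp kernp[OF p(2)]] by auto
  have sub: "subalgebra ra T" "subalgebra rb T"
    using TT r sets_eq_imp_space_eq[OF r(2)] sets_eq_imp_space_eq[OF r(4)] by (auto simp: subalgebra_def)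
  have fin: "finite_measure (restr_to_subalg ra T)" "finite_measure (restr_to_subalg rb T)"
    using finite_measure_restr_to_subalg[OF sub(1)] finite_measure_restr_to_subalg[OF sub(2)] r(1,3)
    by (auto simp: prob_space_def)
  have sr: "sets (restr_to_subalg ra T) = sets T" "sets (restr_to_subalg rb T) = sets T"
    by (rule sets_restr_to_subalg[OF sub(1)], rule sets_restr_to_subalg[OF sub(2)])
  have srr: "sets (restr_to_subalg ra T) = sets (restr_to_subalg rb T)" unfolding sr ..
  obtain D f where D': "D \<in> sets (restr_to_subalg rb T)"
    and D0: "emeasure (restr_to_subalg rb T) D = 0"
    and f': "f \<in> borel_measurable (restr_to_subalg rb T)"
    and decomp: "\<And>A. A \<in> sets (restr_to_subalg rb T) \<Longrightarrow> emeasure (restr_to_subalg ra T) (A - D) = (\<integral>\<^sup>+x\<in>A. f x \<partial>restr_to_subalg rb T)"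
    by (rule Lebesgue_decomposition_finite[OF fin srr]) (rule that, assumption, assumption, assumption, blast)
  have D: "D \<in> sets T" using D' unfolding sr .
  have f: "f \<in> borel_measurable T" using f' unfolding measurable_cong_sets[OF sr(2) refl] .
  have Dp: "D \<in> sets path_space" using D TT by blast
  have fp[measurable]: "f \<in> borel_measurable path_space"
    by (rule measurable_from_subalg[OF _ f]) (use TT in \<open>simp add: subalgebra_def\<close>)
  have rb0: "emeasure rb D = 0" using D0 emeasure_restr_to_subalg[OF sub(2) D] by simp
  have decomp': "emeasure ra (A - D) = (\<integral>\<^sup>+x. f x * indicator A x \<partial>rb)" if A: "A \<in> sets T" for A
  proof -
    have "emeasure ra (A - D) = emeasure (restr_to_subalg ra T) (A - D)"
      using A D by (intro emeasure_restr_to_subalg[OF sub(1), symmetric]) auto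
    also have "\<dots> = (\<integral>\<^sup>+x\<in>A. f x \<partial>restr_to_subalg rb T)" by (rule decomp) (use A sr in simp)
    also have "\<dots> = (\<integral>\<^sup>+x. f x * indicator A x \<partial>rb)"
      using A f by (intro nn_integral_subalgebra2[OF sub(2)]) simp
    finally show ?thesis .
  qed
  have Y0: "coord_Y 0 -` B \<in> sets T" if "B \<in> sets borel" for B
    using measurable_sets[OF coord_Y_measurable_coord_field that, of 0 UNIV] by (simp add: T_def)
  (* test against the events Y_0 = y' in B, for which the laws started at y' are concentrated on one point *)
  have key: "AE y' in ?q. emeasure (law_from P \<alpha>' y') (K - D) = (\<integral>\<^sup>+x. f x * indicator K x \<partial>law_from P \<beta>' y')"
    if K: "K \<in> sets T" for K
  proof (rule nn_integral_eq_on_sets_imp_AE[OF q.sigma_finite_measure_axioms])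
    have Kp[measurable]: "K \<in> sets path_space" using K TT by blast
    note [measurable] = Dp
    show "(\<lambda>y'. emeasure (law_from P \<alpha>' y') (K - D)) \<in> borel_measurable ?q"
      using emeasure_law_from_measurable[OF P p(1), of "K - D"] by (simp add: measurable_cong_sets[OF q(2) refl])
    show "(\<lambda>y'. \<integral>\<^sup>+x. f x * indicator K x \<partial>law_from P \<beta>' y') \<in> borel_measurable ?q"
      by (rule measurable_compose[OF kern[OF p(2)] nn_integral_measurable_subprob_algebra]) simp
    fix B assume "B \<in> sets ?q"
    then have B[measurable]: "B \<in> sets borel" using q by simp
    let ?K = "K \<inter> coord_Y 0 -` B"
    have KB: "?K \<in> sets T" using K Y0[OF B] by blast
    have KBp[measurable]: "?K \<in> sets path_space" using KB TT by blast
    have "(\<integral>\<^sup>+y'. emeasure (law_from P \<alpha>' y') (K - D) * indicator B y' \<partial>?q) = (\<integral>\<^sup>+y'. emeasure (law_from P \<alpha>' y') (?K - D) \<partial>?q)"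
    proof (intro nn_integral_cong)
      fix y'
      have "emeasure (law_from P \<alpha>' y') (?K - D) = (\<integral>\<^sup>+\<omega>. indicator (?K - D) \<omega> \<partial>law_from P \<alpha>' y')"
        by (rule nn_integral_indicator[symmetric]) (simp add: law_from_prob[OF P p(1)])
      also have "\<dots> = (\<integral>\<^sup>+\<omega>. indicator B (coord_Y 0 \<omega>) * indicator (K - D) \<omega> \<partial>law_from P \<alpha>' y')"
        by (auto intro!: nn_integral_cong split: split_indicator)
      also have "\<dots> = indicator B y' * (\<integral>\<^sup>+\<omega>. indicator (K - D) \<omega> \<partial>law_from P \<alpha>' y')"
        by (rule nn_integral_law_from_start[OF P p(1)]) simp_all
      finally show "emeasure (law_from P \<alpha>' y') (K - D) * indicator B y' = emeasure (law_from P \<alpha>' y') (?K - D)"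
        by (simp add: law_from_prob[OF P p(1)] mult.commute)
    qed
    also have "\<dots> = emeasure ra (?K - D)"
      unfolding ra_def by (rule emeasure_bind[OF q.not_empty kern[OF p(1)], symmetric]) simp
    also have "\<dots> = (\<integral>\<^sup>+x. f x * indicator ?K x \<partial>rb)" by (rule decomp'[OF KB])
    also have "\<dots> = (\<integral>\<^sup>+y'. \<integral>\<^sup>+x. f x * indicator ?K x \<partial>law_from P \<beta>' y' \<partial>?q)"
      unfolding rb_def by (rule nn_integral_bind[OF _ kern[OF p(2)]]) simp
    also have "\<dots> = (\<integral>\<^sup>+y'. (\<integral>\<^sup>+x. f x * indicator K x \<partial>law_from P \<beta>' y') * indicator B y' \<partial>?q)"
    proof (intro nn_integral_cong)
      fix y'
      have "(\<integral>\<^sup>+x. f x * indicator ?K x \<partial>law_from P \<beta>' y') = (\<integral>\<^sup>+\<omega>. indicator B (coord_Y 0 \<omega>) * (f \<omega> * indicator K \<omega>) \<partial>law_from P \<beta>' y')"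
        by (auto intro!: nn_integral_cong split: split_indicator)
      also have "\<dots> = indicator B y' * (\<integral>\<^sup>+\<omega>. f \<omega> * indicator K \<omega> \<partial>law_from P \<beta>' y')"
        by (rule nn_integral_law_from_start[OF P p(2)]) simp_all
      finally show "(\<integral>\<^sup>+x. f x * indicator ?K x \<partial>law_from P \<beta>' y') = (\<integral>\<^sup>+x. f x * indicator K x \<partial>law_from P \<beta>' y') * indicator B y'"
        by (simp add: mult.commute)
    qed
    finally show "(\<integral>\<^sup>+y'. emeasure (law_from P \<alpha>' y') (K - D) * indicator B y' \<partial>?q) = 
      (\<integral>\<^sup>+y'. (\<integral>\<^sup>+x. f x * indicator K x \<partial>law_from P \<beta>' y') * indicator B y' \<partial>?q)" .
  qed
  have "\<exists>C'. countable C' \<and> sets T = sigma_sets UNIV C'"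
    unfolding T_def by (rule coord_field_countably_generated[OF C])
  then obtain C' where C': "countable C'" "sets T = sigma_sets UNIV C'" by (elim exE conjE) (rule that)
  obtain \<C> where \<C>: "countable \<C>" "algebra UNIV \<C>" "sets T = sigma_sets UNIV \<C>"
    by (rule countable_generating_algebra[OF C'])
  have \<C>T: "\<C> \<subseteq> sets T" unfolding \<C>(3) by auto
  (* the values of Y_m at which the density works for all events at once *)
  define U where "U = {y'. \<forall>K\<in>\<C>. emeasure (law_from P \<alpha>' y') (K - D) = (\<integral>\<^sup>+x. f x * indicator K x \<partial>law_from P \<beta>' y')}"
  have U: "U \<in> sets borel"
  proof -
    let ?V = "\<lambda>K. {y' \<in> space borel. emeasure (law_from P \<alpha>' y') (K - D) \<noteq> (\<integral>\<^sup>+x. f x * indicator K x \<partial>law_from P \<beta>' y')}"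
    have "?V K \<in> sets borel" if "K \<in> \<C>" for K
    proof -
      have Kp: "K \<in> sets path_space" using that \<C>T TT by blast
      have 1: "(\<lambda>y'. emeasure (law_from P \<alpha>' y') (K - D)) \<in> borel_measurable borel"
        using Kp Dp by (intro emeasure_law_from_measurable[OF P p(1)]) auto
      have 2: "(\<lambda>y'. \<integral>\<^sup>+x. f x * indicator K x \<partial>law_from P \<beta>' y') \<in> borel_measurable borel"
        by (rule measurable_compose[OF measurable_prob_algebraD[OF law_from_measurable[OF P p(2)]] nn_integral_measurable_subprob_algebra])
          (use Kp in simp)
      show "?V K \<in> sets borel" by (rule borel_measurable_neq[OF 1 2])
    qed
    then have "(\<Union>K\<in>\<C>. ?V K) \<in> sets borel" by (intro sets.countable_UN'' \<C>(1))
    from borel_comp[OF this] show ?thesis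
      by (rule back_subst[of "\<lambda>A. A \<in> sets borel"]) (auto simp: U_def)
  qed
  have AEU: "AE y' in ?q. y' \<in> U"
    unfolding U_def mem_Collect_eq AE_ball_countable[OF \<C>(1)]
  proof
    fix K assume "K \<in> \<C>"
    then have "K \<in> sets T" using \<C>T by (rule rev_subsetD)
    then show "AE y' in ?q. emeasure (law_from P \<alpha>' y') (K - D) = (\<integral>\<^sup>+x. f x * indicator K x \<partial>law_from P \<beta>' y')"
      by (rule key)
  qed
  have ac: "emeasure (law_from P \<alpha>' y') (K - D) = 0"
    if y': "y' \<in> U" and K: "K \<in> sets T" and null: "emeasure (law_from P \<beta>' y') K = 0" for y' K
  proof -
    let ?A = "law_from P \<alpha>' y'" and ?B = "law_from P \<beta>' y'"
    have subs: "subalgebra ?A T" "subalgebra ?B T" 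
      using TT by (auto simp: subalgebra_def law_from_prob[OF P p(1)] law_from_prob[OF P p(2)])
    let ?M = "density (restr_to_subalg ?A T) (indicator (UNIV - D))" and ?N = "density (restr_to_subalg ?B T) f"
    have sMN: "sets ?M = sets T" "sets ?N = sets T"
      by (simp_all add: sets_restr_to_subalg[OF subs(1)] sets_restr_to_subalg[OF subs(2)])
    have eM: "emeasure ?M L = emeasure ?A (L - D)" if L: "L \<in> sets T" for L
    proof -
      have "emeasure ?M L = (\<integral>\<^sup>+x. indicator (UNIV - D) x * indicator L x \<partial>restr_to_subalg ?A T)"
        using L D by (intro emeasure_density) (auto simp: measurable_cong_sets[OF sets_restr_to_subalg[OF subs(1)] refl] sets_restr_to_subalg[OF subs(1)] intro!: borel_measurable_indicator)
      also have "\<dots> = (\<integral>\<^sup>+x. indicator (L - D) x \<partial>restr_to_subalg ?A T)"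
        by (intro nn_integral_cong) (auto split: split_indicator)
      also have "\<dots> = emeasure (restr_to_subalg ?A T) (L - D)"
        using L D by (intro nn_integral_indicator) (auto simp: sets_restr_to_subalg[OF subs(1)])
      also have "\<dots> = emeasure ?A (L - D)"
        using L D by (intro emeasure_restr_to_subalg[OF subs(1)]) auto
      finally show ?thesis .
    qed
    have eN: "emeasure ?N L = (\<integral>\<^sup>+x. f x * indicator L x \<partial>?B)" if L: "L \<in> sets T" for L
    proof -
      have "emeasure ?N L = (\<integral>\<^sup>+x. f x * indicator L x \<partial>restr_to_subalg ?B T)"
        using L f by (intro emeasure_density) (auto simp: measurable_cong_sets[OF sets_restr_to_subalg[OF subs(2)] refl] sets_restr_to_subalg[OF subs(2)])
      also have "\<dots> = (\<integral>\<^sup>+x. f x * indicator L x \<partial>?B)"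
        using L f by (intro nn_integral_subalgebra2[OF subs(2)]) simp
      finally show ?thesis .
    qed
    interpret A: prob_space ?A by (rule law_from_prob[OF P p(1)])
    have "?M = ?N"
    proof (rule measure_eqI_generator_eq[where E=\<C> and \<Omega>=UNIV and A="\<lambda>_. UNIV"])
      show "Int_stable \<C>" using \<C>(2) by (simp add: Int_stable_def algebra_iff_Int)
      show "emeasure ?M X = emeasure ?N X" if "X \<in> \<C>" for X
        using that y' \<C>T by (subst eM, blast, subst eN) (auto simp: U_def)
      show "range (\<lambda>_. UNIV) \<subseteq> \<C>" using \<C>(2) by (auto simp: algebra.top)
      show "emeasure ?M UNIV \<noteq> \<infinity>" using eM[of UNIV] sets.top[of T] by simp
    qed (use sMN \<C>(3) in auto)
    then have "emeasure ?A (K - D) = (\<integral>\<^sup>+x. f x * indicator K x \<partial>?B)" using eM[OF K] eN[OF K] by simp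
    also have "\<dots> = 0"
    proof -
      have "AE x in ?B. x \<notin> K" 
        using null K TT by (intro AE_not_in null_setsI) (auto simp: law_from_prob[OF P p(2)])
      then have "AE x in ?B. f x * indicator K x = 0" by eventually_elim simp
      then show ?thesis
        by (subst nn_integral_cong_AE[of _ "\<lambda>_. 0"]) auto
    qed
    finally show ?thesis .
  qed
  let ?D = "{\<omega>. (\<lambda>k. \<omega> (k + m)) \<in> D}"
  have DF: "?D \<in> sets (coord_field \<E> {m..} {m..})"
    using measurable_sets[OF shift_measurable_coord_field D[unfolded T_def]] by (simp add: vimage_def)
  have Dmp: "?D \<in> sets path_space" using DF Tsub by blast
  have Np: "N \<in> sets path_space" using N Tsub by blast
  have "(\<integral>\<^sup>+y'. emeasure (law_from P \<beta>' y') D \<partial>?q) = 0"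
    using emeasure_bind[OF q.not_empty kern[OF p(2)] Dp] rb0 by (simp add: rb_def)
  then have "AE y' in ?q. emeasure (law_from P \<beta>' y') D = 0"
    using emeasure_law_from_measurable[OF P p(2) Dp]
    by (subst nn_integral_0_iff_AE[symmetric]) (simp_all add: measurable_cong_sets[OF q(2) refl])
  then have \<beta>D: "emeasure (law_from P \<beta> y) ?D = 0"
    using law_from_null_shift[OF \<beta> Dp] by (simp add: \<beta>'_def)
  interpret A: prob_space "law_from P \<alpha> y" by (rule law_from_prob[OF P \<alpha>])
  note sA = law_from_prob(2)[OF P \<alpha>, of y]
  have "emeasure (law_from P \<alpha> y) (N - ?D) = 0"
    by (rule law_from_null_transfer[OF \<E> Dp U ac[unfolded T_def] \<alpha> \<alpha>'_def[symmetric] \<beta> \<beta>'_def[symmetric] AEU N])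
  then have 0: "measure (law_from P \<alpha> y) (N - ?D) = 0" by (simp add: measure_def)
  have "measure (law_from P \<alpha> y) N \<le> measure (law_from P \<alpha> y) ((N - ?D) \<union> ?D)"
    using Np Dmp by (intro A.finite_measure_mono) (auto simp: sA)
  also have "\<dots> \<le> measure (law_from P \<alpha> y) (N - ?D) + measure (law_from P \<alpha> y) ?D"
    using Np Dmp by (intro measure_Un_le) (auto simp: sA)
  also have "\<dots> = \<bar>measure (law_from P \<alpha> y) ?D - measure (law_from P \<beta> y) ?D\<bar>"
    using 0 \<beta>D by (simp add: measure_def)
  also have "\<dots> \<le> tv_norm (coord_field \<E> {m..} {m..}) (law_from P \<alpha> y) (law_from P \<beta> y) / 2"
    by (rule tv_norm_upper[OF law_from_prob(1)[OF P \<alpha>] law_from_prob(1)[OF P \<beta>] DF])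
  finally show ?thesis .
qed

end

section \<open>Filters as kernels\<close>

lemma prob_algebra_cong: "sets M = sets N \<Longrightarrow> prob_algebra M = prob_algebra N"
  by (simp add: prob_algebra_def subprob_algebra_cong[of M N])

lemma measure_eqI_algebra:
  assumes "finite_measure M" "sets M = sigma_sets UNIV \<C>" "sets N = sigma_sets UNIV \<C>" "algebra UNIV \<C>"
    and "\<And>A. A \<in> \<C> \<Longrightarrow> emeasure M A = emeasure N A"
  shows "M = N"
proof (rule measure_eqI_generator_eq[where E=\<C> and \<Omega>=UNIV and A="\<lambda>_. UNIV"])
  interpret finite_measure M by fact
  show "Int_stable \<C>" using assms(4) by (simp add: Int_stable_def algebra_iff_Int)
  show "range (\<lambda>_. UNIV) \<subseteq> \<C>" using assms(4) by (auto simp: algebra.top)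
  show "emeasure M UNIV \<noteq> \<infinity>" by simp
qed (use assms in auto)

text \<open>A countable generating algebra lets one exceptional null set serve for all events.\<close>

lemma kernel_AE_eqI:
  assumes "countable C" "sets N = sigma_sets UNIV C"
    and "\<And>\<omega>. prob_space (k \<omega>)" "\<And>\<omega>. sets (k \<omega>) = sets N" "\<And>\<omega>. sets (k' \<omega>) = sets N"
    and AE: "\<And>A. A \<in> sets N \<Longrightarrow> AE \<omega> in M. emeasure (k \<omega>) A = emeasure (k' \<omega>) A"
  shows "AE \<omega> in M. k \<omega> = k' \<omega>"
proof -
  obtain \<C> where \<C>: "countable \<C>" "algebra UNIV \<C>" "sets N = sigma_sets UNIV \<C>"
    by (rule countable_generating_algebra[OF assms(1,2)])
  have "AE \<omega> in M. \<forall>A\<in>\<C>. emeasure (k \<omega>) A = emeasure (k' \<omega>) A"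
    unfolding AE_ball_countable[OF \<C>(1)] using AE \<C>(3) by (auto intro: sigma_sets.Basic)
  then show ?thesis
  proof eventually_elim
    case (elim \<omega>)
    show ?case
      by (rule measure_eqI_algebra[OF _ _ _ \<C>(2)])
        (use elim assms(3,4,5) \<C>(3) in \<open>auto simp: prob_space_def\<close>)
  qed
qed

lemma sets_path_space_eq_coord_field:
  "sets (path_space :: (nat \<Rightarrow> 'e::polish_space \<times> 'f::polish_space) measure) = sets (coord_field (sets borel) UNIV UNIV)"
proof (rule antisym)
  have "(\<lambda>\<omega>. \<omega>) \<in> coord_field (sets borel) UNIV UNIV \<rightarrow>\<^sub>M (path_space :: (nat \<Rightarrow> 'e \<times> 'f) measure)"
  proof (rule measurable_PiM_single')
    fix k :: nat
    have X: "coord_X k \<in> coord_field (sets borel) UNIV UNIV \<rightarrow>\<^sub>M (borel :: 'e measure)"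
      by (rule measurableI) (auto intro!: coord_X_in_coord_field)
    have Y: "coord_Y k \<in> coord_field (sets borel) UNIV UNIV \<rightarrow>\<^sub>M (borel :: 'f measure)"
      by (rule coord_Y_measurable_coord_field) simp
    have "(\<lambda>\<omega>. (coord_X k \<omega>, coord_Y k \<omega>)) \<in> coord_field (sets borel) UNIV UNIV \<rightarrow>\<^sub>M (borel :: ('e \<times> 'f) measure)"
      unfolding borel_prod[symmetric] by (intro measurable_Pair X Y)
    then show "(\<lambda>\<omega>. \<omega> k) \<in> coord_field (sets borel) UNIV UNIV \<rightarrow>\<^sub>M (borel :: ('e \<times> 'f) measure)"
      by (simp add: coord_X_def coord_Y_def)
  qed simp
  from measurable_sets[OF this]
  show "sets (path_space :: (nat \<Rightarrow> 'e \<times> 'f) measure) \<subseteq> sets (coord_field (sets borel) UNIV UNIV)"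
    by auto
qed (rule coord_field_subset_path_space, simp)

lemma countably_generated_borel: "\<exists>C. countable C \<and> sets (borel :: 'a::second_countable_topology measure) = sigma_sets UNIV C"
proof -
  obtain \<B> :: "'a set set" where B: "countable \<B>" "topological_basis \<B>" using ex_countable_basis by blast
  have "(borel :: 'a measure) = sigma UNIV \<B>" by (rule borel_eq_countable_basis[OF B])
  then have "sets (borel :: 'a measure) = sets (sigma UNIV \<B>)" by (rule arg_cong)
  also have "\<dots> = sigma_sets UNIV \<B>" by simp
  finally have "sets (borel :: 'a measure) = sigma_sets UNIV \<B>" .
  then show ?thesis using B(1) by blast
qed

lemma path_space_countably_generated:
  "\<exists>C. countable C \<and> sets (path_space :: (nat \<Rightarrow> 'e::polish_space \<times> 'f::polish_space) measure) = sigma_sets UNIV C"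
proof -
  obtain C where "countable C" "sets (borel :: 'e measure) = sigma_sets UNIV C" using countably_generated_borel by blast
  from coord_field_countably_generated[OF this] show ?thesis
    unfolding sets_path_space_eq_coord_field by blast
qed

lemma FY_eq: "FY 0 (enat n) = (coord_field {} {..n} {} :: (nat \<Rightarrow> 'e::polish_space \<times> 'f::polish_space) measure)"
proof -
  have "{k. 0 \<le> k \<and> enat k \<le> enat n} = {..n}" by auto
  then show ?thesis using FY_eq_coord_field[of 0 "enat n" "{}"] by simp
qed

lemma space_FY [simp]: "space (FY m n) = UNIV"
  by (simp add: FY_def)

lemma sets_FY_subset: "sets (FY m n :: (nat \<Rightarrow> 'e::polish_space \<times> 'f::polish_space) measure) \<subseteq> sets path_space"
  unfolding FY_eq_coord_field[of m n "{}"] by (rule coord_field_subset_path_space) simp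

lemma filter_version_facts:
  fixes P :: "'e::polish_space \<times> 'f::polish_space \<Rightarrow> ('e \<times> 'f) measure"
  assumes P: "markov_kernel P" and \<mu>: "borel_prob \<mu>" and K: "filter_version P \<mu> K"
  shows "subalgebra (chain_law P \<mu>) (FY 0 (enat n))"
    "K n \<in> FY 0 (enat n) \<rightarrow>\<^sub>M prob_algebra path_space"
    "prob_space (K n \<omega>)" "sets (K n \<omega>) = sets path_space" "space (K n \<omega>) = UNIV"
proof -
  have 1: "regular_cond_prob (chain_law P \<mu>) (FY 0 (enat n)) (K n)" using K by (simp add: filter_version_def)
  then show "subalgebra (chain_law P \<mu>) (FY 0 (enat n))" by (simp add: regular_cond_prob_def)
  show m: "K n \<in> FY 0 (enat n) \<rightarrow>\<^sub>M prob_algebra path_space"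
    using 1 by (simp add: regular_cond_prob_def prob_algebra_cong[OF chain_law_prob(1)[OF P \<mu>]])
  from measurable_space[OF m, of \<omega>] show "prob_space (K n \<omega>)" and s: "sets (K n \<omega>) = sets path_space"
    by (auto simp: space_prob_algebra)
  from sets_eq_imp_space_eq[OF s] show "space (K n \<omega>) = UNIV" by simp
qed

lemma filter_version_kernel:
  fixes P :: "'e::polish_space \<times> 'f::polish_space \<Rightarrow> ('e \<times> 'f) measure"
  assumes P: "markov_kernel P" and \<mu>: "borel_prob \<mu>" and K: "filter_version P \<mu> K"
  shows "K n \<in> path_space \<rightarrow>\<^sub>M prob_algebra path_space"
  by (rule measurable_from_subalg[OF _ filter_version_facts(2)[OF P \<mu> K]])
    (use sets_FY_subset in \<open>auto simp: subalgebra_def\<close>)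

lemma filter_version_integral:
  fixes P :: "'e::polish_space \<times> 'f::polish_space \<Rightarrow> ('e \<times> 'f) measure"
  assumes P: "markov_kernel P" and \<mu>: "borel_prob \<mu>" and K: "filter_version P \<mu> K"
    and A: "A \<in> sets path_space"
    and h: "h \<in> borel_measurable (FY 0 (enat n))" "\<And>\<omega>. \<bar>h \<omega>\<bar> \<le> (c::real)"
  shows "(\<integral>\<omega>. h \<omega> * measure (K n \<omega>) A \<partial>chain_law P \<mu>) = (\<integral>\<omega>. h \<omega> * indicator A \<omega> \<partial>chain_law P \<mu>)"
proof -
  let ?M = "chain_law P \<mu>" and ?F = "FY 0 (enat n) :: (nat \<Rightarrow> 'e \<times> 'f) measure"
  note sub = filter_version_facts(1)[OF P \<mu> K, of n]
  interpret M: prob_space ?M by (rule chain_law_prob[OF P \<mu>])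
  interpret finite_measure_subalgebra ?M ?F
    by unfold_locales (rule sub)
  have A': "A \<in> sets ?M" using A chain_law_prob(1)[OF P \<mu>] by simp
  have hM: "h \<in> borel_measurable ?M" by (rule measurable_from_subalg[OF sub h(1)])
  have AE: "AE \<omega> in ?M. measure (K n \<omega>) A = real_cond_exp ?M ?F (indicator A) \<omega>"
    using K A' by (simp add: filter_version_def regular_cond_prob_def)
  have Km: "(\<lambda>\<omega>. measure (K n \<omega>) A) \<in> borel_measurable ?M"
    using measurable_compose[OF filter_version_kernel[OF P \<mu> K, of n] measurable_measure_prob_algebra[OF A]]
    by (simp add: measurable_cong_sets[OF chain_law_prob(1)[OF P \<mu>] refl])
  have int: "integrable ?M (\<lambda>\<omega>. h \<omega> * indicator A \<omega>)"
  proof (rule M.integrable_const_bound[of _ c])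
    show "AE \<omega> in ?M. norm (h \<omega> * indicator A \<omega>) \<le> c"
      using h(2) by (intro AE_I2) (auto split: split_indicator intro: order_trans[OF abs_ge_zero])
  qed (use hM A' in simp)
  have "(\<integral>\<omega>. h \<omega> * measure (K n \<omega>) A \<partial>?M) = (\<integral>\<omega>. h \<omega> * real_cond_exp ?M ?F (indicator A) \<omega> \<partial>?M)"
    using AE hM Km by (intro integral_cong_AE) auto
  also have "\<dots> = (\<integral>\<omega>. h \<omega> * indicator A \<omega> \<partial>?M)"
    using real_cond_exp_intg(2)[OF int h(1)] A' by simp
  finally show ?thesis .
qed

lemma filter_version_emeasure:
  fixes P :: "'e::polish_space \<times> 'f::polish_space \<Rightarrow> ('e \<times> 'f) measure"
  assumes P: "markov_kernel P" and \<mu>: "borel_prob \<mu>" and K: "filter_version P \<mu> K"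
    and A: "A \<in> sets path_space" and B: "B \<in> sets (FY 0 (enat n))"
  shows "(\<integral>\<^sup>+\<omega>. emeasure (K n \<omega>) A * indicator B \<omega> \<partial>chain_law P \<mu>) = emeasure (chain_law P \<mu>) (A \<inter> B)"
proof -
  let ?M = "chain_law P \<mu>"
  interpret M: prob_space ?M by (rule chain_law_prob[OF P \<mu>])
  have A': "A \<in> sets ?M" "B \<in> sets ?M" using A B sets_FY_subset chain_law_prob(1)[OF P \<mu>] by auto
  have Km: "(\<lambda>\<omega>. measure (K n \<omega>) A) \<in> borel_measurable ?M"
    using measurable_compose[OF filter_version_kernel[OF P \<mu> K, of n] measurable_measure_prob_algebra[OF A]]
    by (simp add: measurable_cong_sets[OF chain_law_prob(1)[OF P \<mu>] refl])
  have le1: "measure (K n \<omega>) A \<le> 1" for \<omega>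
    using filter_version_facts(3)[OF P \<mu> K] by (rule prob_space.prob_le_1)
  have em: "emeasure (K n \<omega>) A = ennreal (measure (K n \<omega>) A)" for \<omega>
    using filter_version_facts(3)[OF P \<mu> K, of n \<omega>] by (simp add: finite_measure.emeasure_eq_measure prob_space_def)
  have int: "integrable ?M (\<lambda>\<omega>. indicator B \<omega> * measure (K n \<omega>) A)"
    by (rule M.integrable_const_bound[of _ 1]) (use le1 Km A' in \<open>auto split: split_indicator intro!: AE_I2\<close>)
  have "(\<integral>\<^sup>+\<omega>. emeasure (K n \<omega>) A * indicator B \<omega> \<partial>?M) = (\<integral>\<^sup>+\<omega>. ennreal (indicator B \<omega> * measure (K n \<omega>) A) \<partial>?M)"
    by (intro nn_integral_cong) (auto simp: em split: split_indicator)
  also have "\<dots> = ennreal (\<integral>\<omega>. indicator B \<omega> * measure (K n \<omega>) A \<partial>?M)"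
    using int by (intro nn_integral_eq_integral) (auto intro!: AE_I2 split: split_indicator)
  also have "(\<integral>\<omega>. indicator B \<omega> * measure (K n \<omega>) A \<partial>?M) = (\<integral>\<omega>. indicator B \<omega> * indicator A \<omega> \<partial>?M)"
    by (rule filter_version_integral[OF P \<mu> K A, of _ _ 1]) (use B in \<open>auto split: split_indicator\<close>)
  also have "\<dots> = measure ?M (A \<inter> B)"
    using A' by (simp add: indicator_inter_arith[symmetric] Int_commute)
  finally show ?thesis by (simp add: M.emeasure_eq_measure)
qed

text \<open>The tower property for the filter, localised to an observed event.\<close>

lemma filter_version_bind:
  fixes P :: "'e::polish_space \<times> 'f::polish_space \<Rightarrow> ('e \<times> 'f) measure"
  assumes P: "markov_kernel P" and \<mu>: "borel_prob \<mu>" and K: "filter_version P \<mu> K"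
    and F[measurable]: "F \<in> borel_measurable path_space" and B: "B \<in> sets (FY 0 (enat n))"
  shows "(\<integral>\<^sup>+\<omega>. (\<integral>\<^sup>+\<omega>'. F \<omega>' \<partial>K n \<omega>) * indicator B \<omega> \<partial>chain_law P \<mu>) = (\<integral>\<^sup>+\<omega>. F \<omega> * indicator B \<omega> \<partial>chain_law P \<mu>)"
proof -
  let ?M = "chain_law P \<mu>"
  note sM[measurable_cong] = chain_law_prob(1)[OF P \<mu>]
  have B'[measurable]: "B \<in> sets path_space" using B sets_FY_subset by auto
  let ?MB = "density ?M (indicator B)"
  have Kp: "K n \<in> path_space \<rightarrow>\<^sub>M subprob_algebra path_space"
    by (rule measurable_prob_algebraD[OF filter_version_kernel[OF P \<mu> K]])
  then have Km[measurable]: "K n \<in> ?MB \<rightarrow>\<^sub>M subprob_algebra path_space"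
    by (simp add: measurable_cong_sets[OF sM refl])
  have ne: "space ?MB \<noteq> {}" by (simp add: chain_law_space[OF P \<mu>])
  have eq: "?MB \<bind> K n = ?MB"
  proof (rule measure_eqI)
    show s: "sets (?MB \<bind> K n) = sets ?MB"
      using sets_bind[of ?MB "K n" path_space] ne filter_version_facts(4)[OF P \<mu> K] by (simp add: sM)
    fix A assume "A \<in> sets (?MB \<bind> K n)"
    then have A[measurable]: "A \<in> sets path_space" unfolding s by (simp add: sM)
    have em: "(\<lambda>\<omega>. emeasure (K n \<omega>) A) \<in> borel_measurable path_space"
      by (rule measurable_compose[OF Kp measurable_emeasure_subprob_algebra[OF A]])
    have "emeasure (?MB \<bind> K n) A = (\<integral>\<^sup>+\<omega>. emeasure (K n \<omega>) A \<partial>?MB)"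
      by (rule emeasure_bind[OF ne Km A])
    also have "\<dots> = (\<integral>\<^sup>+\<omega>. indicator B \<omega> * emeasure (K n \<omega>) A \<partial>?M)"
      using em by (intro nn_integral_density) (auto simp: measurable_cong_sets[OF sM refl] sM)
    also have "\<dots> = emeasure ?M (A \<inter> B)"
      using filter_version_emeasure[OF P \<mu> K A B] by (simp add: mult.commute)
    also have "\<dots> = emeasure ?MB A"
      using A by (subst emeasure_density) (auto simp: sM indicator_inter_arith mult.commute nn_integral_indicator[symmetric] simp del: nn_integral_indicator)
    finally show "emeasure (?MB \<bind> K n) A = emeasure ?MB A" .
  qed
  have Fm: "(\<lambda>\<omega>. \<integral>\<^sup>+\<omega>'. F \<omega>' \<partial>K n \<omega>) \<in> borel_measurable path_space"
    by (rule measurable_compose[OF Kp nn_integral_measurable_subprob_algebra[OF F]])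
  have "(\<integral>\<^sup>+\<omega>. (\<integral>\<^sup>+\<omega>'. F \<omega>' \<partial>K n \<omega>) * indicator B \<omega> \<partial>?M) = (\<integral>\<^sup>+\<omega>. \<integral>\<^sup>+\<omega>'. F \<omega>' \<partial>K n \<omega> \<partial>?MB)"
    using Fm by (subst nn_integral_density) (auto simp: measurable_cong_sets[OF sM refl] sM mult.commute)
  also have "\<dots> = (\<integral>\<^sup>+\<omega>. F \<omega> \<partial>(?MB \<bind> K n))"
    by (rule nn_integral_bind[OF F Km, symmetric])
  also have "\<dots> = (\<integral>\<^sup>+\<omega>. F \<omega> * indicator B \<omega> \<partial>?M)"
    unfolding eq by (subst nn_integral_density) (auto simp: measurable_cong_sets[OF sM refl] sM mult.commute)
  finally show ?thesis .
qed

definition initial_X :: "(nat \<Rightarrow> 'e::polish_space \<times> 'f::polish_space) measure \<Rightarrow> 'e measure" where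
  "initial_X \<rho> = distr \<rho> borel (coord_X 0)"

lemma borel_prob_initial_X:
  assumes "prob_space \<rho>" "sets \<rho> = sets path_space"
  shows "borel_prob (initial_X \<rho>)"
  unfolding borel_prob_def initial_X_def
  using assms by (auto intro!: prob_space.prob_space_distr simp: measurable_cong_sets[OF assms(2) refl] coord_X_measurable)

text \<open>The filter at time 0 is the law of a Markov chain started at the observed value of \<open>Y\<^sub>0\<close>. The exceptional set
  is kept in the \<open>\<sigma>\<close>-field of \<open>Y\<^sub>0\<close>, because it has to be transported to another law of which only the
  observation marginal is controlled.\<close>

lemma filter_version_start:
  fixes P :: "'e::polish_space \<times> 'f::polish_space \<Rightarrow> ('e \<times> 'f) measure"
  assumes P: "markov_kernel P" and \<mu>: "borel_prob \<mu>" and K: "filter_version P \<mu> K"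
  shows "AE \<omega> in restr_to_subalg (chain_law P \<mu>) (FY 0 (enat 0)). K 0 \<omega> = law_from P (initial_X (K 0 \<omega>)) (coord_Y 0 \<omega>)"
proof -
  let ?M = "chain_law P \<mu>" and ?F = "FY 0 (enat 0) :: (nat \<Rightarrow> 'e \<times> 'f) measure"
  let ?R = "restr_to_subalg ?M ?F"
  note sub = filter_version_facts(1)[OF P \<mu> K, of 0]
  note Kf = filter_version_facts[OF P \<mu> K, of 0]
  interpret R: prob_space ?R by (rule prob_space_restr_to_subalg[OF sub chain_law_prob(2)[OF P \<mu>]])
  have sR: "sets ?R = sets ?F" by (rule sets_restr_to_subalg[OF sub])
  have Y0F: "coord_Y 0 \<in> ?F \<rightarrow>\<^sub>M (borel :: 'f measure)"
    unfolding FY_eq by (rule coord_Y_measurable_coord_field) simp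
  have KF: "(\<lambda>\<omega>. \<integral>\<^sup>+\<omega>'. G \<omega>' \<partial>K 0 \<omega>) \<in> borel_measurable ?F" if "G \<in> borel_measurable path_space" for G
    by (rule measurable_compose[OF measurable_prob_algebraD[OF Kf(2)] nn_integral_measurable_subprob_algebra[OF that]])
  have KFe: "(\<lambda>\<omega>. emeasure (K 0 \<omega>) A) \<in> borel_measurable ?F" if "A \<in> sets path_space" for A
    by (rule measurable_compose[OF measurable_prob_algebraD[OF Kf(2)] measurable_emeasure_subprob_algebra[OF that]])
  have 1: "AE \<omega> in ?R. emeasure (K 0 \<omega>) A = (\<integral>\<^sup>+\<omega>'. emeasure (chain_from P (\<omega>' 0)) A \<partial>K 0 \<omega>)"
    if A[measurable]: "A \<in> sets path_space" for A
  proof (rule nn_integral_eq_on_sets_imp_AE[OF R.sigma_finite_measure_axioms])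
    define h where "h z = emeasure (chain_from P z) A" for z
    have h[measurable]: "h \<in> borel_measurable borel"
      unfolding h_def by (rule measurable_compose[OF chain_from_measurable_subprob[OF P] measurable_emeasure_subprob_algebra[OF A]])
    have hp: "(\<lambda>\<omega>. h (\<omega> 0)) \<in> borel_measurable path_space" by simp
    show "(\<lambda>\<omega>. emeasure (K 0 \<omega>) A) \<in> borel_measurable ?R"
      by (rule measurable_in_subalg[OF sub KFe[OF A]])
    show "(\<lambda>\<omega>. \<integral>\<^sup>+\<omega>'. emeasure (chain_from P (\<omega>' 0)) A \<partial>K 0 \<omega>) \<in> borel_measurable ?R"
      using measurable_in_subalg[OF sub KF[OF hp]] by (simp add: h_def)
    fix B assume "B \<in> sets ?R"
    then have B: "B \<in> sets ?F" unfolding sR .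
    then have Bp[measurable]: "B \<in> sets path_space" using sets_FY_subset by blast
    have BF: "indicator B \<in> borel_measurable ?F" using B by simp
    have "(\<integral>\<^sup>+\<omega>. emeasure (K 0 \<omega>) A * indicator B \<omega> \<partial>?R) = (\<integral>\<^sup>+\<omega>. emeasure (K 0 \<omega>) A * indicator B \<omega> \<partial>?M)"
      by (intro nn_integral_subalgebra2[OF sub] borel_measurable_times_ennreal KFe[OF A] BF)
    also have "\<dots> = emeasure ?M (A \<inter> B)" by (rule filter_version_emeasure[OF P \<mu> K A B])
    also have "\<dots> = (\<integral>\<^sup>+\<omega>. indicator (A \<inter> B) \<omega> \<partial>?M)" by (simp add: chain_law_prob[OF P \<mu>])
    also have "\<dots> = (\<integral>\<^sup>+\<omega>. \<integral>\<^sup>+\<omega>'. indicator (A \<inter> B) (splice_at 0 \<omega> \<omega>') \<partial>chain_from P (\<omega> 0) \<partial>?M)"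
      by (rule nn_integral_chain_law_splice[OF P \<mu>]) simp
    also have "\<dots> = (\<integral>\<^sup>+\<omega>. h (\<omega> 0) * indicator B \<omega> \<partial>?M)"
    proof (rule nn_integral_cong)
      fix \<omega> :: "nat \<Rightarrow> 'e \<times> 'f"
      have s: "splice_at 0 \<omega> \<omega>' = \<omega>'" for \<omega>' by (rule ext) (simp add: splice_at_def)
      (* B is decided by the starting point *)
      have eqB: "indicator (A \<inter> B) (case_nat (\<omega> 0) \<omega>') = (indicator B \<omega> * indicator A (case_nat (\<omega> 0) \<omega>') :: ennreal)" for \<omega>'
      proof -
        have "case_nat (\<omega> 0) \<omega>' \<in> B \<longleftrightarrow> \<omega> \<in> B"
          using B unfolding FY_eq by (rule coord_field_saturated) (auto simp: coord_Y_def)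
        then show ?thesis by (auto split: split_indicator)
      qed
      have "(\<integral>\<^sup>+\<omega>'. indicator (A \<inter> B) \<omega>' \<partial>chain_from P (\<omega> 0)) = (\<integral>\<^sup>+z. \<integral>\<^sup>+\<omega>'. indicator (A \<inter> B) (case_nat (\<omega> 0) \<omega>') \<partial>chain_from P z \<partial>P (\<omega> 0))"
        by (rule nn_integral_chain_from_step[OF P]) simp
      also have "\<dots> = (\<integral>\<^sup>+z. \<integral>\<^sup>+\<omega>'. (indicator B \<omega> * indicator A (case_nat (\<omega> 0) \<omega>')) \<partial>chain_from P z \<partial>P (\<omega> 0))"
        unfolding eqB ..
      also have "\<dots> = indicator B \<omega> * (\<integral>\<^sup>+z. \<integral>\<^sup>+\<omega>'. indicator A (case_nat (\<omega> 0) \<omega>') \<partial>chain_from P z \<partial>P (\<omega> 0))"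
        by (cases "\<omega> \<in> B") simp_all
      also have "(\<integral>\<^sup>+z. \<integral>\<^sup>+\<omega>'. indicator A (case_nat (\<omega> 0) \<omega>') \<partial>chain_from P z \<partial>P (\<omega> 0)) = (\<integral>\<^sup>+\<omega>'. indicator A \<omega>' \<partial>chain_from P (\<omega> 0))"
        by (rule nn_integral_chain_from_step[OF P, symmetric]) simp
      finally show "(\<integral>\<^sup>+\<omega>'. indicator (A \<inter> B) (splice_at 0 \<omega> \<omega>') \<partial>chain_from P (\<omega> 0)) = h (\<omega> 0) * indicator B \<omega>"
        by (simp add: s h_def chain_from_prob[OF P] mult.commute)
    qed
    also have "\<dots> = (\<integral>\<^sup>+\<omega>. (\<integral>\<^sup>+\<omega>'. h (\<omega>' 0) \<partial>K 0 \<omega>) * indicator B \<omega> \<partial>?M)"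
      by (rule filter_version_bind[OF P \<mu> K hp B, symmetric])
    also have "\<dots> = (\<integral>\<^sup>+\<omega>. (\<integral>\<^sup>+\<omega>'. h (\<omega>' 0) \<partial>K 0 \<omega>) * indicator B \<omega> \<partial>?R)"
      by (intro nn_integral_subalgebra2[OF sub, symmetric] borel_measurable_times_ennreal KF[OF hp] BF)
    finally show "(\<integral>\<^sup>+\<omega>. emeasure (K 0 \<omega>) A * indicator B \<omega> \<partial>?R) = (\<integral>\<^sup>+\<omega>. (\<integral>\<^sup>+\<omega>'. emeasure (chain_from P (\<omega>' 0)) A \<partial>K 0 \<omega>) * indicator B \<omega> \<partial>?R)"
      by (simp add: h_def)
  qed
  have 2: "AE \<omega> in ?R. distr (K 0 \<omega>) borel (coord_Y 0) = return borel (coord_Y 0 \<omega>)"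
  proof -
    obtain C where C: "countable C" "sets (borel :: 'f measure) = sigma_sets UNIV C" using countably_generated_borel by blast
    have Ym: "coord_Y 0 \<in> K 0 \<omega> \<rightarrow>\<^sub>M borel" for \<omega>
      using coord_Y_measurable by (simp add: measurable_cong_sets[OF Kf(4) refl])
    show ?thesis
    proof (rule kernel_AE_eqI[OF C])
      fix B :: "'f set" assume B[measurable]: "B \<in> sets borel"
      let ?YB = "coord_Y 0 -` B :: (nat \<Rightarrow> 'e \<times> 'f) set"
      have YB: "?YB \<in> sets ?F" using measurable_sets[OF Y0F B] by simp
      then have YBp: "?YB \<in> sets path_space" by (rule subsetD[OF sets_FY_subset])
      have "AE \<omega> in ?R. emeasure (K 0 \<omega>) (?YB) = indicator (?YB) \<omega>"
      proof (rule nn_integral_eq_on_sets_imp_AE[OF R.sigma_finite_measure_axioms])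
        show "(\<lambda>\<omega>. emeasure (K 0 \<omega>) (?YB)) \<in> borel_measurable ?R"
          by (rule measurable_in_subalg[OF sub KFe[OF YBp]])
        show "indicator (?YB) \<in> borel_measurable ?R"
          by (rule measurable_in_subalg[OF sub]) (use YB in simp)
        fix B' assume "B' \<in> sets ?R"
        then have B': "B' \<in> sets ?F" unfolding sR .
        have BF: "indicator B' \<in> borel_measurable ?F" using B' by simp
        have I: "?YB \<inter> B' \<in> sets ?F" by (rule sets.Int[OF YB B'])
        have "(\<integral>\<^sup>+\<omega>. emeasure (K 0 \<omega>) (?YB) * indicator B' \<omega> \<partial>?R) = (\<integral>\<^sup>+\<omega>. emeasure (K 0 \<omega>) (?YB) * indicator B' \<omega> \<partial>?M)"
          by (intro nn_integral_subalgebra2[OF sub] borel_measurable_times_ennreal KFe[OF YBp] BF)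
        also have "\<dots> = emeasure ?M (?YB \<inter> B')" by (rule filter_version_emeasure[OF P \<mu> K YBp B'])
        also have "\<dots> = emeasure ?R (?YB \<inter> B')" by (rule emeasure_restr_to_subalg[OF sub I, symmetric])
        also have "\<dots> = (\<integral>\<^sup>+\<omega>. indicator (?YB \<inter> B') \<omega> \<partial>?R)" using I by (simp add: sR)
        also have "\<dots> = (\<integral>\<^sup>+\<omega>. indicator (?YB) \<omega> * indicator B' \<omega> \<partial>?R)"
          by (simp add: indicator_inter_arith)
        finally show "(\<integral>\<^sup>+\<omega>. emeasure (K 0 \<omega>) (?YB) * indicator B' \<omega> \<partial>?R) = (\<integral>\<^sup>+\<omega>. indicator (?YB) \<omega> * indicator B' \<omega> \<partial>?R)" .
      qed
      then show "AE \<omega> in ?R. emeasure (distr (K 0 \<omega>) borel (coord_Y 0)) B = emeasure (return borel (coord_Y 0 \<omega>)) B"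
      proof eventually_elim
        case (elim \<omega>)
        then show ?case by (simp add: emeasure_distr[OF Ym B] Kf indicator_def)
      qed
    qed (auto intro!: prob_space.prob_space_distr Kf Ym)
  qed
  obtain C where C: "countable C" "sets (path_space :: (nat \<Rightarrow> 'e \<times> 'f) measure) = sigma_sets UNIV C"
    using path_space_countably_generated by blast
  show ?thesis
  proof (rule kernel_AE_eqI[OF C])
    show "sets (law_from P (initial_X (K 0 \<omega>)) (coord_Y 0 \<omega>)) = sets path_space" for \<omega>
      by (rule law_from_prob[OF P borel_prob_initial_X[OF Kf(3,4)]])
    fix A :: "(nat \<Rightarrow> 'e \<times> 'f) set" assume A: "A \<in> sets path_space"
    show "AE \<omega> in ?R. emeasure (K 0 \<omega>) A = emeasure (law_from P (initial_X (K 0 \<omega>)) (coord_Y 0 \<omega>)) A"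
      using 1[OF A] 2
    proof eventually_elim
      case (elim \<omega>)
      have Ym: "coord_Y 0 \<in> K 0 \<omega> \<rightarrow>\<^sub>M borel" and Xm: "coord_X 0 \<in> K 0 \<omega> \<rightarrow>\<^sub>M borel"
        using coord_Y_measurable coord_X_measurable by (simp_all add: measurable_cong_sets[OF Kf(4) refl])
      have pm: "Measurable.pred borel (\<lambda>y. y = coord_Y 0 \<omega>)"
        by (simp add: pred_def)
      have "AE y in distr (K 0 \<omega>) borel (coord_Y 0). y = coord_Y 0 \<omega>"
        unfolding elim(2) by (subst AE_return[OF _ pm]) auto
      then have Yeq: "AE \<omega>' in K 0 \<omega>. coord_Y 0 \<omega>' = coord_Y 0 \<omega>"
        by (subst (asm) AE_distr_iff[OF Ym]) auto
      have hm: "(\<lambda>x. emeasure (chain_from P (x, coord_Y 0 \<omega>)) A) \<in> borel_measurable borel"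
        by (rule measurable_compose[OF measurable_prob_algebraD[OF law_from_kernel[OF P]] measurable_emeasure_subprob_algebra[OF A]])
      have "emeasure (K 0 \<omega>) A = (\<integral>\<^sup>+\<omega>'. emeasure (chain_from P (\<omega>' 0)) A \<partial>K 0 \<omega>)" by (rule elim(1))
      also have "\<dots> = (\<integral>\<^sup>+\<omega>'. emeasure (chain_from P (coord_X 0 \<omega>', coord_Y 0 \<omega>)) A \<partial>K 0 \<omega>)"
        using Yeq by (intro nn_integral_cong_AE, eventually_elim) (metis coord_X_def coord_Y_def prod.collapse)
      also have "\<dots> = emeasure (law_from P (initial_X (K 0 \<omega>)) (coord_Y 0 \<omega>)) A"
        unfolding emeasure_law_from[OF P borel_prob_initial_X[OF Kf(3,4)] A]
        unfolding initial_X_def by (rule nn_integral_distr[OF Xm, symmetric]) (use hm in simp)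
      finally show ?case .
    qed
  qed (rule Kf)+
qed

section \<open>Resampling the unobserved component\<close>

lemma coord_field_fun_saturated:
  fixes f :: "(nat \<Rightarrow> 'e::polish_space \<times> 'f::polish_space) \<Rightarrow> 'b::t1_space"
  assumes f: "f \<in> borel_measurable (coord_field \<E> I J)"
    and "\<And>k. k \<in> I \<Longrightarrow> coord_Y k \<omega> = coord_Y k \<omega>'" "\<And>k. k \<in> J \<Longrightarrow> coord_X k \<omega> = coord_X k \<omega>'"
  shows "f \<omega> = f \<omega>'"
proof -
  have "f -` {f \<omega>} \<in> sets (coord_field \<E> I J)"
    using measurable_sets[OF f, of "{f \<omega>}"] by simp
  from coord_field_saturated[OF this assms(2,3)] show ?thesis by simp
qed

lemma UNIV_in_FY: "UNIV \<in> sets (FY m n)"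
  using sets.top[of "FY m n"] by simp

lemma const_path_measurable:
  "(\<lambda>z _. z) \<in> (borel :: ('e::polish_space \<times> 'f::polish_space) measure) \<rightarrow>\<^sub>M FY 0 (enat n)"
proof -
  have s: "snd \<in> (borel :: ('e \<times> 'f) measure) \<rightarrow>\<^sub>M borel" unfolding borel_prod[symmetric] by simp
  show ?thesis unfolding FY_eq by (rule measurable_coord_fieldI) (use s in \<open>auto simp: coord_Y_def\<close>)
qed

lemma snd_measurable_borel_prob: "borel_prob (\<mu> :: ('e::polish_space \<times> 'f::polish_space) measure) \<Longrightarrow> snd \<in> \<mu> \<rightarrow>\<^sub>M borel"
  by (simp add: measurable_cong_sets[OF borel_probD(2) refl]) (simp add: borel_prod[symmetric])

text \<open>An event of \<open>Y\<^sub>0\<close> is decided by a constant path. This expresses its probability through the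
  initial law and its observation marginal.\<close>

lemma emeasure_chain_law_FY0:
  fixes P :: "'e::polish_space \<times> 'f::polish_space \<Rightarrow> ('e \<times> 'f) measure"
  assumes P: "markov_kernel P" and \<mu>: "borel_prob \<mu>" and N: "N \<in> sets (FY 0 (enat 0))"
  shows "emeasure (chain_law P \<mu>) N = emeasure \<mu> {z. (\<lambda>_. z) \<in> N}"
    "emeasure \<mu> {z. (\<lambda>_. z) \<in> N} = emeasure (distr \<mu> borel snd) {y. (\<lambda>_. (undefined, y)) \<in> N}"
    "{z. (\<lambda>_. z) \<in> N} \<in> sets borel" "{y. (\<lambda>_. (undefined, y)) \<in> N} \<in> sets borel"
proof -
  have Np: "N \<in> sets path_space" by (rule subsetD[OF sets_FY_subset N])
  show S: "{z. (\<lambda>_. z) \<in> N} \<in> sets borel"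
    using measurable_sets[OF const_path_measurable N] by (simp add: vimage_def)
  show B: "{y. (\<lambda>_. (undefined, y)) \<in> N} \<in> sets borel"
    using measurable_sets[OF borel_Pair_measurable(2) S, of undefined] by (simp add: vimage_def)
  have sat: "\<omega> \<in> N \<longleftrightarrow> (\<lambda>_. \<omega> 0) \<in> N" for \<omega>
    using N unfolding FY_eq by (rule coord_field_saturated) (auto simp: coord_Y_def)
  have "emeasure (chain_law P \<mu>) N = (\<integral>\<^sup>+\<omega>. indicator N \<omega> \<partial>chain_law P \<mu>)"
    using Np by (simp add: chain_law_prob[OF P \<mu>])
  also have "\<dots> = (\<integral>\<^sup>+\<omega>. indicator {z. (\<lambda>_. z) \<in> N} (\<omega> 0) \<partial>chain_law P \<mu>)"
    using sat by (intro nn_integral_cong) (auto simp: indicator_def)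
  also have "\<dots> = (\<integral>\<^sup>+z. indicator {z. (\<lambda>_. z) \<in> N} z \<partial>\<mu>)"
    using S by (intro nn_integral_chain_law_start[OF P \<mu>]) simp
  also have "\<dots> = emeasure \<mu> {z. (\<lambda>_. z) \<in> N}"
    using S by (simp add: borel_probD[OF \<mu>])
  finally show "emeasure (chain_law P \<mu>) N = emeasure \<mu> {z. (\<lambda>_. z) \<in> N}" .
  have "(\<lambda>_. z) \<in> N \<longleftrightarrow> (\<lambda>_. (undefined, snd z)) \<in> N" for z
    using N unfolding FY_eq by (rule coord_field_saturated) (auto simp: coord_Y_def)
  then have eq: "{z. (\<lambda>_. z) \<in> N} = snd -` {y. (\<lambda>_. (undefined, y)) \<in> N} \<inter> space \<mu>"
    by (auto simp: borel_probD[OF \<mu>])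
  show "emeasure \<mu> {z. (\<lambda>_. z) \<in> N} = emeasure (distr \<mu> borel snd) {y. (\<lambda>_. (undefined, y)) \<in> N}"
    unfolding eq using emeasure_distr[OF snd_measurable_borel_prob[OF \<mu>] B] by simp
qed

lemma subalgebra_FY:
  fixes P :: "'e::polish_space \<times> 'f::polish_space \<Rightarrow> ('e \<times> 'f) measure"
  assumes P: "markov_kernel P" and \<mu>: "borel_prob \<mu>"
  shows "subalgebra (chain_law P \<mu>) (FY m n)"
  using sets_FY_subset[of m n] by (auto simp: subalgebra_def chain_law_space[OF P \<mu>] chain_law_prob[OF P \<mu>])

text \<open>A null set of \<open>Y\<^sub>0\<close> is controlled by the observation marginals; for this reason the almost sure statement has
  to be formulated on the small \<open>\<sigma>\<close>-field.\<close>

lemma AE_FY0_transfer: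
  fixes P :: "'e::polish_space \<times> 'f::polish_space \<Rightarrow> ('e \<times> 'f) measure"
  assumes P: "markov_kernel P" and \<mu>: "borel_prob \<mu>" and \<nu>: "borel_prob \<nu>"
    and ac: "absolutely_continuous (distr \<nu> borel snd) (distr \<mu> borel snd)"
    and AE: "AE \<omega> in restr_to_subalg (chain_law P \<nu>) (FY 0 (enat 0)). p \<omega>"
  shows "AE \<omega> in restr_to_subalg (chain_law P \<mu>) (FY 0 (enat 0)). p \<omega>"
proof -
  note sub\<nu> = subalgebra_FY[OF P \<nu>, of 0 "enat 0"] and sub\<mu> = subalgebra_FY[OF P \<mu>, of 0 "enat 0"]
  obtain N where N: "\<And>\<omega>. \<omega> \<in> space (restr_to_subalg (chain_law P \<nu>) (FY 0 (enat 0))) - N \<Longrightarrow> p \<omega>"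
    "N \<in> null_sets (restr_to_subalg (chain_law P \<nu>) (FY 0 (enat 0)))"
    using AE_E3[OF AE] by blast
  then have NF: "N \<in> sets (FY 0 (enat 0))" and N0: "emeasure (chain_law P \<nu>) N = 0"
    using null_sets_restr_to_subalg[OF sub\<nu>] by auto
  let ?B = "{y. (\<lambda>_. (undefined, y)) \<in> N}"
  have "?B \<in> null_sets (distr \<nu> borel snd)"
    using N0 emeasure_chain_law_FY0[OF P \<nu> NF] by (intro null_setsI) auto
  then have "?B \<in> null_sets (distr \<mu> borel snd)" using ac by (auto simp: absolutely_continuous_def)
  then have "emeasure (chain_law P \<mu>) N = 0"
    using emeasure_chain_law_FY0[OF P \<mu> NF] by auto
  then have "N \<in> null_sets (restr_to_subalg (chain_law P \<mu>) (FY 0 (enat 0)))"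
    using NF emeasure_restr_to_subalg[OF sub\<mu> NF] by (intro null_setsI) (auto simp: sets_restr_to_subalg[OF sub\<mu>])
  then show ?thesis
    by (rule AE_I') (use N(1) in \<open>auto simp: space_restr_to_subalg chain_law_space[OF P \<mu>] chain_law_space[OF P \<nu>]\<close>)
qed

lemma AE_FY0_imp_AE_initial:
  fixes P :: "'e::polish_space \<times> 'f::polish_space \<Rightarrow> ('e \<times> 'f) measure"
  assumes P: "markov_kernel P" and \<mu>: "borel_prob \<mu>"
    and AE: "AE \<omega> in restr_to_subalg (chain_law P \<mu>) (FY 0 (enat 0)). p \<omega>"
  shows "AE z in \<mu>. p (\<lambda>_. z)"
proof -
  note sub = subalgebra_FY[OF P \<mu>, of 0 "enat 0"]
  obtain N where N: "\<And>\<omega>. \<omega> \<in> space (restr_to_subalg (chain_law P \<mu>) (FY 0 (enat 0))) - N \<Longrightarrow> p \<omega>"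
    "N \<in> null_sets (restr_to_subalg (chain_law P \<mu>) (FY 0 (enat 0)))"
    using AE_E3[OF AE] by blast
  then have NF: "N \<in> sets (FY 0 (enat 0))" and N0: "emeasure (chain_law P \<mu>) N = 0"
    using null_sets_restr_to_subalg[OF sub] by auto
  have "{z. (\<lambda>_. z) \<in> N} \<in> null_sets \<mu>"
    using N0 emeasure_chain_law_FY0[OF P \<mu> NF] by (intro null_setsI) (auto simp: borel_probD[OF \<mu>])
  then show ?thesis
    by (rule AE_I') (use N(1) in \<open>auto simp: space_restr_to_subalg chain_law_space[OF P \<mu>] borel_probD[OF \<mu>]\<close>)
qed

locale nondegenerate_chain =
  fixes P :: "'e::polish_space \<times> 'f::polish_space \<Rightarrow> ('e \<times> 'f) measure" and \<E> :: "'e set set"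
  assumes P: "markov_kernel P" and nondeg: "nondegenerate P"
    and \<E>: "\<E> \<subseteq> sets borel" and \<E>_gen: "\<exists>C. countable C \<and> \<E> = sigma_sets UNIV C"
begin

abbreviation tail :: "nat \<Rightarrow> (nat \<Rightarrow> 'e \<times> 'f) measure" where
  "tail m \<equiv> F0 \<E> m \<infinity>"

abbreviation obs_tail :: "nat \<Rightarrow> (nat \<Rightarrow> 'e \<times> 'f) measure" where
  "obs_tail m \<equiv> coord_field \<E> UNIV {m..}"

lemma singular_mass:
  assumes "borel_prob \<alpha>" "borel_prob \<beta>" "N \<in> sets (obs_tail m)" "emeasure (law_from P \<beta> y) N = 0"
  shows "measure (law_from P \<alpha> y) N \<le> tv_norm (tail m) (law_from P \<alpha> y) (law_from P \<beta> y) / 2"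
proof -
  obtain P0 Q g where *: "markov_kernel P0" "markov_kernel Q" "g \<in> borel_measurable borel" "\<And>z. 0 < (g z :: real)"
    "\<And>x y. P (x, y) = density (P0 x \<Otimes>\<^sub>M Q y) (\<lambda>(x', y'). ennreal (g (x, y, x', y')))"
    using nondeg unfolding nondegenerate_def by (elim exE conjE) (rule that, auto)
  obtain C where "countable C" "\<E> = sigma_sets UNIV C" using \<E>_gen by blast
  from singular_mass_le_tail_variation[OF P * \<E> this assms]
  show ?thesis unfolding tv_norm_cong_sets[OF sets_F0_infinity] .
qed

lemma obs_tail_subset: "sets (obs_tail m) \<subseteq> sets path_space"
  by (rule coord_field_subset_path_space[OF \<E>])

lemma tail_subset: "sets (tail m) \<subseteq> sets path_space"
  unfolding sets_F0_infinity by (rule coord_field_subset_path_space[OF \<E>])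

lemma tail_subset_obs_tail: "sets (tail m) \<subseteq> sets (obs_tail m)"
  unfolding sets_F0_infinity by (rule coord_field_mono) auto

lemma obs_tail_antimono: "m \<le> n \<Longrightarrow> sets (obs_tail n) \<subseteq> sets (obs_tail m)"
  by (rule coord_field_mono) auto

lemma tail_antimono: "m \<le> n \<Longrightarrow> sets (tail n) \<subseteq> sets (tail m)"
  unfolding sets_F0_infinity by (rule coord_field_mono) auto

lemma obs_tail_generated: "\<exists>C. countable C \<and> sets (obs_tail m) = sigma_sets UNIV C"
  using \<E>_gen coord_field_countably_generated by metis

lemma tail_generated: "\<exists>C. countable C \<and> sets (tail m) = sigma_sets UNIV C"
  unfolding sets_F0_infinity using \<E>_gen coord_field_countably_generated by metis

lemma FY_subset_obs_tail: "sets (FY k n) \<subseteq> sets (obs_tail m)"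
  unfolding FY_eq_coord_field[of k n \<E>] by (rule coord_field_mono) auto

lemma tv_norm_tail_measurable:
  assumes "K \<in> M \<rightarrow>\<^sub>M prob_algebra path_space" "K' \<in> M \<rightarrow>\<^sub>M prob_algebra path_space"
  shows "(\<lambda>x. tv_norm (tail m) (K x) (K' x)) \<in> borel_measurable M"
proof -
  obtain C where "countable C" "sets (tail m) = sigma_sets UNIV C" using tail_generated by blast
  from tv_norm_measurable[OF assms space_path_space tail_subset this] show ?thesis .
qed

lemma tv_norm_tail_antimono:
  "prob_space \<rho> \<Longrightarrow> prob_space \<rho>' \<Longrightarrow> m \<le> n \<Longrightarrow> tv_norm (tail n) \<rho> \<rho>' \<le> tv_norm (tail m) \<rho> \<rho>'"
  by (rule tv_norm_mono[OF _ _ tail_antimono])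

text \<open>Disintegrate over \<open>Y\<^sub>0\<close>: for almost every observation \<open>S m\<close> is null for the second filter at time 0, so that its
  mass under the first filter is at most half their distance on the local tail after time \<open>m\<close>.\<close>

lemma singular_mass_tendsto_0:
  assumes \<mu>: "borel_prob \<mu>" and \<nu>: "borel_prob \<nu>"
    and K: "filter_version P \<mu> K" and L: "filter_version P \<nu> L"
    and ac: "absolutely_continuous (distr \<nu> borel snd) (distr \<mu> borel snd)"
    and conv: "AE \<omega> in chain_law P \<mu>. (\<lambda>m. tv_norm (tail m) (K 0 \<omega>) (L 0 \<omega>)) \<longlonglongrightarrow> 0"
    and S: "\<And>m. S m \<in> sets (obs_tail m)" "\<And>m. emeasure (chain_law P \<nu>) (S m) = 0"
  shows "(\<lambda>m. measure (chain_law P \<mu>) (S m)) \<longlonglongrightarrow> 0"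
proof -
  let ?M = "chain_law P \<mu>"
  interpret M: prob_space ?M by (rule chain_law_prob[OF P \<mu>])
  note Kf = filter_version_facts[OF P \<mu> K, of 0] and Lf = filter_version_facts[OF P \<nu> L, of 0]
  note sub\<mu> = subalgebra_FY[OF P \<mu>, of 0 "enat 0"] and sub\<nu> = subalgebra_FY[OF P \<nu>, of 0 "enat 0"]
  have Sp: "S m \<in> sets path_space" for m using S(1) obs_tail_subset by blast
  have "AE \<omega> in restr_to_subalg (chain_law P \<nu>) (FY 0 (enat 0)). emeasure (L 0 \<omega>) (S m) = 0" for m
  proof (rule AE_restr_to_subalg2[OF sub\<nu>])
    have m: "(\<lambda>\<omega>. emeasure (L 0 \<omega>) (S m)) \<in> borel_measurable (FY 0 (enat 0))"
      by (rule measurable_compose[OF measurable_prob_algebraD[OF Lf(2)] measurable_emeasure_subprob_algebra[OF Sp]])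
    show "Measurable.pred (FY 0 (enat 0)) (\<lambda>\<omega>. emeasure (L 0 \<omega>) (S m) = 0)" using m by measurable
    have "(\<integral>\<^sup>+\<omega>. emeasure (L 0 \<omega>) (S m) * indicator UNIV \<omega> \<partial>chain_law P \<nu>) = 0"
      using filter_version_emeasure[OF P \<nu> L Sp, of UNIV 0] S(2)[of m] by (simp add: UNIV_in_FY)
    then show "AE \<omega> in chain_law P \<nu>. emeasure (L 0 \<omega>) (S m) = 0"
      using measurable_from_subalg[OF sub\<nu> m] by (simp add: nn_integral_0_iff_AE)
  qed
  then have "AE \<omega> in restr_to_subalg (chain_law P \<nu>) (FY 0 (enat 0)). \<forall>m. emeasure (L 0 \<omega>) (S m) = 0"
    by (simp add: AE_all_countable)
  from AE_restr_to_subalg[OF sub\<mu> AE_FY0_transfer[OF P \<mu> \<nu> ac this]]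
  have 1: "AE \<omega> in ?M. \<forall>m. emeasure (L 0 \<omega>) (S m) = 0" .
  have 2: "AE \<omega> in ?M. K 0 \<omega> = law_from P (initial_X (K 0 \<omega>)) (coord_Y 0 \<omega>)"
    by (rule AE_restr_to_subalg[OF sub\<mu> filter_version_start[OF P \<mu> K]])
  have 3: "AE \<omega> in ?M. L 0 \<omega> = law_from P (initial_X (L 0 \<omega>)) (coord_Y 0 \<omega>)"
    by (rule AE_restr_to_subalg[OF sub\<mu> AE_FY0_transfer[OF P \<mu> \<nu> ac filter_version_start[OF P \<nu> L]]])
  have lim: "AE \<omega> in ?M. (\<lambda>m. measure (K 0 \<omega>) (S m)) \<longlonglongrightarrow> 0"
    using 1 2 3 conv
  proof eventually_elim
    case (elim \<omega>)
    have le: "measure (K 0 \<omega>) (S m) \<le> tv_norm (tail m) (K 0 \<omega>) (L 0 \<omega>) / 2" for m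
    proof -
      have "emeasure (law_from P (initial_X (L 0 \<omega>)) (coord_Y 0 \<omega>)) (S m) = 0" using elim(1,3) by simp
      from singular_mass[OF borel_prob_initial_X[OF Kf(3,4)[of \<omega>]] borel_prob_initial_X[OF Lf(3,4)[of \<omega>]] S(1) this]
      show ?thesis unfolding elim(2)[symmetric] elim(3)[symmetric] .
    qed
    have "(\<lambda>m. tv_norm (tail m) (K 0 \<omega>) (L 0 \<omega>) / 2) \<longlonglongrightarrow> 0"
      using tendsto_divide[OF elim(4) tendsto_const[of 2]] by simp
    from tendsto_sandwich[OF always_eventually always_eventually tendsto_const this, of "\<lambda>m. measure (K 0 \<omega>) (S m)"]
    show ?case using le by simp
  qed
  have Km: "(\<lambda>\<omega>. measure (K 0 \<omega>) (S m)) \<in> borel_measurable ?M" for m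
    using measurable_compose[OF filter_version_kernel[OF P \<mu> K, of 0] measurable_measure_prob_algebra[OF Sp]]
    by (simp add: measurable_cong_sets[OF chain_law_prob(1)[OF P \<mu>] refl])
  have "(\<lambda>m. \<integral>\<omega>. measure (K 0 \<omega>) (S m) \<partial>?M) \<longlonglongrightarrow> (\<integral>\<omega>. 0 \<partial>?M)"
  proof (rule integral_dominated_convergence[where w="\<lambda>_. 1"])
    show "AE \<omega> in ?M. norm (measure (K 0 \<omega>) (S m)) \<le> 1" for m
      using prob_space.prob_le_1[OF Kf(3)] by (intro AE_I2) simp
  qed (use Km lim in simp_all)
  moreover have "(\<integral>\<omega>. measure (K 0 \<omega>) (S m) \<partial>?M) = measure ?M (S m)" for m
    using filter_version_integral[OF P \<mu> K Sp, of "\<lambda>_. 1" 0 1] Sp by (simp add: chain_law_prob[OF P \<mu>])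
  ultimately show ?thesis by simp
qed

lemma chain_from_eq_law_from: "chain_from P (x, y) = law_from P (return borel x) y"
  unfolding law_from_def
  by (rule bind_return[symmetric, where N=path_space])
    (auto intro: measurable_prob_algebraD[OF law_from_kernel[OF P]])

text \<open>Total variation distance is convex in the starting distribution.\<close>

lemma tv_norm_law_from_le:
  assumes \<alpha>: "borel_prob \<alpha>" and \<rho>: "prob_space \<rho>" "sets \<rho> = sets path_space"
  shows "tv_norm (tail m) (law_from P \<alpha> y) \<rho> \<le> (\<integral>x. tv_norm (tail m) (chain_from P (x, y)) \<rho> \<partial>\<alpha>)"
proof -
  interpret \<alpha>: prob_space \<alpha> by (rule borel_probD[OF \<alpha>])
  have k: "(\<lambda>x. chain_from P (x, y)) \<in> \<alpha> \<rightarrow>\<^sub>M prob_algebra path_space"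
    using law_from_kernel[OF P] by (simp add: measurable_cong_sets[OF borel_probD(2)[OF \<alpha>] refl])
  have tvm: "(\<lambda>x. tv_norm (tail m) (chain_from P (x, y)) \<rho>) \<in> borel_measurable \<alpha>"
    by (rule tv_norm_tail_measurable[OF k]) (use \<rho> in \<open>simp add: space_prob_algebra\<close>)
  have tvi: "integrable \<alpha> (\<lambda>x. tv_norm (tail m) (chain_from P (x, y)) \<rho>)"
    by (rule \<alpha>.integrable_const_bound[of _ 2])
      (use tvm tv_norm_le_2[OF chain_from_prob(2)[OF P] \<rho>(1)] tv_norm_nonneg[OF chain_from_prob(2)[OF P] \<rho>(1)] in auto)
  have "\<bar>measure (law_from P \<alpha> y) A - measure \<rho> A\<bar> \<le> (\<integral>x. tv_norm (tail m) (chain_from P (x, y)) \<rho> \<partial>\<alpha>) / 2"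
    if A: "A \<in> sets (tail m)" for A
  proof -
    have Ap: "A \<in> sets path_space" using A tail_subset by blast
    have mm: "(\<lambda>x. measure (chain_from P (x, y)) A) \<in> borel_measurable \<alpha>"
      by (rule measurable_compose[OF k measurable_measure_prob_algebra[OF Ap]])
    have mi: "integrable \<alpha> (\<lambda>x. measure (chain_from P (x, y)) A)"
      by (rule \<alpha>.integrable_const_bound[of _ 1]) (use mm prob_space.prob_le_1[OF chain_from_prob(2)[OF P]] in auto)
    have "ennreal (measure (law_from P \<alpha> y) A) = emeasure (law_from P \<alpha> y) A"
      using law_from_prob(1)[OF P \<alpha>, of y] by (simp add: finite_measure.emeasure_eq_measure prob_space_def)
    also have "\<dots> = (\<integral>\<^sup>+x. ennreal (measure (chain_from P (x, y)) A) \<partial>\<alpha>)"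
      unfolding emeasure_law_from[OF P \<alpha> Ap] using chain_from_prob(2)[OF P]
      by (intro nn_integral_cong) (simp add: finite_measure.emeasure_eq_measure prob_space_def)
    also have "\<dots> = ennreal (\<integral>x. measure (chain_from P (x, y)) A \<partial>\<alpha>)"
      by (rule nn_integral_eq_integral[OF mi]) simp
    finally have "measure (law_from P \<alpha> y) A = (\<integral>x. measure (chain_from P (x, y)) A \<partial>\<alpha>)"
      by (simp add: integral_nonneg_AE)
    then have "measure (law_from P \<alpha> y) A - measure \<rho> A = (\<integral>x. measure (chain_from P (x, y)) A - measure \<rho> A \<partial>\<alpha>)"
      using mi by (simp add: \<alpha>.prob_space)
    also have "\<bar>\<dots>\<bar> \<le> (\<integral>x. \<bar>measure (chain_from P (x, y)) A - measure \<rho> A\<bar> \<partial>\<alpha>)"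
      by (rule integral_abs_bound)
    also have "\<dots> \<le> (\<integral>x. tv_norm (tail m) (chain_from P (x, y)) \<rho> / 2 \<partial>\<alpha>)"
      using mi tvi tv_norm_upper[OF chain_from_prob(2)[OF P] \<rho>(1) A]
      by (intro integral_mono) auto
    finally show ?thesis by simp
  qed
  from tv_norm_least[OF this] show ?thesis by simp
qed

lemma tv_norm_triangle:
  assumes "prob_space \<rho>" "prob_space \<sigma>" "prob_space \<tau>"
  shows "tv_norm G \<rho> \<tau> \<le> tv_norm G \<rho> \<sigma> + tv_norm G \<tau> \<sigma>"
proof -
  have "\<bar>measure \<rho> A - measure \<tau> A\<bar> \<le> (tv_norm G \<rho> \<sigma> + tv_norm G \<tau> \<sigma>) / 2" if "A \<in> sets G" for A
    using tv_norm_upper[OF assms(1,2) that] tv_norm_upper[OF assms(3,2) that]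
    unfolding add_divide_distrib by linarith
  from tv_norm_least[of G \<rho> \<tau>, OF this] show ?thesis by simp
qed

end

locale ergodic_chain = nondegenerate_chain P \<E>
  for P :: "'e::polish_space \<times> 'f::polish_space \<Rightarrow> ('e \<times> 'f) measure" and \<E> +
  fixes lam :: "('e \<times> 'f) measure" and K
  assumes lam: "borel_prob lam" "lam \<bind> P = lam"
    and ergodic: "local_ergodicity P lam \<E>"
    and K: "filter_version P lam K"
begin

text \<open>The law of a chain in which \<open>X\<^sub>0\<close> is redrawn from its conditional law given \<open>Y\<^sub>0\<close>. It is read off from the filter
  at time 0, which looks at \<open>Y\<^sub>0\<close> alone and can be evaluated at a constant path.\<close>

definition resample :: "'e \<times> 'f \<Rightarrow> (nat \<Rightarrow> 'e \<times> 'f) measure" where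
  "resample z = K 0 (\<lambda>_. z)"

lemma resample_prob: "prob_space (resample z)" "sets (resample z) = sets path_space" "space (resample z) = UNIV"
  unfolding resample_def by (rule filter_version_facts[OF P lam(1) K])+

lemma resample_measurable: "resample \<in> borel \<rightarrow>\<^sub>M prob_algebra path_space"
  unfolding resample_def[abs_def]
  by (rule measurable_compose[OF const_path_measurable filter_version_facts(2)[OF P lam(1) K]])

text \<open>The redrawn starting point is again distributed according to \<open>lam\<close>, so it is almost surely a point at which local
  ergodicity holds. Both laws therefore approach the stationary one.\<close>

lemma resample_tendsto:
  "AE z in lam. (\<exists>\<alpha>. borel_prob \<alpha> \<and> resample z = law_from P \<alpha> (snd z)) \<and>
    (\<lambda>m. tv_norm (tail m) (resample z) (chain_from P z)) \<longlonglongrightarrow> 0"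
proof -
  let ?M = "chain_law P lam"
  note Kf = filter_version_facts[OF P lam(1) K, of 0]
  note sub = subalgebra_FY[OF P lam(1), of 0 "enat 0"]
  have erg: "AE z in lam. (\<lambda>m. tv_norm (tail m) (chain_from P z) ?M) \<longlonglongrightarrow> 0"
    using ergodic unfolding local_ergodicity_def chain_from_def by (simp add: case_prod_beta')
  obtain N where N: "\<And>z. z \<in> space lam - N \<Longrightarrow> (\<lambda>m. tv_norm (tail m) (chain_from P z) ?M) \<longlonglongrightarrow> 0" "N \<in> null_sets lam"
    using AE_E3[OF erg] by blast
  have Nb[measurable]: "N \<in> sets borel" using N(2) borel_probD(2)[OF lam(1)] by auto
  (* N contains the starting points without local ergodicity; a resampled path almost surely avoids it *)
  let ?S = "{\<omega>. \<omega> 0 \<in> N}"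
  have "{\<omega> \<in> space path_space. \<omega> 0 \<in> N} \<in> sets path_space" by measurable
  then have Sp: "?S \<in> sets path_space" by simp
  have start: "(\<integral>\<^sup>+\<omega>. indicator ?S \<omega> \<partial>?M) = emeasure lam N"
    using nn_integral_chain_law_start[OF P lam(1), of "indicator N"] Nb
    by (simp add: indicator_def[abs_def] borel_probD[OF lam(1)] flip: nn_integral_indicator)
  then have S0: "emeasure ?M ?S = 0" using null_setsD1[OF N(2)] Sp by (simp add: chain_law_prob[OF P lam(1)])
  have "AE \<omega> in restr_to_subalg ?M (FY 0 (enat 0)). emeasure (K 0 \<omega>) ?S = 0"
  proof (rule AE_restr_to_subalg2[OF sub])
    have m: "(\<lambda>\<omega>. emeasure (K 0 \<omega>) ?S) \<in> borel_measurable (FY 0 (enat 0))"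
      by (rule measurable_compose[OF measurable_prob_algebraD[OF Kf(2)] measurable_emeasure_subprob_algebra[OF Sp]])
    show "Measurable.pred (FY 0 (enat 0)) (\<lambda>\<omega>. emeasure (K 0 \<omega>) ?S = 0)" using m by measurable
    have "(\<integral>\<^sup>+\<omega>. emeasure (K 0 \<omega>) ?S * indicator UNIV \<omega> \<partial>?M) = 0"
      using filter_version_emeasure[OF P lam(1) K Sp, of UNIV 0] S0 by (simp add: UNIV_in_FY)
    then show "AE \<omega> in ?M. emeasure (K 0 \<omega>) ?S = 0"
      using measurable_from_subalg[OF sub m] by (simp add: nn_integral_0_iff_AE)
  qed
  from AE_FY0_imp_AE_initial[OF P lam(1) this]
  have 1: "AE z in lam. emeasure (resample z) ?S = 0" unfolding resample_def .
  from AE_FY0_imp_AE_initial[OF P lam(1) filter_version_start[OF P lam(1) K]]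
  have 2: "AE z in lam. resample z = law_from P (initial_X (resample z)) (snd z)"
    unfolding resample_def by (simp add: coord_Y_def)
  show ?thesis
    using 1 2 erg
  proof eventually_elim
    case (elim z)
    let ?\<alpha> = "initial_X (resample z)" and ?y = "snd z"
    have \<alpha>: "borel_prob ?\<alpha>" by (rule borel_prob_initial_X[OF resample_prob(1,2)])
    interpret \<alpha>: prob_space ?\<alpha> by (rule borel_probD[OF \<alpha>])
    have cs: "emeasure (chain_from P (x, ?y)) ?S = indicator N (x, ?y)" for x
    proof -
      have "emeasure (chain_from P (x, ?y)) ?S = (\<integral>\<^sup>+\<omega>. indicator ?S \<omega> \<partial>chain_from P (x, ?y))"
        using Sp by (simp add: chain_from_prob[OF P])
      also have "\<dots> = (\<integral>\<^sup>+\<omega>. indicator N (\<omega> 0) \<partial>chain_from P (x, ?y))"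
        by (intro nn_integral_cong) (simp add: indicator_def)
      also have "\<dots> = indicator N (x, ?y)" by (rule nn_integral_chain_from_start[OF P]) simp
      finally show ?thesis .
    qed
    have pairm: "(\<lambda>x. indicator N (x, ?y) :: ennreal) \<in> borel_measurable ?\<alpha>"
      using measurable_compose[OF borel_Pair_measurable(1) borel_measurable_indicator[OF Nb], of ?y]
      by (simp add: measurable_cong_sets[OF borel_probD(2)[OF \<alpha>] refl])
    have "emeasure (law_from P ?\<alpha> ?y) ?S = 0" using elim(1,2) by simp
    then have "(\<integral>\<^sup>+x. indicator N (x, ?y) \<partial>?\<alpha>) = 0" unfolding emeasure_law_from[OF P \<alpha> Sp] cs .
    then have "AE x in ?\<alpha>. indicator N (x, ?y) = (0 :: ennreal)" using pairm by (simp add: nn_integral_0_iff_AE)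
    then have AEx: "AE x in ?\<alpha>. (\<lambda>m. tv_norm (tail m) (chain_from P (x, ?y)) ?M) \<longlonglongrightarrow> 0"
    proof eventually_elim
      case (elim x)
      show ?case by (rule N(1)) (use elim in \<open>auto simp: borel_probD[OF lam(1)] indicator_def split: if_splits\<close>)
    qed
    have k: "(\<lambda>x. chain_from P (x, ?y)) \<in> ?\<alpha> \<rightarrow>\<^sub>M prob_algebra path_space"
      using law_from_kernel[OF P] by (simp add: measurable_cong_sets[OF borel_probD(2)[OF \<alpha>] refl])
    have Mp: "prob_space ?M" "sets ?M = sets path_space" by (rule chain_law_prob[OF P lam(1)])+
    have tvm: "(\<lambda>x. tv_norm (tail m) (chain_from P (x, ?y)) ?M) \<in> borel_measurable ?\<alpha>" for m
      by (rule tv_norm_tail_measurable[OF k]) (use Mp in \<open>simp add: space_prob_algebra\<close>)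
    have "(\<lambda>m. \<integral>x. tv_norm (tail m) (chain_from P (x, ?y)) ?M \<partial>?\<alpha>) \<longlonglongrightarrow> (\<integral>x. 0 \<partial>?\<alpha>)"
    proof (rule integral_dominated_convergence[where w="\<lambda>_. 2"])
      show "AE x in ?\<alpha>. norm (tv_norm (tail m) (chain_from P (x, ?y)) ?M) \<le> 2" for m
        using tv_norm_le_2[OF chain_from_prob(2)[OF P] Mp(1)] tv_norm_nonneg[OF chain_from_prob(2)[OF P] Mp(1)]
        by (intro AE_I2) simp
    qed (use tvm AEx in simp_all)
    then have lim1: "(\<lambda>m. \<integral>x. tv_norm (tail m) (chain_from P (x, ?y)) ?M \<partial>?\<alpha>) \<longlonglongrightarrow> 0" by simp
    have le: "tv_norm (tail m) (resample z) (chain_from P z) \<le>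
      (\<integral>x. tv_norm (tail m) (chain_from P (x, ?y)) ?M \<partial>?\<alpha>) + tv_norm (tail m) (chain_from P z) ?M" for m
    proof -
      have "tv_norm (tail m) (resample z) ?M = tv_norm (tail m) (law_from P ?\<alpha> ?y) ?M" using elim(2) by simp
      also have "\<dots> \<le> (\<integral>x. tv_norm (tail m) (chain_from P (x, ?y)) ?M \<partial>?\<alpha>)"
        by (rule tv_norm_law_from_le[OF \<alpha> Mp])
      finally show ?thesis
        using tv_norm_triangle[OF resample_prob(1) Mp(1) chain_from_prob(2)[OF P], of "tail m" z z] by linarith
    qed
    have "(\<lambda>m. tv_norm (tail m) (resample z) (chain_from P z)) \<longlonglongrightarrow> 0"
      using tendsto_sandwich[OF always_eventually always_eventually tendsto_const tendsto_add_zero[OF lim1 elim(3)],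
          of "\<lambda>m. tv_norm (tail m) (resample z) (chain_from P z)"]
        le tv_norm_nonneg[OF resample_prob(1) chain_from_prob(2)[OF P]] by simp
    then show ?case using elim(2) \<alpha> by blast
  qed
qed

end

context ergodic_chain
begin

text \<open>Otherwise a Borel-Cantelli argument produces an event that is null for the true chain and has mass at
  least \<open>\<eta>\<close> for the resampled one. By transfer of singularity its mass is at most half the distance on the
  local tail, which is smaller than \<open>\<eta>\<close>.\<close>

lemma resample_absolutely_continuous:
  assumes \<alpha>: "borel_prob \<alpha>" "resample z = law_from P \<alpha> (snd z)"
    and conv: "(\<lambda>m. tv_norm (tail m) (resample z) (chain_from P z)) \<longlonglongrightarrow> 0" and \<eta>: "0 < (\<eta> :: real)"
  shows "\<exists>m j. \<forall>N\<in>sets (obs_tail m). measure (chain_from P z) N < 1 / real (Suc j) \<longrightarrow> measure (resample z) N \<le> \<eta>"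
proof -
  interpret L: prob_space "chain_from P z" by (rule chain_from_prob[OF P])
  interpret R: prob_space "resample z" by (rule resample_prob)
  have "\<forall>\<^sub>F m in sequentially. tv_norm (tail m) (resample z) (chain_from P z) < \<eta>"
    by (rule order_tendstoD(2)[OF conv \<eta>])
  then obtain m where m: "tv_norm (tail m) (resample z) (chain_from P z) < \<eta>"
    by (auto simp: eventually_sequentially)
  show ?thesis
  proof (rule ccontr)
    assume "\<not> ?thesis"
    then have "\<exists>N. N \<in> sets (obs_tail m) \<and> measure (chain_from P z) N < 1 / real (Suc j) \<and> \<eta> < measure (resample z) N" for j
      by (meson not_le)
    then have "\<exists>N. N \<in> sets (obs_tail m) \<and> measure (chain_from P z) N < 1 / real (Suc (2 ^ j)) \<and> \<eta> < measure (resample z) N" for j :: nat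
      by blast
    then have "\<exists>N. \<forall>j::nat. N j \<in> sets (obs_tail m) \<and> measure (chain_from P z) (N j) < 1 / real (Suc (2 ^ j)) \<and> \<eta> < measure (resample z) (N j)"
      by (intro choice allI)
    then obtain N where N: "\<And>j::nat. N j \<in> sets (obs_tail m)" "\<And>j. measure (chain_from P z) (N j) < 1 / real (Suc (2 ^ j))"
      "\<And>j. \<eta> < measure (resample z) (N j)" by blast
    have Np: "N j \<in> sets path_space" for j using N(1) obs_tail_subset by blast
    have NL: "N j \<in> sets (chain_from P z)" "N j \<in> sets (resample z)" for j
      using Np by (simp_all add: chain_from_prob[OF P] resample_prob)
    have geo: "measure (chain_from P z) (N j) \<le> (1/2) ^ j" for j
    proof -
      have "1 / real (Suc (2 ^ j)) \<le> 1 / 2 ^ j" by (simp add: frac_le)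
      then show ?thesis using N(2)[of j] by (simp add: power_one_over)
    qed
    have summ: "summable (\<lambda>j. measure (chain_from P z) (N j))"
    proof (rule summable_comparison_test'[OF summable_geometric, of "1/2" 0])
      show "norm (measure (chain_from P z) (N j)) \<le> (1/2) ^ j" for j using geo[of j] by simp
    qed simp
    have null: "limsup N \<in> null_sets (chain_from P z)"
      by (rule borel_cantelli_limsup1[OF NL(1) _ summ]) (simp add: less_top[symmetric])
    let ?U = "\<lambda>n. \<Union>j\<in>{n..}. N j"
    have lims: "limsup N = (\<Inter>n. ?U n)" by (simp add: limsup_INF_SUP)
    have UT: "?U n \<in> sets (obs_tail m)" for n by (rule sets.countable_UN'') (use N(1) in simp_all)
    have lT: "limsup N \<in> sets (obs_tail m)" unfolding lims by (rule sets.countable_INT) (simp_all add: image_subset_iff UT)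
    have limU: "(\<lambda>n. measure (resample z) (?U n)) \<longlonglongrightarrow> measure (resample z) (\<Inter>n. ?U n)"
    proof (rule R.finite_Lim_measure_decseq)
      show "range ?U \<subseteq> sets (resample z)"
        unfolding resample_prob(2) by (rule image_subsetI) (rule subsetD[OF obs_tail_subset UT])
      show "antimono ?U" by (rule antimonoI) (rule UN_mono, simp_all)
    qed
    have geU: "\<eta> \<le> measure (resample z) (?U n)" for n
    proof -
      have "measure (resample z) (N n) \<le> measure (resample z) (?U n)"
      proof (rule R.finite_measure_mono)
        show "N n \<subseteq> ?U n" by (rule UN_upper) simp
        show "?U n \<in> sets (resample z)"
          unfolding resample_prob(2) by (rule subsetD[OF obs_tail_subset UT])
      qed
      then show ?thesis using N(3)[of n] by linarith
    qed
    have "\<eta> \<le> measure (resample z) (limsup N)"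
      unfolding lims by (rule LIMSEQ_le_const[OF limU], intro exI allI impI, rule geU)
    moreover have "measure (resample z) (limsup N) \<le> tv_norm (tail m) (resample z) (chain_from P z) / 2"
    proof -
      have ce: "chain_from P z = law_from P (return borel (fst z)) (snd z)"
        using chain_from_eq_law_from[of "fst z" "snd z"] by simp
      have "emeasure (law_from P (return borel (fst z)) (snd z)) (limsup N) = 0"
        using null_setsD1[OF null] unfolding ce .
      from singular_mass[OF \<alpha>(1) borel_prob_return lT this] show ?thesis
        unfolding \<alpha>(2)[symmetric] ce[symmetric] .
    qed
    ultimately show False using m \<eta> by linarith
  qed
qed

text \<open>The constants of \<open>resample_absolutely_continuous\<close> can be chosen uniformly off a set of small probability.
  Since the chain is stationary, they then serve at every time.\<close>

lemma resample_uniformly_absolutely_continuous: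
  assumes \<eta>: "0 < (\<eta> :: real)"
  obtains m d Z where "0 < (d :: real)" "Z \<in> sets borel" "measure lam (UNIV - Z) \<le> \<eta>"
    "\<And>z N. z \<in> Z \<Longrightarrow> N \<in> sets (obs_tail m) \<Longrightarrow> measure (chain_from P z) N < d \<Longrightarrow> measure (resample z) N \<le> \<eta>"
proof -
  interpret lam: prob_space lam by (rule borel_probD[OF lam(1)])
  define gen where "gen m \<C> \<longleftrightarrow> countable \<C> \<and> algebra UNIV \<C> \<and> sets (obs_tail m) = sigma_sets UNIV \<C>" for m \<C>
  have "\<exists>\<C>. gen m \<C>" for m
  proof -
    obtain C where C: "countable C" "sets (obs_tail m) = sigma_sets UNIV C"
      using obs_tail_generated[of m] by (elim exE conjE) (rule that)
    obtain \<C> where "countable \<C>" "algebra UNIV \<C>" "sets (obs_tail m) = sigma_sets UNIV \<C>"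
      by (rule countable_generating_algebra[OF C])
    then have "gen m \<C>" unfolding gen_def by (intro conjI)
    then show ?thesis ..
  qed
  then have ex: "\<exists>\<C>. \<forall>m. gen m (\<C> m)" by (intro choice allI)
  obtain \<C> where gen: "\<forall>m. gen m (\<C> m)" using ex ..
  have \<C>: "countable (\<C> m)" "algebra UNIV (\<C> m)" "sets (obs_tail m) = sigma_sets UNIV (\<C> m)" for m
    using gen unfolding gen_def by simp_all
  define good where "good i z \<longleftrightarrow> (\<forall>N\<in>sets (obs_tail i). measure (chain_from P z) N < 1 / real (Suc i) \<longrightarrow> measure (resample z) N \<le> \<eta>)" for i z
  define bad where "bad i = (\<Union>N\<in>\<C> i. {z. measure (chain_from P z) N < 1 / real (Suc i) \<and> \<eta> < measure (resample z) N})" for i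
  have \<C>sub: "\<C> i \<subseteq> sets (obs_tail i)" for i using \<C>(3) by auto
  have bad_good: "z \<in> bad i \<longleftrightarrow> \<not> good i z" for z i
  proof
    assume "z \<in> bad i"
    then obtain N where "N \<in> \<C> i" "measure (chain_from P z) N < 1 / real (Suc i)" "\<eta> < measure (resample z) N"
      by (auto simp: bad_def)
    then show "\<not> good i z" using \<C>sub[of i] by (auto simp: good_def not_le intro!: bexI[of _ N])
  next
    assume "\<not> good i z"
    then obtain N where N: "N \<in> sets (obs_tail i)" "measure (chain_from P z) N < 1 / real (Suc i)" "\<eta> < measure (resample z) N"
      by (auto simp: good_def not_le)
    interpret L: prob_space "chain_from P z" by (rule chain_from_prob[OF P])
    interpret R: prob_space "resample z" by (rule resample_prob)
    define e where "e = min (1 / real (Suc i) - measure (chain_from P z) N) (measure (resample z) N - \<eta>)"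
    have e: "0 < e" using N by (simp add: e_def)
    have sub: "\<C> i \<subseteq> sets (chain_from P z)" "\<C> i \<subseteq> sets (resample z)"
      using \<C>sub[of i] obs_tail_subset[of i] by (auto simp: chain_from_prob[OF P] resample_prob)
    obtain C where C: "C \<in> \<C> i" "measure (chain_from P z) ((N - C) \<union> (C - N)) < e" "measure (resample z) ((N - C) \<union> (C - N)) < e"
      using algebra_approximation[OF L.finite_measure_axioms R.finite_measure_axioms chain_from_space[OF P] resample_prob(3) \<C>(2) sub, of N e]
        N(1) \<C>(3)[of i] e by auto
    have s: "N \<in> sets (chain_from P z)" "C \<in> sets (chain_from P z)" "N \<in> sets (resample z)" "C \<in> sets (resample z)"
      using sub C N(1) obs_tail_subset[of i] by (auto simp: chain_from_prob[OF P] resample_prob)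
    have "measure (chain_from P z) C \<le> measure (chain_from P z) (N \<union> ((N - C) \<union> (C - N)))"
      using s by (intro L.finite_measure_mono) auto
    also have "\<dots> \<le> measure (chain_from P z) N + measure (chain_from P z) ((N - C) \<union> (C - N))"
      using s by (intro measure_Un_le) auto
    finally have 1: "measure (chain_from P z) C < 1 / real (Suc i)" using C(2) unfolding e_def by linarith
    have "measure (resample z) N \<le> measure (resample z) (C \<union> ((N - C) \<union> (C - N)))"
      using s by (intro R.finite_measure_mono) auto
    also have "\<dots> \<le> measure (resample z) C + measure (resample z) ((N - C) \<union> (C - N))"
      using s by (intro measure_Un_le) auto
    finally have 2: "\<eta> < measure (resample z) C" using C(3) unfolding e_def by linarith
    show "z \<in> bad i" unfolding bad_def using C(1) 1 2 by blast
  qed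
  have badm: "bad i \<in> sets borel" for i
    unfolding bad_def
  proof (rule sets.countable_UN''[OF \<C>(1)])
    fix N assume "N \<in> \<C> i"
    then have N: "N \<in> sets path_space" using \<C>sub[of i] obs_tail_subset[of i] by blast
    have [measurable]: "(\<lambda>z. measure (chain_from P z) N) \<in> borel_measurable borel" "(\<lambda>z. measure (resample z) N) \<in> borel_measurable borel"
      by (rule measurable_compose[OF chain_from_measurable[OF P] measurable_measure_prob_algebra[OF N]],
          rule measurable_compose[OF resample_measurable measurable_measure_prob_algebra[OF N]])
    have "{z \<in> space borel. measure (chain_from P z) N < 1 / real (Suc i) \<and> \<eta> < measure (resample z) N} \<in> sets borel"
      by measurable
    then show "{z. measure (chain_from P z) N < 1 / real (Suc i) \<and> \<eta> < measure (resample z) N} \<in> sets borel" by simp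
  qed
  have mono: "good j z" if "i \<le> j" "good i z" for i j z
    unfolding good_def
  proof (intro ballI impI)
    fix N assume N: "N \<in> sets (obs_tail j)" "measure (chain_from P z) N < 1 / real (Suc j)"
    have "1 / real (Suc j) \<le> 1 / real (Suc i)" using that(1) by (intro divide_left_mono) auto
    with N that obs_tail_antimono[OF that(1)] show "measure (resample z) N \<le> \<eta>" by (auto simp: good_def)
  qed
  have "AE z in lam. \<exists>i. good i z"
    using resample_tendsto
  proof eventually_elim
    case (elim z)
    then obtain \<alpha> where "borel_prob \<alpha>" "resample z = law_from P \<alpha> (snd z)" by blast
    from resample_absolutely_continuous[OF this conjunct2[OF elim] \<eta>] obtain m j
      where mj: "\<And>N. N \<in> sets (obs_tail m) \<Longrightarrow> measure (chain_from P z) N < 1 / real (Suc j) \<Longrightarrow> measure (resample z) N \<le> \<eta>"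
      by blast
    have "good (max m j) z"
      unfolding good_def
    proof (intro ballI impI)
      fix N assume N: "N \<in> sets (obs_tail (max m j))" "measure (chain_from P z) N < 1 / real (Suc (max m j))"
      have "1 / real (Suc (max m j)) \<le> 1 / real (Suc j)" by (intro divide_left_mono) auto
      with N obs_tail_antimono[of m "max m j"] show "measure (resample z) N \<le> \<eta>" by (intro mj) auto
    qed
    then show ?case by blast
  qed
  then have "AE z in lam. z \<notin> (\<Inter>i. bad i)" by eventually_elim (auto simp: bad_good)
  moreover have badl: "bad i \<in> sets lam" for i using badm by (simp add: borel_probD[OF lam(1)])
  then have "(\<Inter>i. bad i) \<in> sets lam" by (intro sets.countable_INT) auto
  ultimately have "(\<Inter>i. bad i) \<in> null_sets lam" by (simp add: AE_iff_null_sets)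
  then have z: "measure lam (\<Inter>i. bad i) = 0" by (simp add: measure_def null_setsD1)
  have "(\<lambda>i. measure lam (bad i)) \<longlonglongrightarrow> measure lam (\<Inter>i. bad i)"
  proof (rule lam.finite_Lim_measure_decseq)
    show "range bad \<subseteq> sets lam" using badl by auto
    show "antimono bad" by (rule antimonoI) (use bad_good mono in blast)
  qed
  then have "(\<lambda>i. measure lam (bad i)) \<longlonglongrightarrow> 0" using z by simp
  from order_tendstoD(2)[OF this \<eta>] obtain i where i: "measure lam (bad i) < \<eta>"
    by (auto simp: eventually_sequentially)
  show thesis
  proof (rule that[of "1 / real (Suc i)" "UNIV - bad i" i])
    show "UNIV - bad i \<in> sets borel" using badm[of i] by (simp flip: Compl_eq_Diff_UNIV)
    show "measure lam (UNIV - (UNIV - bad i)) \<le> \<eta>" using i by (simp add: double_diff)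
    show "measure (resample z) N \<le> \<eta>" if "z \<in> UNIV - bad i" "N \<in> sets (obs_tail i)" "measure (chain_from P z) N < 1 / real (Suc i)" for z N
      using that bad_good[of z i] by (auto simp: good_def)
  qed simp
qed

end

section \<open>Conditional densities are nearly observable\<close>

text \<open>Clipping changes the conditional expectation on a null set only. The bounds have to hold at every path,
  because the function is evaluated along resampled paths, whose law need not be the original one.\<close>

lemma bounded_cond_exp:
  fixes f :: "'a \<Rightarrow> real"
  assumes M: "prob_space M" and sub: "subalgebra M G" and f: "f \<in> borel_measurable M" "\<And>x. 0 \<le> f x" "\<And>x. f x \<le> c"
  obtains W where "W \<in> borel_measurable G" "\<And>x. 0 \<le> W x" "\<And>x. W x \<le> c"
    "\<And>h b. h \<in> borel_measurable G \<Longrightarrow> (\<And>x. \<bar>h x\<bar> \<le> b) \<Longrightarrow> (\<integral>x. h x * f x \<partial>M) = (\<integral>x. h x * W x \<partial>M)"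
proof -
  interpret prob_space M by fact
  interpret finite_measure_subalgebra M G by unfold_locales (rule sub)
  have int: "integrable M f" by (rule integrable_const_bound[of _ c]) (use f in auto)
  let ?E = "real_cond_exp M G f"
  define W where "W x = min c (max 0 (?E x))" for x
  have AE: "AE x in M. ?E x = W x"
    using real_cond_exp_ge_c[OF int, of 0] real_cond_exp_le_c[OF int, of c] f
    by (auto simp: W_def elim!: eventually_elim2)
  have Em: "?E \<in> borel_measurable G" by simp
  show thesis
  proof
    show Wm: "W \<in> borel_measurable G" unfolding W_def by measurable
    have c: "0 \<le> c" using order_trans[OF f(2,3)] .
    show "0 \<le> W x" "W x \<le> c" for x using c by (auto simp: W_def)
    fix h and b :: real assume h: "h \<in> borel_measurable G" "\<And>x. \<bar>h x\<bar> \<le> b"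
    have hM[measurable]: "h \<in> borel_measurable M" by (rule measurable_from_subalg[OF sub h(1)])
    have [measurable]: "W \<in> borel_measurable M" by (rule measurable_from_subalg[OF sub Wm])
    have "integrable M (\<lambda>x. h x * f x)"
    proof (rule integrable_const_bound[of _ "b * c"])
      show "AE x in M. norm (h x * f x) \<le> b * c"
        using h f by (intro AE_I2) (auto simp: abs_mult intro!: mult_mono intro: order_trans[OF abs_ge_zero])
    qed (use f in simp)
    from real_cond_exp_intg(2)[OF this h(1) f(1)]
    have "(\<integral>x. h x * f x \<partial>M) = (\<integral>x. h x * ?E x \<partial>M)" by simp
    also have "\<dots> = (\<integral>x. h x * W x \<partial>M)"
      using AE by (intro integral_cong_AE) auto
    finally show "(\<integral>x. h x * f x \<partial>M) = (\<integral>x. h x * W x \<partial>M)" .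
  qed
qed

abbreviation past_field :: "nat \<Rightarrow> (nat \<Rightarrow> 'e::polish_space \<times> 'f::polish_space) measure" where
  "past_field n \<equiv> coord_field (sets borel) {..<n} {..<n}"

lemma past_field_subset: "sets (past_field n) \<subseteq> sets path_space"
  by (rule coord_field_subset_path_space) simp

lemma past_set_approximation:
  fixes M :: "(nat \<Rightarrow> 'e::polish_space \<times> 'f::polish_space) measure"
  assumes "prob_space M" "sets M = sets path_space" "A \<in> sets M" "0 < (e::real)"
  shows "\<exists>n C. C \<in> sets (past_field n) \<and> measure M ((A - C) \<union> (C - A)) < e"
proof -
  interpret prob_space M by fact
  let ?\<A> = "\<Union>n. sets (past_field n) :: (nat \<Rightarrow> 'e \<times> 'f) set set"
  have mono: "sets (past_field n) \<subseteq> sets (past_field m :: (nat \<Rightarrow> 'e \<times> 'f) measure)" if "n \<le> m" for n m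
    using that by (intro coord_field_mono) auto
  have alg: "algebra UNIV ?\<A>"
    unfolding algebra_iff_Un
  proof (intro conjI ballI)
    show "{} \<in> ?\<A>" by blast
    show "UNIV - a \<in> ?\<A>" if a: "a \<in> ?\<A>" for a
    proof -
      obtain n where "a \<in> sets (past_field n)" using a by blast
      then have "UNIV - a \<in> sets (past_field n)" using sets.compl_sets[of a "past_field n"] by simp
      then show ?thesis by blast
    qed
    show "a \<union> b \<in> ?\<A>" if ab: "a \<in> ?\<A>" "b \<in> ?\<A>" for a b
    proof -
      obtain n m where "a \<in> sets (past_field n)" "b \<in> sets (past_field m)" using ab by blast
      then have "a \<in> sets (past_field (max n m))" "b \<in> sets (past_field (max n m))"
        using mono[of n "max n m"] mono[of m "max n m"] by auto
      then have "a \<union> b \<in> sets (past_field (max n m))" by (rule sets.Un)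
      then show ?thesis by blast
    qed
  qed simp
  have "sets (path_space :: (nat \<Rightarrow> 'e \<times> 'f) measure) \<subseteq> sigma_sets UNIV ?\<A>"
    unfolding sets_path_space_eq_coord_field sets_coord_field[of _ UNIV]
  proof (rule sigma_sets_mono', rule subsetI)
    fix S :: "(nat \<Rightarrow> 'e \<times> 'f) set"
    assume "S \<in> {coord_Y k -` B | k B. k \<in> UNIV \<and> B \<in> sets borel} \<union> {coord_X k -` A | k A. k \<in> UNIV \<and> A \<in> sets borel}"
    then consider k B where "S = coord_Y k -` B" "B \<in> sets borel" | k A where "S = coord_X k -` A" "A \<in> sets borel"
      by blast
    then show "S \<in> ?\<A>"
    proof cases
      case 1
      have "S \<in> sets (past_field (Suc k))"
        using measurable_sets[OF coord_Y_measurable_coord_field[of k "{..<Suc k}"] 1(2)] 1(1) by simp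
      then show ?thesis by blast
    next
      case 2
      have "S \<in> sets (past_field (Suc k))"
        unfolding 2(1) by (rule coord_X_in_coord_field) (use 2 in auto)
      then show ?thesis by blast
    qed
  qed
  then have A: "A \<in> sigma_sets UNIV ?\<A>" using assms by auto
  have sub: "?\<A> \<subseteq> sets M" using past_field_subset assms(2) by blast
  have sp: "space M = UNIV" using sets_eq_imp_space_eq[OF assms(2)] by simp
  from algebra_approximation[OF finite_measure_axioms finite_measure_axioms sp sp alg sub sub A assms(4)]
  show ?thesis by blast
qed

text \<open>Events of the finite past form an algebra that generates the path space, so they are dense; simple
  functions and dominated convergence do the rest.\<close>

lemma past_function_approximation:
  fixes M :: "(nat \<Rightarrow> 'e::polish_space \<times> 'f::polish_space) measure" and f :: "_ \<Rightarrow> real"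
  assumes M: "prob_space M" "sets M = sets path_space" and f: "integrable M f" and e: "0 < (e::real)"
  shows "\<exists>n C. C \<in> borel_measurable (past_field n) \<and> integrable M C \<and> (\<integral>x. \<bar>f x - C x\<bar> \<partial>M) < e"
  using f e
proof (induction f arbitrary: e rule: integrable_induct)
  case (base A c)
  interpret prob_space M by fact
  have "0 < e / (\<bar>c\<bar> + 1)" using base by simp
  from past_set_approximation[OF M base(1) this] obtain n C
    where C: "C \<in> sets (past_field n)" "measure M ((A - C) \<union> (C - A)) < e / (\<bar>c\<bar> + 1)" by blast
  have CM: "C \<in> sets M" using C past_field_subset M(2) by blast
  have "(\<integral>x. \<bar>indicator A x *\<^sub>R c - indicator C x *\<^sub>R c\<bar> \<partial>M) = (\<integral>x. \<bar>c\<bar> * indicator ((A - C) \<union> (C - A)) x \<partial>M)"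
    by (intro Bochner_Integration.integral_cong) (auto simp: indicator_def)
  also have "\<dots> = \<bar>c\<bar> * measure M ((A - C) \<union> (C - A))" using base(1) CM by simp
  also have "\<dots> \<le> (\<bar>c\<bar> + 1) * measure M ((A - C) \<union> (C - A))" by (intro mult_right_mono) auto
  also have "\<dots> < e" using C(2) by (simp add: pos_less_divide_eq mult.commute)
  finally have "(\<integral>x. \<bar>indicator A x *\<^sub>R c - indicator C x *\<^sub>R c\<bar> \<partial>M) < e" .
  moreover have "(\<lambda>x. indicator C x *\<^sub>R c) \<in> borel_measurable (past_field n)" using C(1) by simp
  moreover have "integrable M (\<lambda>x. indicator C x *\<^sub>R c)" using CM by (simp add: emeasure_eq_measure)
  ultimately show ?case by blast
next
  case (add f g)
  have "0 < e/2" using add by simp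
  then obtain n C m D where C: "C \<in> borel_measurable (past_field n)" "integrable M C" "(\<integral>x. \<bar>f x - C x\<bar> \<partial>M) < e/2"
    and D: "D \<in> borel_measurable (past_field m)" "integrable M D" "(\<integral>x. \<bar>g x - D x\<bar> \<partial>M) < e/2"
    using add.IH by meson
  have up: "h \<in> borel_measurable (past_field (max n m))" if "h \<in> borel_measurable (past_field k)" "k \<le> max n m" for h :: "(nat \<Rightarrow> 'e \<times> 'f) \<Rightarrow> real" and k
  proof (rule measurable_from_subalg[OF _ that(1)])
    have "sets (past_field k) \<subseteq> sets (past_field (max n m) :: (nat \<Rightarrow> 'e \<times> 'f) measure)"
      using that(2) by (intro coord_field_mono) auto
    then show "subalgebra (past_field (max n m)) (past_field k :: (nat \<Rightarrow> 'e \<times> 'f) measure)" by (simp add: subalgebra_def)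
  qed
  have "(\<lambda>x. C x + D x) \<in> borel_measurable (past_field (max n m))"
    using up[OF C(1)] up[OF D(1)] by simp
  moreover have "(\<integral>x. \<bar>(f x + g x) - (C x + D x)\<bar> \<partial>M) < e"
  proof -
    have "(\<integral>x. \<bar>(f x + g x) - (C x + D x)\<bar> \<partial>M) \<le> (\<integral>x. \<bar>f x - C x\<bar> + \<bar>g x - D x\<bar> \<partial>M)"
      using add C D by (intro integral_mono) auto
    also have "\<dots> = (\<integral>x. \<bar>f x - C x\<bar> \<partial>M) + (\<integral>x. \<bar>g x - D x\<bar> \<partial>M)"
      using add C D by (intro Bochner_Integration.integral_add) auto
    finally show ?thesis using C(3) D(3) by linarith
  qed
  ultimately show ?case using C(2) D(2) by (intro exI[of _ "max n m"] exI[of _ "\<lambda>x. C x + D x"]) auto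
next
  case (lim f s)
  have "(\<lambda>i. \<integral>x. \<bar>s i x - f x\<bar> \<partial>M) \<longlonglongrightarrow> (\<integral>x. \<bar>f x - f x\<bar> \<partial>M)"
  proof (rule integral_dominated_convergence[where w="\<lambda>x. 3 * \<bar>f x\<bar>"])
    show "AE x in M. (\<lambda>i. \<bar>s i x - f x\<bar>) \<longlonglongrightarrow> \<bar>f x - f x\<bar>"
      using lim by (intro AE_I2 tendsto_intros) auto
    show "AE x in M. norm \<bar>s i x - f x\<bar> \<le> 3 * \<bar>f x\<bar>" for i
    proof (rule AE_I2)
      fix x assume "x \<in> space M"
      then have "norm (s i x) \<le> 2 * norm (f x)" using lim by simp
      then show "norm \<bar>s i x - f x\<bar> \<le> 3 * \<bar>f x\<bar>" by simp
    qed
  qed (use lim in auto)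
  then have "(\<lambda>i. \<integral>x. \<bar>s i x - f x\<bar> \<partial>M) \<longlonglongrightarrow> 0" by simp
  from order_tendstoD(2)[OF this, of "e/2"] lim(6) obtain i where i: "(\<integral>x. \<bar>s i x - f x\<bar> \<partial>M) < e/2"
    by (auto simp: eventually_sequentially)
  have "0 < e/2" using lim by simp
  then obtain n C where C: "C \<in> borel_measurable (past_field n)" "integrable M C" "(\<integral>x. \<bar>s i x - C x\<bar> \<partial>M) < e/2"
    using lim.IH by meson
  have "(\<integral>x. \<bar>f x - C x\<bar> \<partial>M) \<le> (\<integral>x. \<bar>s i x - f x\<bar> + \<bar>s i x - C x\<bar> \<partial>M)"
    using lim C by (intro integral_mono) auto
  also have "\<dots> = (\<integral>x. \<bar>s i x - f x\<bar> \<partial>M) + (\<integral>x. \<bar>s i x - C x\<bar> \<partial>M)"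
    using lim C by (intro Bochner_Integration.integral_add) auto
  finally show ?case using C i by (intro exI[of _ n] exI[of _ C]) auto
qed

lemma tv_norm_commute: "tv_norm G \<rho> \<rho>' = tv_norm G \<rho>' \<rho>"
  by (simp add: tv_norm_def abs_minus_commute)

lemma splice_at_measurable1:
  fixes W :: "(nat \<Rightarrow> 'e::polish_space \<times> 'f::polish_space) \<Rightarrow> real"
  assumes "W \<in> borel_measurable (coord_field \<E> UNIV {n + m..})"
  shows "(\<lambda>\<omega>'. W (splice_at n \<omega> \<omega>')) \<in> borel_measurable (coord_field \<E> UNIV {m..})"
  using measurable_compose[OF measurable_compose[OF measurable_Pair1' splice_at_measurable_coord_field] assms, of \<omega>]
  by simp

lemma ennreal_affine:
  assumes "0 \<le> a" "0 \<le> b" "0 \<le> p" "0 \<le> q" "0 \<le> r"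
  shows "ennreal a + ennreal b * ennreal p + ennreal q * ennreal r = ennreal (a + b * p + q * r)"
  using assms by (simp add: ennreal_mult[symmetric] ennreal_plus[symmetric] del: ennreal_plus)

context ergodic_chain
begin

text \<open>Conditional expectations given a decreasing sequence of \<open>\<sigma>\<close>-fields are successive orthogonal projections:
  \<open>\<parallel>W\<^sub>m - W\<^sub>k\<parallel>\<^sup>2 = \<parallel>W\<^sub>m\<parallel>\<^sup>2 - \<parallel>W\<^sub>k\<parallel>\<^sup>2\<close> for \<open>m \<le> k\<close>, and the squared norms decrease.\<close>

lemma cond_exp_L2_Cauchy:
  assumes \<Lambda>: "\<Lambda> \<in> borel_measurable path_space" "\<And>\<omega>. 0 \<le> \<Lambda> \<omega>" "\<And>\<omega>. \<Lambda> \<omega> \<le> (c::real)"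
  obtains W where "\<And>m. W m \<in> borel_measurable (obs_tail m)" "\<And>m \<omega>. 0 \<le> W m \<omega>" "\<And>m \<omega>. W m \<omega> \<le> c"
    "\<And>m h b. h \<in> borel_measurable (obs_tail m) \<Longrightarrow> (\<And>\<omega>. \<bar>h \<omega>\<bar> \<le> b) \<Longrightarrow>
      (\<integral>\<omega>. h \<omega> * \<Lambda> \<omega> \<partial>chain_law P lam) = (\<integral>\<omega>. h \<omega> * W m \<omega> \<partial>chain_law P lam)"
    "\<And>e. 0 < e \<Longrightarrow> \<exists>m. \<forall>k\<ge>m. (\<integral>\<omega>. (W m \<omega> - W k \<omega>)\<^sup>2 \<partial>chain_law P lam) < e"
proof -
  let ?M = "chain_law P lam"
  interpret M: prob_space ?M by (rule chain_law_prob[OF P lam(1)])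
  note sM = chain_law_prob(1)[OF P lam(1)]
  have sub: "subalgebra ?M (obs_tail m)" for m
    using obs_tail_subset[of m] by (simp add: subalgebra_def chain_law_space[OF P lam(1)] sM)
  have \<Lambda>M: "\<Lambda> \<in> borel_measurable ?M" using \<Lambda>(1) by (simp add: measurable_cong_sets[OF sM refl])
  define good where "good m W \<longleftrightarrow> W \<in> borel_measurable (obs_tail m) \<and> (\<forall>\<omega>. 0 \<le> W \<omega>) \<and> (\<forall>\<omega>. W \<omega> \<le> c) \<and>
    (\<forall>h b. h \<in> borel_measurable (obs_tail m) \<longrightarrow> (\<forall>\<omega>. \<bar>h \<omega>\<bar> \<le> b) \<longrightarrow>
      (\<integral>\<omega>. h \<omega> * \<Lambda> \<omega> \<partial>?M) = (\<integral>\<omega>. h \<omega> * W \<omega> \<partial>?M))" for m and W :: "(nat \<Rightarrow> 'e \<times> 'f) \<Rightarrow> real"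
  have "\<exists>W. good m W" for m
  proof (rule bounded_cond_exp[OF M.prob_space_axioms sub[of m] \<Lambda>M \<Lambda>(2,3)])
    fix W :: "(nat \<Rightarrow> 'e \<times> 'f) \<Rightarrow> real"
    assume "W \<in> borel_measurable (obs_tail m)" "\<And>x. 0 \<le> W x" "\<And>x. W x \<le> c"
      "\<And>h b. h \<in> borel_measurable (obs_tail m) \<Longrightarrow> (\<And>x. \<bar>h x\<bar> \<le> b) \<Longrightarrow> (\<integral>x. h x * \<Lambda> x \<partial>?M) = (\<integral>x. h x * W x \<partial>?M)"
    then have "good m W" unfolding good_def by blast
    then show "\<exists>W. good m W" by (intro exI[where x=W])
  qed
  then have ex: "\<exists>W. \<forall>m. good m (W m)" by (intro choice allI)
  obtain W where "\<forall>m. good m (W m)" using ex ..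
  then have W: "W m \<in> borel_measurable (obs_tail m)" "0 \<le> W m \<omega>" "W m \<omega> \<le> c"
    and Wce: "h \<in> borel_measurable (obs_tail m) \<Longrightarrow> (\<And>\<omega>. \<bar>h \<omega>\<bar> \<le> b) \<Longrightarrow>
      (\<integral>\<omega>. h \<omega> * \<Lambda> \<omega> \<partial>?M) = (\<integral>\<omega>. h \<omega> * W m \<omega> \<partial>?M)" for m \<omega> h b
    unfolding good_def by blast+
  have WM[measurable]: "W m \<in> borel_measurable ?M" for m by (rule measurable_from_subalg[OF sub W(1)])
  have Wabs: "\<bar>W m \<omega>\<bar> \<le> c" for m \<omega> using W(2,3)[of m \<omega>] by simp
  have int: "integrable ?M (\<lambda>\<omega>. W m \<omega> * W k \<omega>)" for m k
  proof (rule M.integrable_const_bound[of _ "c * c"])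
    show "AE \<omega> in ?M. norm (W m \<omega> * W k \<omega>) \<le> c * c"
      using Wabs by (intro AE_I2) (auto simp: abs_mult intro!: mult_mono intro: order_trans[OF abs_ge_zero])
  qed simp
  define e where "e m = (\<integral>\<omega>. W m \<omega> * W m \<omega> \<partial>?M)" for m
  have cross: "(\<integral>\<omega>. W k \<omega> * W m \<omega> \<partial>?M) = e k" if "m \<le> k" for m k
  proof -
    have "subalgebra (obs_tail m) (obs_tail k)" using obs_tail_antimono[OF that] by (simp add: subalgebra_def)
    then have "W k \<in> borel_measurable (obs_tail m)" by (rule measurable_from_subalg[OF _ W(1)])
    from Wce[OF this Wabs] Wce[OF W(1) Wabs, of k] show ?thesis by (simp add: e_def)
  qed
  have sq: "(\<integral>\<omega>. (W m \<omega> - W k \<omega>)\<^sup>2 \<partial>?M) = e m - e k" if "m \<le> k" for m k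
  proof -
    have "(\<integral>\<omega>. (W m \<omega> - W k \<omega>)\<^sup>2 \<partial>?M) = (\<integral>\<omega>. W m \<omega> * W m \<omega> - 2 * (W k \<omega> * W m \<omega>) + W k \<omega> * W k \<omega> \<partial>?M)"
      by (intro Bochner_Integration.integral_cong) (auto simp: power2_eq_square algebra_simps)
    also have "\<dots> = e m - 2 * (\<integral>\<omega>. W k \<omega> * W m \<omega> \<partial>?M) + e k"
      using int by (simp add: e_def)
    finally show ?thesis using cross[OF that] by simp
  qed
  have dec: "e k \<le> e m" if "m \<le> k" for m k
  proof -
    have "0 \<le> (\<integral>\<omega>. (W m \<omega> - W k \<omega>)\<^sup>2 \<partial>?M)" by (intro integral_nonneg_AE AE_I2) simp
    then show ?thesis using sq[OF that] by simp
  qed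
  have "0 \<le> e m" for m unfolding e_def using W(2) by (intro integral_nonneg_AE AE_I2) simp
  then obtain L where L: "e \<longlonglongrightarrow> L" "\<And>i. L \<le> e i"
    using decseq_convergent[of e 0] dec by (auto simp: decseq_def)
  have Cauchy: "\<exists>m. \<forall>k\<ge>m. (\<integral>\<omega>. (W m \<omega> - W k \<omega>)\<^sup>2 \<partial>?M) < d" if d: "0 < d" for d
  proof -
    have "L < L + d" using d by simp
    from order_tendstoD(2)[OF L(1) this] obtain m where "e m < L + d" by (auto simp: eventually_sequentially)
    then have "\<forall>k\<ge>m. (\<integral>\<omega>. (W m \<omega> - W k \<omega>)\<^sup>2 \<partial>?M) < d"
      using sq[of m] L(2) by (smt (verit))
    then show ?thesis ..
  qed
  show thesis by (rule that[of W]) (fact W Wce Cauchy)+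
qed

lemma measurable_resample_at:
  "(\<lambda>\<omega>. resample (\<omega> n)) \<in> FY 0 (enat n) \<rightarrow>\<^sub>M prob_algebra path_space"
proof -
  have "(\<lambda>\<omega> _. \<omega> n) \<in> FY 0 (enat n) \<rightarrow>\<^sub>M (FY 0 (enat 0) :: (nat \<Rightarrow> 'e \<times> 'f) measure)"
    unfolding FY_eq
  proof (rule measurable_coord_fieldI)
    show "(\<lambda>\<omega>. coord_Y k (\<lambda>_. \<omega> n :: 'e \<times> 'f)) \<in> coord_field {} {..n} {} \<rightarrow>\<^sub>M borel" for k
      using coord_Y_measurable_coord_field[of n "{..n}" "{}" "{}"] by (simp add: coord_Y_def[abs_def])
  qed simp
  from measurable_compose[OF this filter_version_facts(2)[OF P lam(1) K]]
  show ?thesis unfolding resample_def .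
qed

text \<open>Either \<open>F\<close> exceeds \<open>t\<close> with small probability for the true chain, hence also for the resampled one, or the
  integral of \<open>F\<close> for the true chain is at least \<open>t * d\<close>, and the last term alone dominates \<open>c\<close>. The point \<open>z\<close>
  enters the right-hand side through integrable terms only, so the bound survives integration over the stationary
  position at any time.\<close>

lemma resampled_integral_bound:
  assumes m: "0 < d" "\<And>z N. z \<in> Z \<Longrightarrow> N \<in> sets (obs_tail m) \<Longrightarrow> measure (chain_from P z) N < d \<Longrightarrow> measure (resample z) N \<le> \<eta>"
    and F: "F \<in> borel_measurable (obs_tail m)" "\<And>\<omega>. 0 \<le> F \<omega>" "\<And>\<omega>. F \<omega> \<le> (c::real)" and c: "0 < c" and t: "0 < t" and \<eta>: "0 \<le> \<eta>"
  shows "(\<integral>\<^sup>+\<omega>. ennreal (F \<omega>) \<partial>resample z) \<le>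
    ennreal (t + c * \<eta>) + ennreal c * indicator (UNIV - Z) z + ennreal (c / (t * d)) * (\<integral>\<^sup>+\<omega>. ennreal (F \<omega>) \<partial>chain_from P z)"
proof -
  interpret L: prob_space "chain_from P z" by (rule chain_from_prob[OF P])
  interpret R: prob_space "resample z" by (rule resample_prob)
  have Fp[measurable]: "F \<in> borel_measurable path_space"
    by (rule measurable_from_subalg[OF _ F(1)]) (use obs_tail_subset in \<open>simp add: subalgebra_def\<close>)
  define N where "N = {\<omega>. t < F \<omega>}"
  have "{\<omega> \<in> space (obs_tail m). t < F \<omega>} \<in> sets (obs_tail m)" using F(1) by measurable
  then have NT: "N \<in> sets (obs_tail m)" by (simp add: N_def)
  have Np: "N \<in> sets path_space" by (rule subsetD[OF obs_tail_subset NT])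
  have NR: "N \<in> sets (resample z)" and NL: "N \<in> sets (chain_from P z)"
    using Np by (simp_all add: resample_prob chain_from_prob[OF P])
  have "(\<integral>\<^sup>+\<omega>. ennreal (F \<omega>) \<partial>resample z) \<le> (\<integral>\<^sup>+\<omega>. ennreal t + ennreal c * indicator N \<omega> \<partial>resample z)"
  proof (rule nn_integral_mono)
    fix \<omega>
    have "F \<omega> \<le> t + c * indicator N \<omega>" using F(3)[of \<omega>] t by (auto simp: N_def indicator_def)
    then have "ennreal (F \<omega>) \<le> ennreal (t + c * indicator N \<omega>)" by (rule ennreal_leI)
    also have "\<dots> = ennreal t + ennreal c * indicator N \<omega>"
      using t c by (simp add: ennreal_plus[symmetric] indicator_def del: ennreal_plus)
    finally show "ennreal (F \<omega>) \<le> ennreal t + ennreal c * indicator N \<omega>" .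
  qed
  also have "\<dots> = ennreal t + ennreal c * emeasure (resample z) N"
    using NR R.emeasure_space_1 by (simp add: nn_integral_add nn_integral_cmult_indicator)
  also have "\<dots> = ennreal (t + c * measure (resample z) N)"
    using t c by (simp add: R.emeasure_eq_measure ennreal_mult'[symmetric] measure_nonneg)
  finally have 1: "(\<integral>\<^sup>+\<omega>. ennreal (F \<omega>) \<partial>resample z) \<le> ennreal (t + c * measure (resample z) N)" .
  consider "z \<notin> Z" | "z \<in> Z" "measure (chain_from P z) N < d" | "d \<le> measure (chain_from P z) N" by linarith
  then show ?thesis
  proof cases
    case 1
    have "measure (resample z) N \<le> 1" by (rule R.prob_le_1)
    then have "t + c * measure (resample z) N \<le> (t + c * \<eta>) + c" using c \<eta> mult_left_mono[of "measure (resample z) N" 1 c]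
      by (smt (verit) mult_nonneg_nonneg mult_cancel_left2)
    then have "ennreal (t + c * measure (resample z) N) \<le> ennreal ((t + c * \<eta>) + c)" by (rule ennreal_leI)
    also have "\<dots> = ennreal (t + c * \<eta>) + ennreal c * indicator (UNIV - Z) z"
      using 1 t c \<eta> by (simp add: ennreal_plus)
    finally show ?thesis using \<open>(\<integral>\<^sup>+\<omega>. ennreal (F \<omega>) \<partial>resample z) \<le> ennreal (t + c * measure (resample z) N)\<close>
      by (meson order_trans add_increasing2 zero_le order_refl)
  next
    case 2
    have "t + c * measure (resample z) N \<le> t + c * \<eta>" using m(2)[OF 2(1) NT 2(2)] c by simp
    then have "ennreal (t + c * measure (resample z) N) \<le> ennreal (t + c * \<eta>)" by (rule ennreal_leI)
    with 1 have "(\<integral>\<^sup>+\<omega>. ennreal (F \<omega>) \<partial>resample z) \<le> ennreal (t + c * \<eta>)" by (rule order_trans)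
    also have "\<dots> \<le> ennreal (t + c * \<eta>) + ennreal c * indicator (UNIV - Z) z + ennreal (c / (t * d)) * (\<integral>\<^sup>+\<omega>. ennreal (F \<omega>) \<partial>chain_from P z)"
      by (simp add: add.assoc)
    finally show ?thesis .
  next
    case 3
    have "ennreal (t * d) \<le> ennreal t * emeasure (chain_from P z) N"
      using 3 t m(1) by (simp add: L.emeasure_eq_measure ennreal_mult'[symmetric] measure_nonneg ennreal_leI mult_left_mono)
    also have "\<dots> = (\<integral>\<^sup>+\<omega>. ennreal t * indicator N \<omega> \<partial>chain_from P z)"
      using NL by (simp add: nn_integral_cmult_indicator)
    also have "\<dots> \<le> (\<integral>\<^sup>+\<omega>. ennreal (F \<omega>) \<partial>chain_from P z)"
      by (intro nn_integral_mono) (auto simp: N_def indicator_def intro!: ennreal_leI)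
    finally have "ennreal (c / (t * d)) * ennreal (t * d) \<le> ennreal (c / (t * d)) * (\<integral>\<^sup>+\<omega>. ennreal (F \<omega>) \<partial>chain_from P z)"
      by (rule mult_left_mono) simp
    moreover have "ennreal (c / (t * d)) * ennreal (t * d) = ennreal c"
      using t m(1) c by (simp add: ennreal_mult'[symmetric])
    ultimately have G: "ennreal c \<le> ennreal (c / (t * d)) * (\<integral>\<^sup>+\<omega>. ennreal (F \<omega>) \<partial>chain_from P z)" by simp
    have "measure (resample z) N \<le> 1" by (rule R.prob_le_1)
    then have "t + c * measure (resample z) N \<le> (t + c * \<eta>) + c" using c \<eta> mult_left_mono[of "measure (resample z) N" 1 c]
      by (smt (verit) mult_nonneg_nonneg mult_cancel_left2)
    then have "ennreal (t + c * measure (resample z) N) \<le> ennreal ((t + c * \<eta>) + c)" by (rule ennreal_leI)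
    also have "\<dots> = ennreal (t + c * \<eta>) + ennreal c" using t c \<eta> by (simp add: ennreal_plus)
    also have "\<dots> \<le> ennreal (t + c * \<eta>) + ennreal c * indicator (UNIV - Z) z + ennreal (c / (t * d)) * (\<integral>\<^sup>+\<omega>. ennreal (F \<omega>) \<partial>chain_from P z)"
      using G by (intro add_mono) auto
    finally show ?thesis using 1 by (rule order_trans[rotated])
  qed
qed

text \<open>The resampling argument. \<open>U\<close> is the conditional expectation for a time \<open>k\<close> so late that it lies beyond the
  horizon \<open>n\<close> of the approximation \<open>C\<close> by at least the time \<open>m\<close> that resampling requires; \<open>\<theta>\<close> has to be chosen
  before \<open>n\<close>, which is why \<open>m\<close> and \<open>d\<close> must not depend on the time of the resampling.\<close>

lemma cond_exp_near_observable:
  assumes \<Lambda>: "\<Lambda> \<in> borel_measurable path_space" "\<And>\<omega>. 0 \<le> \<Lambda> \<omega>" "\<And>\<omega>. \<Lambda> \<omega> \<le> (c::real)" and \<epsilon>: "0 < (\<epsilon>::real)"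
  obtains M n W V where "M0 \<le> M" "W \<in> borel_measurable (obs_tail M)" "\<And>\<omega>. 0 \<le> W \<omega>" "\<And>\<omega>. W \<omega> \<le> c"
    "\<And>h b. h \<in> borel_measurable (obs_tail M) \<Longrightarrow> (\<And>\<omega>. \<bar>h \<omega>\<bar> \<le> b) \<Longrightarrow>
      (\<integral>\<omega>. h \<omega> * \<Lambda> \<omega> \<partial>chain_law P lam) = (\<integral>\<omega>. h \<omega> * W \<omega> \<partial>chain_law P lam)"
    "V \<in> borel_measurable (FY 0 (enat n))" "\<And>\<omega>. 0 \<le> V \<omega>" "\<And>\<omega>. V \<omega> \<le> c"
    "(\<integral>\<omega>. \<bar>W \<omega> - V \<omega>\<bar> \<partial>chain_law P lam) < \<epsilon>"
proof -
  let ?M = "chain_law P lam"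
  interpret M: prob_space ?M by (rule chain_law_prob[OF P lam(1)])
  interpret lam: prob_space lam by (rule borel_probD[OF lam(1)])
  note sM = chain_law_prob(1)[OF P lam(1)]
  have c0: "0 \<le> c" using order_trans[OF \<Lambda>(2,3)] .
  define c1 where "c1 = c + 1"
  have c1: "0 < c1" "c \<le> c1" using c0 by (simp_all add: c1_def)
  define t \<eta> where "t = \<epsilon> / 4" and "\<eta> = \<epsilon> / (8 * c1)"
  have t: "0 < t" and \<eta>: "0 < \<eta>" using \<epsilon> c1 by (simp_all add: t_def \<eta>_def)
  obtain m d Z where d: "0 < d" and Z: "Z \<in> sets borel" "measure lam (UNIV - Z) \<le> \<eta>"
    and mZ: "\<And>z N. z \<in> Z \<Longrightarrow> N \<in> sets (obs_tail m) \<Longrightarrow> measure (chain_from P z) N < d \<Longrightarrow> measure (resample z) N \<le> \<eta>"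
    by (rule resample_uniformly_absolutely_continuous[OF \<eta>]) (rule that, assumption, assumption, assumption, blast)
  define \<theta> where "\<theta> = (\<epsilon> / 8) / (1 + c1 / (t * d))"
  have td: "0 < t * d" using t d by simp
  have \<theta>: "0 < \<theta>" and \<theta>2: "\<theta> + c1 / (t * d) * \<theta> = \<epsilon> / 8"
  proof -
    have "0 < 1 + c1 / (t * d)" using c1 td by (simp add: add_pos_pos)
    then show "0 < \<theta>" using \<epsilon> by (simp add: \<theta>_def)
    have "a / x * x = a" if "0 < x" for a x :: real using that by simp
    from this[OF \<open>0 < 1 + c1 / (t * d)\<close>] have "\<theta> * (1 + c1 / (t * d)) = \<epsilon> / 8"
      unfolding \<theta>_def .
    then show "\<theta> + c1 / (t * d) * \<theta> = \<epsilon> / 8" by (simp only: distrib_left mult_1_right mult.commute)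
  qed
  obtain W where W: "\<And>m. W m \<in> borel_measurable (obs_tail m)" "\<And>m \<omega>. 0 \<le> W m \<omega>" "\<And>m \<omega>. W m \<omega> \<le> c"
    and Wce: "\<And>m h b. h \<in> borel_measurable (obs_tail m) \<Longrightarrow> (\<And>\<omega>. \<bar>h \<omega>\<bar> \<le> b) \<Longrightarrow>
      (\<integral>\<omega>. h \<omega> * \<Lambda> \<omega> \<partial>?M) = (\<integral>\<omega>. h \<omega> * W m \<omega> \<partial>?M)"
    and Cauchy: "\<And>e. 0 < e \<Longrightarrow> \<exists>m. \<forall>k\<ge>m. (\<integral>\<omega>. (W m \<omega> - W k \<omega>)\<^sup>2 \<partial>?M) < e"
    using cond_exp_L2_Cauchy[OF \<Lambda>] by blast
  have sub: "subalgebra ?M (obs_tail m)" for m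
    using obs_tail_subset[of m] by (simp add: subalgebra_def chain_law_space[OF P lam(1)] sM)
  have WM[measurable]: "W m \<in> borel_measurable ?M" for m by (rule measurable_from_subalg[OF sub W(1)])
  have Wp[measurable]: "W m \<in> borel_measurable path_space" for m
    using WM[of m] by (simp add: measurable_cong_sets[OF sM refl])
  have Wi: "integrable ?M (W m)" for m
    by (rule M.integrable_const_bound[of _ c]) (use W(2,3) in simp_all)
  have "0 < \<theta>\<^sup>2 / 4" using \<theta> by simp
  from Cauchy[OF this] obtain m0 where m0: "\<And>k. k \<ge> m0 \<Longrightarrow> (\<integral>\<omega>. (W m0 \<omega> - W k \<omega>)\<^sup>2 \<partial>?M) < \<theta>\<^sup>2 / 4" by blast
  have "0 < \<theta> / 2" using \<theta> by simp
  from past_function_approximation[OF M.prob_space_axioms sM Wi this]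
  obtain n C0 where C0: "C0 \<in> borel_measurable (past_field n)" "integrable ?M C0" "(\<integral>\<omega>. \<bar>W m0 \<omega> - C0 \<omega>\<bar> \<partial>?M) < \<theta> / 2"
    by blast
  define C where "C \<omega> = min c (max 0 (C0 \<omega>))" for \<omega>
  have Cm: "C \<in> borel_measurable (past_field n)" unfolding C_def using C0(1) by measurable
  have Cp[measurable]: "C \<in> borel_measurable path_space"
    by (rule measurable_from_subalg[OF _ Cm]) (use past_field_subset in \<open>simp add: subalgebra_def\<close>)
  then have CM[measurable]: "C \<in> borel_measurable ?M" by (simp add: measurable_cong_sets[OF sM refl])
  have C: "0 \<le> C \<omega>" "C \<omega> \<le> c" for \<omega> using c0 by (auto simp: C_def)
  have Ci: "integrable ?M C" by (rule M.integrable_const_bound[of _ c]) (use C in simp_all)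
  have Csat: "C (splice_at n \<omega> \<omega>') = C \<omega>" for \<omega> \<omega>'
    by (rule coord_field_fun_saturated[OF Cm]) (auto simp: coord_splice_at)
  (* beyond m0 for the Cauchy estimate, beyond n + m for resampling at time n *)
  define k where "k = n + (m + (m0 + M0))"
  define U where "U = W k"
  have Up[measurable]: "U \<in> borel_measurable path_space" and UM[measurable]: "U \<in> borel_measurable ?M" unfolding U_def by simp_all
  have U: "0 \<le> U \<omega>" "U \<omega> \<le> c" for \<omega> unfolding U_def by (rule W)+
  have Ui: "integrable ?M U" unfolding U_def by (rule Wi)
  have UC: "(\<integral>\<omega>. \<bar>U \<omega> - C \<omega>\<bar> \<partial>?M) < \<theta>"
  proof -
    have "integrable ?M (\<lambda>\<omega>. (W m0 \<omega> - U \<omega>)\<^sup>2)"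
    proof (rule M.integrable_const_bound[of _ "c\<^sup>2"])
      show "AE \<omega> in ?M. norm ((W m0 \<omega> - U \<omega>)\<^sup>2) \<le> c\<^sup>2"
      proof (rule AE_I2)
        fix \<omega>
        have "\<bar>W m0 \<omega> - U \<omega>\<bar> \<le> c" using W(2,3)[of m0 \<omega>] U[of \<omega>] by linarith
        then show "norm ((W m0 \<omega> - U \<omega>)\<^sup>2) \<le> c\<^sup>2" using power_mono[of "\<bar>W m0 \<omega> - U \<omega>\<bar>" c 2] by simp
      qed
    qed simp
    note sqi = this
    (* passes from the L2 estimate to an L1 estimate *)
    have am: "\<bar>x\<bar> \<le> \<theta> / 4 + x\<^sup>2 / \<theta>" for x :: real
    proof -
      have "0 \<le> (\<bar>x\<bar> - \<theta> / 2)\<^sup>2" by simp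
      also have "\<dots> = x\<^sup>2 - \<theta> * \<bar>x\<bar> + \<theta>\<^sup>2 / 4" by (simp add: power2_eq_square algebra_simps)
      finally have "\<theta> * \<bar>x\<bar> \<le> \<theta> * (\<theta> / 4 + x\<^sup>2 / \<theta>)" using \<theta> by (simp add: power2_eq_square algebra_simps)
      then show ?thesis using \<theta> by (simp only: mult_le_cancel_left_pos)
    qed
    have "(\<integral>\<omega>. \<bar>W m0 \<omega> - U \<omega>\<bar> \<partial>?M) \<le> (\<integral>\<omega>. \<theta> / 4 + (W m0 \<omega> - U \<omega>)\<^sup>2 / \<theta> \<partial>?M)"
      using am sqi Wi Ui by (intro integral_mono) auto
    also have "\<dots> = \<theta> / 4 + (\<integral>\<omega>. (W m0 \<omega> - U \<omega>)\<^sup>2 \<partial>?M) / \<theta>"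
      using sqi by (simp add: M.prob_space)
    also have "\<dots> \<le> \<theta> / 4 + (\<theta>\<^sup>2 / 4) / \<theta>"
      using m0[of k] \<theta> by (intro add_left_mono divide_right_mono) (auto simp: U_def k_def)
    also have "\<dots> = \<theta> / 2" using \<theta> by (simp add: power2_eq_square)
    finally have 1: "(\<integral>\<omega>. \<bar>W m0 \<omega> - U \<omega>\<bar> \<partial>?M) \<le> \<theta> / 2" .
    have "(\<integral>\<omega>. \<bar>W m0 \<omega> - C \<omega>\<bar> \<partial>?M) \<le> (\<integral>\<omega>. \<bar>W m0 \<omega> - C0 \<omega>\<bar> \<partial>?M)"
    proof (rule integral_mono)
      show "\<bar>W m0 \<omega> - C \<omega>\<bar> \<le> \<bar>W m0 \<omega> - C0 \<omega>\<bar>" for \<omega> using W(2,3)[of m0 \<omega>] by (auto simp: C_def)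
    qed (use Wi Ci C0 in auto)
    with C0(3) have 2: "(\<integral>\<omega>. \<bar>W m0 \<omega> - C \<omega>\<bar> \<partial>?M) < \<theta> / 2" by linarith
    have "(\<integral>\<omega>. \<bar>U \<omega> - C \<omega>\<bar> \<partial>?M) \<le> (\<integral>\<omega>. \<bar>W m0 \<omega> - U \<omega>\<bar> + \<bar>W m0 \<omega> - C \<omega>\<bar> \<partial>?M)"
      using Wi Ui Ci by (intro integral_mono) auto
    also have "\<dots> = (\<integral>\<omega>. \<bar>W m0 \<omega> - U \<omega>\<bar> \<partial>?M) + (\<integral>\<omega>. \<bar>W m0 \<omega> - C \<omega>\<bar> \<partial>?M)"
      using Wi Ui Ci by (intro Bochner_Integration.integral_add) auto
    finally show ?thesis using 1 2 by linarith
  qed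
  define F where "F \<omega> \<omega>' = \<bar>U (splice_at n \<omega> \<omega>') - C \<omega>\<bar>" for \<omega> \<omega>'
  have F: "0 \<le> F \<omega> \<omega>'" "F \<omega> \<omega>' \<le> c1" for \<omega> \<omega>'
    using U[of "splice_at n \<omega> \<omega>'"] C[of \<omega>] c1 by (auto simp: F_def)
  have Usm: "(\<lambda>\<omega>'. U (splice_at n \<omega> \<omega>')) \<in> borel_measurable (obs_tail (m + (m0 + M0)))" for \<omega>
    unfolding U_def k_def by (rule splice_at_measurable1[OF W(1)])
  have up: "h \<in> borel_measurable (obs_tail (m + (m0 + M0))) \<Longrightarrow> h \<in> borel_measurable (obs_tail m)" for h :: "_ \<Rightarrow> real"
    by (rule measurable_from_subalg) (use obs_tail_antimono[of m "m + (m0 + M0)"] in \<open>simp_all add: subalgebra_def\<close>)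
  have Fm: "F \<omega> \<in> borel_measurable (obs_tail m)" for \<omega>
    unfolding F_def using up[OF Usm] by simp
  have Usp: "(\<lambda>\<omega>'. U (splice_at n \<omega> \<omega>')) \<in> borel_measurable (resample z)" for \<omega> z
  proof -
    have "(\<lambda>\<omega>'. U (splice_at n \<omega> \<omega>')) \<in> borel_measurable path_space"
      by (rule measurable_from_subalg[OF _ up[OF Usm]]) (use obs_tail_subset in \<open>simp add: subalgebra_def\<close>)
    then show ?thesis by (simp add: measurable_cong_sets[OF resample_prob(2) refl])
  qed
  have Usi: "integrable (resample z) (\<lambda>\<omega>'. U (splice_at n \<omega> \<omega>'))" for \<omega> z
  proof -
    interpret R: prob_space "resample z" by (rule resample_prob)
    show ?thesis by (rule R.integrable_const_bound[of _ c]) (use U Usp in simp_all)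
  qed
  (* average over the resampled future, given the observed past *)
  define V where "V \<omega> = (\<integral>\<omega>'. U (splice_at n \<omega> \<omega>') \<partial>resample (\<omega> n))" for \<omega>
  have V: "0 \<le> V \<omega>" "V \<omega> \<le> c" for \<omega>
  proof -
    interpret R: prob_space "resample (\<omega> n)" by (rule resample_prob)
    show "0 \<le> V \<omega>" unfolding V_def using U by (intro integral_nonneg_AE AE_I2)
    have "V \<omega> \<le> (\<integral>\<omega>'. c \<partial>resample (\<omega> n))" unfolding V_def using U Usi by (intro integral_mono) auto
    then show "V \<omega> \<le> c" by (simp add: R.prob_space)
  qed
  have Vm: "V \<in> borel_measurable (FY 0 (enat n))"
  proof -
    have id1: "(\<lambda>\<omega>. \<omega>) \<in> (FY 0 (enat n) :: (nat \<Rightarrow> 'e \<times> 'f) measure) \<rightarrow>\<^sub>M coord_field \<E> {..<n} {}"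
    proof (rule measurable_from_subalg[where F="coord_field \<E> {..<n} {}"])
      have "sets (coord_field \<E> {..<n} {}) \<subseteq> sets (FY 0 (enat n) :: (nat \<Rightarrow> 'e \<times> 'f) measure)"
        unfolding FY_eq_coord_field[of 0 "enat n" \<E>] by (rule coord_field_mono) auto
      then show "subalgebra (FY 0 (enat n)) (coord_field \<E> {..<n} {} :: (nat \<Rightarrow> 'e \<times> 'f) measure)" by (simp add: subalgebra_def)
    qed simp
    have id2: "(\<lambda>\<omega>. \<omega>) \<in> path_space \<rightarrow>\<^sub>M obs_tail (m + (m0 + M0))"
      by (rule measurable_from_subalg[where F="obs_tail (m + (m0 + M0))"]) (use obs_tail_subset in \<open>simp_all add: subalgebra_def\<close>)
    have "(\<lambda>p. (fst p, snd p)) \<in> FY 0 (enat n) \<Otimes>\<^sub>M path_space \<rightarrow>\<^sub>M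
      (coord_field \<E> {..<n} {} :: (nat \<Rightarrow> 'e \<times> 'f) measure) \<Otimes>\<^sub>M obs_tail (m + (m0 + M0))"
      by (rule measurable_Pair[OF measurable_compose[OF measurable_fst id1] measurable_compose[OF measurable_snd id2]])
    from measurable_compose[OF measurable_compose[OF this splice_at_measurable_coord_field] W(1)[of "n + (m + (m0 + M0))"]]
    have mm: "(\<lambda>(\<omega>, \<omega>'). ennreal (U (splice_at n \<omega> \<omega>'))) \<in> borel_measurable (FY 0 (enat n) \<Otimes>\<^sub>M path_space)"
      by (simp add: U_def k_def case_prod_beta')
    have eq: "V \<omega> = enn2real (\<integral>\<^sup>+\<omega>'. ennreal (U (splice_at n \<omega> \<omega>')) \<partial>resample (\<omega> n))" for \<omega>
      unfolding V_def using U Usp by (intro integral_eq_nn_integral AE_I2) simp_all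
    have "(\<lambda>\<omega>. \<integral>\<^sup>+\<omega>'. ennreal (U (splice_at n \<omega> \<omega>')) \<partial>resample (\<omega> n)) \<in> borel_measurable (FY 0 (enat n))"
      by (rule nn_integral_measurable_subprob_algebra2[OF mm measurable_prob_algebraD[OF measurable_resample_at]])
    then show ?thesis unfolding eq[abs_def] by measurable
  qed
  have VM[measurable]: "V \<in> borel_measurable ?M"
    by (rule measurable_from_subalg[OF subalgebra_FY[OF P lam(1)] Vm])
  have Vi: "integrable ?M V" by (rule M.integrable_const_bound[of _ c]) (use V in simp_all)
  have VC: "(\<integral>\<omega>. \<bar>V \<omega> - C \<omega>\<bar> \<partial>?M) \<le> t + 2 * c1 * \<eta> + c1 / (t * d) * \<theta>"
  proof -
    have step: "ennreal \<bar>V \<omega> - C \<omega>\<bar> \<le> ennreal (t + c1 * \<eta>) + ennreal c1 * indicator (UNIV - Z) (\<omega> n) +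
        ennreal (c1 / (t * d)) * (\<integral>\<^sup>+\<omega>'. ennreal (F \<omega> \<omega>') \<partial>chain_from P (\<omega> n))" for \<omega>
    proof -
      interpret R: prob_space "resample (\<omega> n)" by (rule resample_prob)
      have "\<bar>V \<omega> - C \<omega>\<bar> = \<bar>\<integral>\<omega>'. U (splice_at n \<omega> \<omega>') - C \<omega> \<partial>resample (\<omega> n)\<bar>"
        unfolding V_def using Usi by (simp add: R.prob_space)
      also have "\<dots> \<le> (\<integral>\<omega>'. F \<omega> \<omega>' \<partial>resample (\<omega> n))" unfolding F_def by (rule integral_abs_bound)
      finally have "ennreal \<bar>V \<omega> - C \<omega>\<bar> \<le> ennreal (\<integral>\<omega>'. F \<omega> \<omega>' \<partial>resample (\<omega> n))" by (rule ennreal_leI)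
      also have "\<dots> = (\<integral>\<^sup>+\<omega>'. ennreal (F \<omega> \<omega>') \<partial>resample (\<omega> n))"
        using Usi F by (intro nn_integral_eq_integral[symmetric]) (auto simp: F_def[abs_def])
      also have "\<dots> \<le> ennreal (t + c1 * \<eta>) + ennreal c1 * indicator (UNIV - Z) (\<omega> n) +
        ennreal (c1 / (t * d)) * (\<integral>\<^sup>+\<omega>'. ennreal (F \<omega> \<omega>') \<partial>chain_from P (\<omega> n))"
        by (rule resampled_integral_bound[OF d mZ Fm F c1(1) t less_imp_le[OF \<eta>]])
      finally show ?thesis .
    qed
    have UCn: "(\<lambda>\<omega>. ennreal \<bar>U \<omega> - C \<omega>\<bar>) \<in> borel_measurable path_space" by measurable
    have Fint: "(\<integral>\<^sup>+\<omega>. \<integral>\<^sup>+\<omega>'. ennreal (F \<omega> \<omega>') \<partial>chain_from P (\<omega> n) \<partial>?M) = ennreal (\<integral>\<omega>. \<bar>U \<omega> - C \<omega>\<bar> \<partial>?M)"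
    proof -
      have "(\<integral>\<^sup>+\<omega>. \<integral>\<^sup>+\<omega>'. ennreal (F \<omega> \<omega>') \<partial>chain_from P (\<omega> n) \<partial>?M) = (\<integral>\<^sup>+\<omega>. ennreal \<bar>U \<omega> - C \<omega>\<bar> \<partial>?M)"
        using nn_integral_chain_law_splice[OF P lam(1) UCn, of n] by (simp add: F_def Csat)
      also have "\<dots> = ennreal (\<integral>\<omega>. \<bar>U \<omega> - C \<omega>\<bar> \<partial>?M)"
        using Ui Ci by (intro nn_integral_eq_integral) auto
      finally show ?thesis .
    qed
    have Zm: "(\<lambda>\<omega>. indicator (UNIV - Z) (\<omega> n) :: ennreal) \<in> borel_measurable path_space"
    proof -
      have "UNIV - Z \<in> sets borel" using borel_comp[OF Z(1)] by (simp add: Compl_eq_Diff_UNIV)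
      then have "indicator (UNIV - Z) \<in> borel_measurable borel" by simp
      from measurable_compose[OF _ this, of "\<lambda>\<omega>. \<omega> n" path_space] show ?thesis by simp
    qed
    have Fnm: "(\<lambda>\<omega>. \<integral>\<^sup>+\<omega>'. ennreal (F \<omega> \<omega>') \<partial>chain_from P (\<omega> n)) \<in> borel_measurable path_space"
      using nn_integral_splice_measurable[OF P UCn, of n] by (simp add: F_def Csat)
    have "ennreal (\<integral>\<omega>. \<bar>V \<omega> - C \<omega>\<bar> \<partial>?M) = (\<integral>\<^sup>+\<omega>. ennreal \<bar>V \<omega> - C \<omega>\<bar> \<partial>?M)"
      using Vi Ci by (intro nn_integral_eq_integral[symmetric]) auto
    also have "\<dots> \<le> (\<integral>\<^sup>+\<omega>. ennreal (t + c1 * \<eta>) + ennreal c1 * indicator (UNIV - Z) (\<omega> n) +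
        ennreal (c1 / (t * d)) * (\<integral>\<^sup>+\<omega>'. ennreal (F \<omega> \<omega>') \<partial>chain_from P (\<omega> n)) \<partial>?M)"
      by (intro nn_integral_mono step)
    also have "\<dots> = ennreal (t + c1 * \<eta>) + ennreal c1 * (\<integral>\<^sup>+\<omega>. indicator (UNIV - Z) (\<omega> n) \<partial>?M) +
        ennreal (c1 / (t * d)) * (\<integral>\<^sup>+\<omega>. \<integral>\<^sup>+\<omega>'. ennreal (F \<omega> \<omega>') \<partial>chain_from P (\<omega> n) \<partial>?M)"
      using Zm Fnm M.emeasure_space_1
      by (simp add: nn_integral_add nn_integral_cmult measurable_cong_sets[OF sM refl])
    also have "(\<integral>\<^sup>+\<omega>. indicator (UNIV - Z) (\<omega> n) \<partial>?M) = ennreal (measure lam (UNIV - Z))"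
    proof -
      have Zc: "UNIV - Z \<in> sets borel" using borel_comp[OF Z(1)] by (simp add: Compl_eq_Diff_UNIV)
      have "(\<integral>\<^sup>+\<omega>. indicator (UNIV - Z) (\<omega> n) \<partial>?M) = (\<integral>\<^sup>+z. indicator (UNIV - Z) z \<partial>lam)"
        by (rule nn_integral_chain_law_marginal[OF P lam]) (use Zc in simp)
      also have "\<dots> = emeasure lam (UNIV - Z)" using Zc by (intro nn_integral_indicator) (simp add: borel_probD[OF lam(1)])
      finally show ?thesis by (simp add: lam.emeasure_eq_measure)
    qed
    also have "ennreal (t + c1 * \<eta>) + ennreal c1 * ennreal (measure lam (UNIV - Z)) +
        ennreal (c1 / (t * d)) * (\<integral>\<^sup>+\<omega>. \<integral>\<^sup>+\<omega>'. ennreal (F \<omega> \<omega>') \<partial>chain_from P (\<omega> n) \<partial>?M)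
      = ennreal ((t + c1 * \<eta>) + c1 * measure lam (UNIV - Z) + c1 / (t * d) * (\<integral>\<omega>. \<bar>U \<omega> - C \<omega>\<bar> \<partial>?M))"
      unfolding Fint using t c1 \<eta> td
      by (intro ennreal_affine) (auto intro!: add_nonneg_nonneg)
    also have "\<dots> \<le> ennreal (t + 2 * c1 * \<eta> + c1 / (t * d) * \<theta>)"
    proof (rule ennreal_leI)
      have "c1 * measure lam (UNIV - Z) \<le> c1 * \<eta>" using Z(2) c1 by (intro mult_left_mono) auto
      moreover have "c1 / (t * d) * (\<integral>\<omega>. \<bar>U \<omega> - C \<omega>\<bar> \<partial>?M) \<le> c1 / (t * d) * \<theta>"
        using UC c1 td by (intro mult_left_mono) auto
      ultimately show "(t + c1 * \<eta>) + c1 * measure lam (UNIV - Z) + c1 / (t * d) * (\<integral>\<omega>. \<bar>U \<omega> - C \<omega>\<bar> \<partial>?M) \<le> t + 2 * c1 * \<eta> + c1 / (t * d) * \<theta>"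
        by linarith
    qed
    finally show ?thesis using t c1 \<eta> td \<theta> by (subst (asm) ennreal_le_iff) (auto intro!: add_nonneg_nonneg)
  qed
  have "(\<integral>\<omega>. \<bar>U \<omega> - V \<omega>\<bar> \<partial>?M) \<le> (\<integral>\<omega>. \<bar>U \<omega> - C \<omega>\<bar> + \<bar>V \<omega> - C \<omega>\<bar> \<partial>?M)"
    using Ui Vi Ci by (intro integral_mono) auto
  also have "\<dots> = (\<integral>\<omega>. \<bar>U \<omega> - C \<omega>\<bar> \<partial>?M) + (\<integral>\<omega>. \<bar>V \<omega> - C \<omega>\<bar> \<partial>?M)"
    using Ui Vi Ci by (intro Bochner_Integration.integral_add) auto
  also have "\<dots> \<le> \<theta> + (t + 2 * c1 * \<eta> + c1 / (t * d) * \<theta>)" using UC VC by linarith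
  also have "\<dots> = \<epsilon> / 8 + t + 2 * c1 * \<eta>" using \<theta>2 by linarith
  also have "\<dots> < \<epsilon>" using \<epsilon> c1 by (simp add: t_def \<eta>_def)
  finally have final: "(\<integral>\<omega>. \<bar>U \<omega> - V \<omega>\<bar> \<partial>?M) < \<epsilon>" .
  show thesis
  proof (rule that[of k U V n])
    show "M0 \<le> k" by (simp add: k_def)
    show "U \<in> borel_measurable (obs_tail k)" unfolding U_def by (rule W)
    show "(\<integral>\<omega>. h \<omega> * \<Lambda> \<omega> \<partial>?M) = (\<integral>\<omega>. h \<omega> * U \<omega> \<partial>?M)"
      if "h \<in> borel_measurable (obs_tail k)" "\<And>\<omega>. \<bar>h \<omega>\<bar> \<le> b" for h b
      unfolding U_def by (rule Wce[OF that])
  qed (fact U Vm V final)+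
qed

end

section \<open>Stability of the filter\<close>

lemma SUP_min_of_nat: "(SUP j::nat. min (of_nat j) x) = (x :: ennreal)"
proof -
  have "(SUP j::nat. min (of_nat j) x) = (SUP j::nat. inf (of_nat j) x)" by (simp add: inf_min)
  also have "\<dots> = inf (SUP j::nat. of_nat j) x" by (rule SUP_inf[symmetric])
  finally show ?thesis by (simp add: ennreal_SUP_of_nat_eq_top)
qed

context ergodic_chain
begin

text \<open>The singular parts on the \<open>\<sigma>\<close>-fields \<open>obs_tail k\<close> vanish as \<open>k\<close> grows. For large \<open>k\<close> the absolutely
  continuous part, truncated at a high level, has almost full mass. Truncation keeps the
  domination by the law started at \<open>\<mu>\<close>.\<close>

lemma dominated_part:
  assumes \<mu>: "borel_prob \<mu>" and L: "filter_version P \<mu> L"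
    and ac: "absolutely_continuous (distr lam borel snd) (distr \<mu> borel snd)"
    and conv: "AE \<omega> in chain_law P \<mu>. (\<lambda>m. tv_norm (tail m) (L 0 \<omega>) (K 0 \<omega>)) \<longlonglongrightarrow> 0"
    and \<epsilon>: "0 < \<epsilon>" "\<epsilon> < (1::real)"
  obtains k c \<Lambda> where "\<Lambda> \<in> borel_measurable (obs_tail k)" "\<And>\<omega>. 0 \<le> \<Lambda> \<omega>" "\<And>\<omega>. \<Lambda> \<omega> \<le> (c::real)"
    "\<And>h b. h \<in> borel_measurable (obs_tail k) \<Longrightarrow> (\<And>\<omega>. 0 \<le> h \<omega>) \<Longrightarrow> (\<And>\<omega>. h \<omega> \<le> (b::real)) \<Longrightarrow>
      (\<integral>\<omega>. h \<omega> * \<Lambda> \<omega> \<partial>chain_law P lam) \<le> (\<integral>\<omega>. h \<omega> \<partial>chain_law P \<mu>)"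
    "1 - \<epsilon> < (\<integral>\<omega>. \<Lambda> \<omega> \<partial>chain_law P lam)"
proof -
  let ?M = "chain_law P \<mu>" and ?N = "chain_law P lam"
  interpret M: prob_space ?M by (rule chain_law_prob[OF P \<mu>])
  interpret N: prob_space ?N by (rule chain_law_prob[OF P lam(1)])
  note sM = chain_law_prob(1)[OF P \<mu>] and sN = chain_law_prob(1)[OF P lam(1)]
  have subM: "subalgebra ?M (obs_tail k)" and subN: "subalgebra ?N (obs_tail k)" for k
    using obs_tail_subset[of k] by (simp_all add: subalgebra_def chain_law_space[OF P \<mu>] chain_law_space[OF P lam(1)] sM sN)
  define dec where "dec k D f \<longleftrightarrow> D \<in> sets (obs_tail k) \<and> emeasure ?N D = 0 \<and> f \<in> borel_measurable (obs_tail k) \<and>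
    (\<forall>A\<in>sets (obs_tail k). emeasure ?M (A - D) = (\<integral>\<^sup>+\<omega>. f \<omega> * indicator A \<omega> \<partial>?N))"
    for k D and f :: "(nat \<Rightarrow> 'e \<times> 'f) \<Rightarrow> ennreal"
  have "\<exists>D. \<exists>f. dec k D f" for k
  proof -
    have s: "sets (restr_to_subalg ?M (obs_tail k)) = sets (obs_tail k)" "sets (restr_to_subalg ?N (obs_tail k)) = sets (obs_tail k)"
      by (rule sets_restr_to_subalg[OF subM], rule sets_restr_to_subalg[OF subN])
    have ss: "sets (restr_to_subalg ?M (obs_tail k)) = sets (restr_to_subalg ?N (obs_tail k))" unfolding s ..
    show ?thesis
    proof (rule Lebesgue_decomposition_finite[OF finite_measure_restr_to_subalg[OF subM M.finite_measure_axioms]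
          finite_measure_restr_to_subalg[OF subN N.finite_measure_axioms] ss])
      fix D f
      assume D': "D \<in> sets (restr_to_subalg ?N (obs_tail k))" and D0: "emeasure (restr_to_subalg ?N (obs_tail k)) D = 0"
        and f': "f \<in> borel_measurable (restr_to_subalg ?N (obs_tail k))"
        and eq: "\<And>A. A \<in> sets (restr_to_subalg ?N (obs_tail k)) \<Longrightarrow>
          emeasure (restr_to_subalg ?M (obs_tail k)) (A - D) = (\<integral>\<^sup>+x. f x * indicator A x \<partial>restr_to_subalg ?N (obs_tail k))"
      have D: "D \<in> sets (obs_tail k)" using D' unfolding s .
      have f: "f \<in> borel_measurable (obs_tail k)" by (rule measurable_in_subalg'[OF subN f'])
      have "emeasure ?M (A - D) = (\<integral>\<^sup>+\<omega>. f \<omega> * indicator A \<omega> \<partial>?N)" if A: "A \<in> sets (obs_tail k)" for A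
      proof -
        have "emeasure ?M (A - D) = emeasure (restr_to_subalg ?M (obs_tail k)) (A - D)"
          by (rule emeasure_restr_to_subalg[OF subM sets.Diff[OF A D], symmetric])
        also have "\<dots> = (\<integral>\<^sup>+x. f x * indicator A x \<partial>restr_to_subalg ?N (obs_tail k))" by (rule eq) (use A s in simp)
        also have "\<dots> = (\<integral>\<^sup>+\<omega>. f \<omega> * indicator A \<omega> \<partial>?N)"
          by (rule nn_integral_subalgebra2[OF subN]) (use f A in simp)
        finally show ?thesis .
      qed
      then have "dec k D f" unfolding dec_def using D f D0 emeasure_restr_to_subalg[OF subN D] by simp
      then show ?thesis by blast
    qed
  qed
  then have ex: "\<exists>D. \<forall>k. \<exists>f. dec k (D k) f" by (intro choice allI)
  obtain D where D: "\<forall>k. \<exists>f. dec k (D k) f" using ex ..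
  have DS: "D k \<in> sets (obs_tail k)" "emeasure ?N (D k) = 0" for k using D unfolding dec_def by blast+
  have "(\<lambda>k. measure ?M (D k)) \<longlonglongrightarrow> 0"
    by (rule singular_mass_tendsto_0[OF \<mu> lam(1) L K ac conv DS])
  from order_tendstoD(2)[OF this \<epsilon>(1)] obtain k where k: "measure ?M (D k) < \<epsilon>" by (auto simp: eventually_sequentially)
  obtain f where "dec k (D k) f" using D by blast
  then have f: "f \<in> borel_measurable (obs_tail k)"
    and feq: "\<And>A. A \<in> sets (obs_tail k) \<Longrightarrow> emeasure ?M (A - D k) = (\<integral>\<^sup>+\<omega>. f \<omega> * indicator A \<omega> \<partial>?N)"
    unfolding dec_def by blast+
  have fN: "f \<in> borel_measurable ?N" by (rule measurable_from_subalg[OF subN f])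
  have Dp: "D k \<in> sets path_space" by (rule subsetD[OF obs_tail_subset DS(1)])
  have UT: "UNIV \<in> sets (obs_tail k)" using sets.top[of "obs_tail k"] by simp
  have "measure ?M (UNIV - D k) = 1 - measure ?M (D k)"
    using M.prob_compl[of "D k"] Dp by (simp add: sM chain_law_space[OF P \<mu>])
  then have "1 - \<epsilon> < measure ?M (UNIV - D k)" using k by linarith
  then have "ennreal (1 - \<epsilon>) < emeasure ?M (UNIV - D k)"
    using \<epsilon> by (simp add: M.emeasure_eq_measure ennreal_lessI)
  also have "\<dots> = (\<integral>\<^sup>+\<omega>. f \<omega> \<partial>?N)" using feq[OF UT] by simp
  also have "\<dots> = (\<integral>\<^sup>+\<omega>. (SUP j::nat. min (of_nat j) (f \<omega>)) \<partial>?N)" by (simp add: SUP_min_of_nat)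
  also have "\<dots> = (SUP j::nat. \<integral>\<^sup>+\<omega>. min (of_nat j) (f \<omega>) \<partial>?N)"
  proof (rule nn_integral_monotone_convergence_SUP)
    show "incseq (\<lambda>j \<omega>. min (of_nat j) (f \<omega>))" by (intro incseq_SucI le_funI min.mono) auto
  qed (use fN in measurable)
  finally obtain j :: nat where j: "ennreal (1 - \<epsilon>) < (\<integral>\<^sup>+\<omega>. min (of_nat j) (f \<omega>) \<partial>?N)"
    unfolding less_SUP_iff by blast
  define \<Lambda> where "\<Lambda> \<omega> = enn2real (min (of_nat j) (f \<omega>))" for \<omega>
  have \<Lambda>e: "ennreal (\<Lambda> \<omega>) = min (of_nat j) (f \<omega>)" for \<omega>
    unfolding \<Lambda>_def by (rule ennreal_enn2real) (simp add: min_less_iff_disj of_nat_less_top)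
  have \<Lambda>m: "\<Lambda> \<in> borel_measurable (obs_tail k)" unfolding \<Lambda>_def using f by measurable
  have \<Lambda>0: "0 \<le> \<Lambda> \<omega>" for \<omega> by (simp add: \<Lambda>_def)
  have \<Lambda>c: "\<Lambda> \<omega> \<le> real j" for \<omega>
  proof -
    have "ennreal (\<Lambda> \<omega>) \<le> ennreal (real j)" unfolding \<Lambda>e by (simp add: ennreal_of_nat_eq_real_of_nat)
    then show ?thesis by simp
  qed
  have \<Lambda>N: "\<Lambda> \<in> borel_measurable ?N" by (rule measurable_from_subalg[OF subN \<Lambda>m])
  have \<Lambda>i: "integrable ?N \<Lambda>" by (rule N.integrable_const_bound[of _ "real j"]) (use \<Lambda>0 \<Lambda>c \<Lambda>N in simp_all)
  have DC: "UNIV - D k \<in> sets (obs_tail k)" by (rule sets.Diff[OF UT DS(1)])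
  have DCm: "(indicator (UNIV - D k) :: _ \<Rightarrow> ennreal) \<in> borel_measurable (restr_to_subalg ?M (obs_tail k))"
    by (rule measurable_in_subalg[OF subM]) (use DC in simp)
  have dens: "density (restr_to_subalg ?N (obs_tail k)) f = density (restr_to_subalg ?M (obs_tail k)) (indicator (UNIV - D k))"
  proof (rule measure_eqI)
    show "sets (density (restr_to_subalg ?N (obs_tail k)) f) = sets (density (restr_to_subalg ?M (obs_tail k)) (indicator (UNIV - D k)))"
      by (simp add: sets_restr_to_subalg[OF subM] sets_restr_to_subalg[OF subN])
    fix A assume "A \<in> sets (density (restr_to_subalg ?N (obs_tail k)) f)"
    then have A: "A \<in> sets (obs_tail k)" by (simp add: sets_restr_to_subalg[OF subN])
    have "emeasure (density (restr_to_subalg ?N (obs_tail k)) f) A = (\<integral>\<^sup>+\<omega>. f \<omega> * indicator A \<omega> \<partial>restr_to_subalg ?N (obs_tail k))"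
      by (rule emeasure_density[OF measurable_in_subalg[OF subN f]]) (simp add: sets_restr_to_subalg[OF subN] A)
    also have "\<dots> = (\<integral>\<^sup>+\<omega>. f \<omega> * indicator A \<omega> \<partial>?N)"
      by (rule nn_integral_subalgebra2[OF subN]) (use f A in simp)
    also have "\<dots> = emeasure ?M (A - D k)" by (rule feq[OF A, symmetric])
    also have "\<dots> = emeasure (restr_to_subalg ?M (obs_tail k)) (A - D k)"
      by (rule emeasure_restr_to_subalg[OF subM sets.Diff[OF A DS(1)], symmetric])
    also have "\<dots> = (\<integral>\<^sup>+\<omega>. indicator (A - D k) \<omega> \<partial>restr_to_subalg ?M (obs_tail k))"
      by (rule nn_integral_indicator[symmetric]) (simp add: sets_restr_to_subalg[OF subM] sets.Diff[OF A DS(1)])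
    also have "\<dots> = (\<integral>\<^sup>+\<omega>. indicator (UNIV - D k) \<omega> * indicator A \<omega> \<partial>restr_to_subalg ?M (obs_tail k))"
      by (intro nn_integral_cong) (auto split: split_indicator)
    also have "\<dots> = emeasure (density (restr_to_subalg ?M (obs_tail k)) (indicator (UNIV - D k))) A"
      by (rule emeasure_density[OF DCm, symmetric]) (simp add: sets_restr_to_subalg[OF subM] A)
    finally show "emeasure (density (restr_to_subalg ?N (obs_tail k)) f) A = emeasure (density (restr_to_subalg ?M (obs_tail k)) (indicator (UNIV - D k))) A" .
  qed
  have dom: "(\<integral>\<omega>. h \<omega> * \<Lambda> \<omega> \<partial>?N) \<le> (\<integral>\<omega>. h \<omega> \<partial>?M)"
    if h: "h \<in> borel_measurable (obs_tail k)" "\<And>\<omega>. 0 \<le> h \<omega>" "\<And>\<omega>. h \<omega> \<le> (b::real)" for h b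
  proof -
    have hN: "h \<in> borel_measurable ?N" and hM: "h \<in> borel_measurable ?M"
      by (rule measurable_from_subalg[OF subN h(1)], rule measurable_from_subalg[OF subM h(1)])
    have he: "(\<lambda>\<omega>. ennreal (h \<omega>)) \<in> borel_measurable (obs_tail k)" using h(1) by measurable
    have hi: "integrable ?M h" by (rule M.integrable_const_bound[of _ b]) (use h hM in simp_all)
    have hli: "integrable ?N (\<lambda>\<omega>. h \<omega> * \<Lambda> \<omega>)"
    proof (rule N.integrable_const_bound[of _ "b * real j"])
      show "AE \<omega> in ?N. norm (h \<omega> * \<Lambda> \<omega>) \<le> b * real j"
        using h(2,3) \<Lambda>0 \<Lambda>c by (intro AE_I2) (auto simp: abs_mult intro!: mult_mono intro: order_trans)
    qed (use hN \<Lambda>N in simp)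
    have "ennreal (\<integral>\<omega>. h \<omega> * \<Lambda> \<omega> \<partial>?N) = (\<integral>\<^sup>+\<omega>. ennreal (h \<omega> * \<Lambda> \<omega>) \<partial>?N)"
      using h(2) \<Lambda>0 by (intro nn_integral_eq_integral[OF hli, symmetric] AE_I2) simp
    also have "\<dots> \<le> (\<integral>\<^sup>+\<omega>. f \<omega> * ennreal (h \<omega>) \<partial>?N)"
    proof (rule nn_integral_mono)
      fix \<omega>
      have "ennreal (h \<omega> * \<Lambda> \<omega>) = min (of_nat j) (f \<omega>) * ennreal (h \<omega>)"
        using h(2) \<Lambda>0 by (simp add: ennreal_mult \<Lambda>e mult.commute)
      also have "\<dots> \<le> f \<omega> * ennreal (h \<omega>)" by (intro mult_right_mono) simp_all
      finally show "ennreal (h \<omega> * \<Lambda> \<omega>) \<le> f \<omega> * ennreal (h \<omega>)" .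
    qed
    also have "\<dots> = (\<integral>\<^sup>+\<omega>. f \<omega> * ennreal (h \<omega>) \<partial>restr_to_subalg ?N (obs_tail k))"
      by (rule nn_integral_subalgebra2[OF subN, symmetric]) (use f he in simp)
    also have "\<dots> = (\<integral>\<^sup>+\<omega>. ennreal (h \<omega>) \<partial>density (restr_to_subalg ?N (obs_tail k)) f)"
      by (rule nn_integral_density[symmetric]) (simp_all add: measurable_in_subalg[OF subN] f he)
    also have "\<dots> = (\<integral>\<^sup>+\<omega>. indicator (UNIV - D k) \<omega> * ennreal (h \<omega>) \<partial>restr_to_subalg ?M (obs_tail k))"
      unfolding dens by (rule nn_integral_density[OF DCm measurable_in_subalg[OF subM he]])
    also have "\<dots> \<le> (\<integral>\<^sup>+\<omega>. ennreal (h \<omega>) \<partial>restr_to_subalg ?M (obs_tail k))"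
      by (intro nn_integral_mono) (auto split: split_indicator)
    also have "\<dots> = (\<integral>\<^sup>+\<omega>. ennreal (h \<omega>) \<partial>?M)" by (rule nn_integral_subalgebra2[OF subM he])
    also have "\<dots> = ennreal (\<integral>\<omega>. h \<omega> \<partial>?M)" using h(2) by (intro nn_integral_eq_integral[OF hi] AE_I2)
    finally show ?thesis using h(2) by (subst (asm) ennreal_le_iff) (auto intro!: integral_nonneg_AE)
  qed
  have mass: "1 - \<epsilon> < (\<integral>\<omega>. \<Lambda> \<omega> \<partial>?N)"
  proof -
    have "(\<integral>\<^sup>+\<omega>. min (of_nat j) (f \<omega>) \<partial>?N) = ennreal (\<integral>\<omega>. \<Lambda> \<omega> \<partial>?N)"
      unfolding \<Lambda>e[symmetric] using \<Lambda>0 by (intro nn_integral_eq_integral[OF \<Lambda>i] AE_I2)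
    with j show ?thesis using \<epsilon> by (simp add: ennreal_less_iff)
  qed
  show thesis by (rule that[of \<Lambda> k "real j"]) (fact \<Lambda>m \<Lambda>0 \<Lambda>c dom mass)+
qed

lemma FY_mono: "n \<le> n' \<Longrightarrow> sets (FY 0 (enat n)) \<subseteq> sets (FY 0 (enat n') :: (nat \<Rightarrow> 'e \<times> 'f) measure)"
  unfolding FY_eq by (rule coord_field_mono) auto

text \<open>Bayes' formula with errors. For \<open>B\<close> observed up to time \<open>n\<close>, the integral of the difference of the filters over \<open>B\<close>
  would vanish if \<open>V\<close> were the density. The density is missed by the undominated part and by
  \<open>W - V\<close>; both are counted in \<open>\<zeta> B\<close>, which is additive in \<open>B\<close> and does not mention \<open>n\<close>. The events of first
  exceedance are disjoint, so their contributions add up to at most the total error.\<close>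

lemma maximal_bound:
  assumes \<mu>: "borel_prob \<mu>" and L: "filter_version P \<mu> L"
    and ac: "absolutely_continuous (distr lam borel snd) (distr \<mu> borel snd)"
    and conv: "AE \<omega> in chain_law P \<mu>. (\<lambda>m. tv_norm (tail m) (L 0 \<omega>) (K 0 \<omega>)) \<longlonglongrightarrow> 0"
    and \<kappa>: "0 < (\<kappa>::real)" and \<delta>: "0 < (\<delta>::real)"
  shows "\<exists>M n0 E. E \<in> sets path_space \<and> measure (chain_law P \<mu>) E \<le> \<delta> \<and>
    (\<forall>\<omega>. \<omega> \<notin> E \<longrightarrow> (\<forall>n\<ge>n0. tv_norm (tail M) (L n \<omega>) (K n \<omega>) \<le> 2 * \<kappa>))"
proof -
  let ?M = "chain_law P \<mu>" and ?N = "chain_law P lam"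
  interpret M: prob_space ?M by (rule chain_law_prob[OF P \<mu>])
  interpret N: prob_space ?N by (rule chain_law_prob[OF P lam(1)])
  note sM = chain_law_prob(1)[OF P \<mu>] and sN = chain_law_prob(1)[OF P lam(1)]
  have subM: "subalgebra ?M (obs_tail k)" and subN: "subalgebra ?N (obs_tail k)" for k
    using obs_tail_subset[of k] by (simp_all add: subalgebra_def chain_law_space[OF P \<mu>] chain_law_space[OF P lam(1)] sM sN)
  define \<epsilon> where "\<epsilon> = min (1/2) (\<delta> * \<kappa> / 2)"
  have \<epsilon>: "0 < \<epsilon>" "\<epsilon> < 1" "2 * \<epsilon> \<le> \<delta> * \<kappa>" using \<delta> \<kappa> by (auto simp: \<epsilon>_def min_def)
  obtain k c \<Lambda> where \<Lambda>: "\<Lambda> \<in> borel_measurable (obs_tail k)" "\<And>\<omega>. 0 \<le> \<Lambda> \<omega>" "\<And>\<omega>. \<Lambda> \<omega> \<le> (c::real)"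
    and dom: "\<And>h b. h \<in> borel_measurable (obs_tail k) \<Longrightarrow> (\<And>\<omega>. 0 \<le> h \<omega>) \<Longrightarrow> (\<And>\<omega>. h \<omega> \<le> (b::real)) \<Longrightarrow>
      (\<integral>\<omega>. h \<omega> * \<Lambda> \<omega> \<partial>?N) \<le> (\<integral>\<omega>. h \<omega> \<partial>?M)"
    and mass: "1 - \<epsilon> < (\<integral>\<omega>. \<Lambda> \<omega> \<partial>?N)"
  proof (rule dominated_part[OF \<mu> L ac conv \<epsilon>(1,2)])
    fix k c and \<Lambda> :: "(nat \<Rightarrow> 'e \<times> 'f) \<Rightarrow> real"
    assume "\<Lambda> \<in> borel_measurable (obs_tail k)" "\<And>\<omega>. 0 \<le> \<Lambda> \<omega>" "\<And>\<omega>. \<Lambda> \<omega> \<le> c"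
      "\<And>h b. h \<in> borel_measurable (obs_tail k) \<Longrightarrow> (\<And>\<omega>. 0 \<le> h \<omega>) \<Longrightarrow> (\<And>\<omega>. h \<omega> \<le> (b::real)) \<Longrightarrow>
        (\<integral>\<omega>. h \<omega> * \<Lambda> \<omega> \<partial>?N) \<le> (\<integral>\<omega>. h \<omega> \<partial>?M)"
      "1 - \<epsilon> < (\<integral>\<omega>. \<Lambda> \<omega> \<partial>?N)"
    then show ?thesis by (rule that)
  qed
  have \<Lambda>p: "\<Lambda> \<in> borel_measurable path_space"
    by (rule measurable_from_subalg[OF _ \<Lambda>(1)]) (use obs_tail_subset in \<open>simp add: subalgebra_def\<close>)
  obtain m n0 W V where m: "k \<le> m" and W: "W \<in> borel_measurable (obs_tail m)" "\<And>\<omega>. 0 \<le> W \<omega>" "\<And>\<omega>. W \<omega> \<le> c"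
    and Wce: "\<And>h b. h \<in> borel_measurable (obs_tail m) \<Longrightarrow> (\<And>\<omega>. \<bar>h \<omega>\<bar> \<le> b) \<Longrightarrow>
      (\<integral>\<omega>. h \<omega> * \<Lambda> \<omega> \<partial>?N) = (\<integral>\<omega>. h \<omega> * W \<omega> \<partial>?N)"
    and V: "V \<in> borel_measurable (FY 0 (enat n0))" "\<And>\<omega>. 0 \<le> V \<omega>" "\<And>\<omega>. V \<omega> \<le> c"
    and WV: "(\<integral>\<omega>. \<bar>W \<omega> - V \<omega>\<bar> \<partial>?N) < \<epsilon>"
  proof (rule cond_exp_near_observable[OF \<Lambda>p \<Lambda>(2,3) \<epsilon>(1), of k])
    fix m n W V
    assume "k \<le> m" "W \<in> borel_measurable (obs_tail m)" "\<And>\<omega>. 0 \<le> W \<omega>" "\<And>\<omega>. W \<omega> \<le> c"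
      "\<And>h b. h \<in> borel_measurable (obs_tail m) \<Longrightarrow> (\<And>\<omega>. \<bar>h \<omega>\<bar> \<le> b) \<Longrightarrow>
        (\<integral>\<omega>. h \<omega> * \<Lambda> \<omega> \<partial>?N) = (\<integral>\<omega>. h \<omega> * W \<omega> \<partial>?N)"
      "V \<in> borel_measurable (FY 0 (enat n))" "\<And>\<omega>. 0 \<le> V \<omega>" "\<And>\<omega>. V \<omega> \<le> c"
      "(\<integral>\<omega>. \<bar>W \<omega> - V \<omega>\<bar> \<partial>?N) < \<epsilon>"
    then show ?thesis by (rule that)
  qed
  have meas[measurable]: "\<Lambda> \<in> borel_measurable ?N" "W \<in> borel_measurable ?N" "V \<in> borel_measurable ?N"
    by (rule measurable_from_subalg[OF subN \<Lambda>(1)], rule measurable_from_subalg[OF subN W(1)],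
        rule measurable_from_subalg[OF subalgebra_FY[OF P lam(1)] V(1)])
  (* the total error mass: what the dominated part misses, plus the distance between W and V *)
  define \<zeta> where "\<zeta> B = measure ?M B + (\<integral>\<omega>. indicator B \<omega> * (\<bar>W \<omega> - V \<omega>\<bar> - \<Lambda> \<omega>) \<partial>?N)" for B
  have bd: "integrable ?N u" if "u \<in> borel_measurable ?N" "\<And>\<omega>. \<bar>u \<omega>\<bar> \<le> b" for u and b :: real
    by (rule N.integrable_const_bound[of _ b]) (use that in simp_all)
  have ri: "integrable ?N (\<lambda>\<omega>. \<bar>W \<omega> - V \<omega>\<bar> - \<Lambda> \<omega>)"
  proof (rule bd[of _ c])
    show "\<bar>\<bar>W \<omega> - V \<omega>\<bar> - \<Lambda> \<omega>\<bar> \<le> c" for \<omega>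
      using W(2,3)[of \<omega>] V(2,3)[of \<omega>] \<Lambda>(2,3)[of \<omega>] by linarith
  qed simp
  have \<zeta>top: "\<zeta> UNIV < \<delta> * \<kappa>"
  proof -
    have "integrable ?N (\<lambda>\<omega>. \<bar>W \<omega> - V \<omega>\<bar>)"
    proof (rule bd[of _ c])
      show "\<bar>\<bar>W \<omega> - V \<omega>\<bar>\<bar> \<le> c" for \<omega> using W(2,3)[of \<omega>] V(2,3)[of \<omega>] by linarith
    qed simp
    moreover have "integrable ?N \<Lambda>" by (rule bd[of _ c]) (use \<Lambda>(2,3) in simp_all)
    ultimately have "\<zeta> UNIV = 1 + ((\<integral>\<omega>. \<bar>W \<omega> - V \<omega>\<bar> \<partial>?N) - (\<integral>\<omega>. \<Lambda> \<omega> \<partial>?N))"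
      using M.prob_space by (simp add: \<zeta>_def chain_law_space[OF P \<mu>])
    then show ?thesis using mass WV \<epsilon>(3) by linarith
  qed
  have \<zeta>Un: "\<zeta> (A \<union> B) = \<zeta> A + \<zeta> B" if "A \<in> sets path_space" "B \<in> sets path_space" "A \<inter> B = {}" for A B
  proof -
    have AB: "A \<in> sets ?M" "B \<in> sets ?M" "A \<in> sets ?N" "B \<in> sets ?N" using that by (simp_all add: sM sN)
    have "(\<integral>\<omega>. indicator (A \<union> B) \<omega> * (\<bar>W \<omega> - V \<omega>\<bar> - \<Lambda> \<omega>) \<partial>?N) =
      (\<integral>\<omega>. indicator A \<omega> * (\<bar>W \<omega> - V \<omega>\<bar> - \<Lambda> \<omega>) + indicator B \<omega> * (\<bar>W \<omega> - V \<omega>\<bar> - \<Lambda> \<omega>) \<partial>?N)"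
      using that(3) by (intro Bochner_Integration.integral_cong) (auto split: split_indicator)
    also have "\<dots> = (\<integral>\<omega>. indicator A \<omega> * (\<bar>W \<omega> - V \<omega>\<bar> - \<Lambda> \<omega>) \<partial>?N) + (\<integral>\<omega>. indicator B \<omega> * (\<bar>W \<omega> - V \<omega>\<bar> - \<Lambda> \<omega>) \<partial>?N)"
      using integrable_mult_indicator[OF AB(3) ri] integrable_mult_indicator[OF AB(4) ri]
      by (intro Bochner_Integration.integral_add) simp_all
    finally show ?thesis using M.finite_measure_Union[OF AB(1,2) that(3)] by (simp add: \<zeta>_def)
  qed
  have KO: "(\<lambda>\<omega>. measure (K n \<omega>) A) \<in> borel_measurable (FY 0 (enat n))" if "A \<in> sets path_space" for A n
    by (rule measurable_compose[OF filter_version_facts(2)[OF P lam(1) K] measurable_measure_prob_algebra[OF that]])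
  have LO: "(\<lambda>\<omega>. measure (L n \<omega>) A) \<in> borel_measurable (FY 0 (enat n))" if "A \<in> sets path_space" for A n
    by (rule measurable_compose[OF filter_version_facts(2)[OF P \<mu> L] measurable_measure_prob_algebra[OF that]])
  have K1: "0 \<le> measure (K n \<omega>) A" "measure (K n \<omega>) A \<le> 1" for n \<omega> A
    using prob_space.prob_le_1[OF filter_version_facts(3)[OF P lam(1) K]] by (simp_all add: measure_nonneg)
  have L1: "0 \<le> measure (L n \<omega>) A" "measure (L n \<omega>) A \<le> 1" for n \<omega> A
    using prob_space.prob_le_1[OF filter_version_facts(3)[OF P \<mu> L]] by (simp_all add: measure_nonneg)
  have claim1: "(\<integral>\<omega>. indicator B \<omega> * (measure (L n \<omega>) A - measure (K n \<omega>) A) \<partial>?M) \<le> \<zeta> B"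
    if n: "n0 \<le> n" and B: "B \<in> sets (FY 0 (enat n))" and A: "A \<in> sets (tail m)" for n B A
  proof -
    have Ap: "A \<in> sets path_space" by (rule subsetD[OF tail_subset A])
    have Bp: "B \<in> sets path_space" by (rule subsetD[OF sets_FY_subset B])
    have AO: "A \<in> sets (obs_tail m)" by (rule subsetD[OF tail_subset_obs_tail A])
    have BO: "B \<in> sets (obs_tail m)" by (rule subsetD[OF FY_subset_obs_tail B])
    have subFO: "subalgebra (obs_tail m) (FY 0 (enat n))" using FY_subset_obs_tail by (simp add: subalgebra_def)
    have subO: "subalgebra (obs_tail k) (obs_tail m)" using obs_tail_antimono[OF m] by (simp add: subalgebra_def)
    have [measurable]: "A \<in> sets ?M" "B \<in> sets ?M" "A \<in> sets ?N" "B \<in> sets ?N" using Ap Bp by (simp_all add: sM sN)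
    define f where "f \<omega> = indicator B \<omega> * (indicator A \<omega> - measure (K n \<omega>) A)" for \<omega>
    have fO: "f \<in> borel_measurable (obs_tail m)"
      unfolding f_def using AO BO measurable_from_subalg[OF subFO KO[OF Ap]] by simp
    have fM[measurable]: "f \<in> borel_measurable ?M" and fN[measurable]: "f \<in> borel_measurable ?N"
      by (rule measurable_from_subalg[OF subM fO], rule measurable_from_subalg[OF subN fO])
    have fB: "\<bar>f \<omega>\<bar> \<le> indicator B \<omega>" for \<omega>
      using K1[of n \<omega> A] by (auto simp: f_def split: split_indicator)
    have f1: "\<bar>f \<omega>\<bar> \<le> 1" for \<omega> using fB[of \<omega>] by (auto split: split_indicator_asm)
    have fi: "integrable ?M f" by (rule M.integrable_const_bound[of _ 1]) (use f1 in simp_all)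
    have Bi: "integrable ?M (indicator B :: _ \<Rightarrow> real)" by (simp add: M.emeasure_eq_measure)
    have c0: "0 \<le> c" using order_trans[OF \<Lambda>(2,3)] .
    have prod_bd: "integrable ?N (\<lambda>\<omega>. u \<omega> * v \<omega>)"
      if "u \<in> borel_measurable ?N" "v \<in> borel_measurable ?N" "\<And>\<omega>. \<bar>u \<omega>\<bar> \<le> 1" "\<And>\<omega>. \<bar>v \<omega>\<bar> \<le> b" for u v and b :: real
    proof (rule bd)
      show "\<bar>u \<omega> * v \<omega>\<bar> \<le> 1 * b" for \<omega> using mult_mono[OF that(3)[of \<omega>] that(4)[of \<omega>]] by (simp add: abs_mult)
    qed (use that in simp)
    have lb: "\<bar>\<Lambda> \<omega>\<bar> \<le> c" "\<bar>W \<omega>\<bar> \<le> c" "\<bar>V \<omega>\<bar> \<le> c" "\<bar>W \<omega> - V \<omega>\<bar> \<le> c" for \<omega>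
      using \<Lambda>(2,3)[of \<omega>] W(2,3)[of \<omega>] V(2,3)[of \<omega>] by (auto simp: abs_le_iff)
    have B1: "\<bar>indicator B \<omega>\<bar> \<le> (1::real)" for \<omega> by (auto split: split_indicator)
    have iB: "integrable ?N (\<lambda>\<omega>. indicator B \<omega> * \<bar>W \<omega> - V \<omega>\<bar>)" "integrable ?N (\<lambda>\<omega>. indicator B \<omega> * \<Lambda> \<omega>)"
      by (rule prod_bd[of _ _ c]; use lb B1 in simp)+
    have if': "integrable ?N (\<lambda>\<omega>. f \<omega> * \<Lambda> \<omega>)" "integrable ?N (\<lambda>\<omega>. f \<omega> * (W \<omega> - V \<omega>))" "integrable ?N (\<lambda>\<omega>. f \<omega> * V \<omega>)"
      by (rule prod_bd[of _ _ c]; use lb f1 in simp)+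
    have "(\<integral>\<omega>. (indicator B \<omega> - f \<omega>) * \<Lambda> \<omega> \<partial>?N) \<le> (\<integral>\<omega>. indicator B \<omega> - f \<omega> \<partial>?M)"
    proof (rule dom)
      show "(\<lambda>\<omega>. indicator B \<omega> - f \<omega>) \<in> borel_measurable (obs_tail k)"
        by (rule measurable_from_subalg[OF subO]) (use fO BO in simp)
      show "0 \<le> indicator B \<omega> - f \<omega>" for \<omega> using fB[of \<omega>] by linarith
      show "indicator B \<omega> - f \<omega> \<le> 2" for \<omega> using f1[of \<omega>] B1[of \<omega>] by linarith
    qed
    also have "(\<integral>\<omega>. indicator B \<omega> - f \<omega> \<partial>?M) = measure ?M B - (\<integral>\<omega>. f \<omega> \<partial>?M)"
      using Bi fi by simp
    also have "(\<integral>\<omega>. (indicator B \<omega> - f \<omega>) * \<Lambda> \<omega> \<partial>?N) = (\<integral>\<omega>. indicator B \<omega> * \<Lambda> \<omega> \<partial>?N) - (\<integral>\<omega>. f \<omega> * \<Lambda> \<omega> \<partial>?N)"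
      using iB if' by (simp add: left_diff_distrib)
    also have "(\<integral>\<omega>. f \<omega> * \<Lambda> \<omega> \<partial>?N) = (\<integral>\<omega>. f \<omega> * W \<omega> \<partial>?N)" by (rule Wce[OF fO f1])
    also have "\<dots> = (\<integral>\<omega>. f \<omega> * (W \<omega> - V \<omega>) \<partial>?N) + (\<integral>\<omega>. f \<omega> * V \<omega> \<partial>?N)"
    proof -
      have "(\<integral>\<omega>. f \<omega> * W \<omega> \<partial>?N) = (\<integral>\<omega>. f \<omega> * (W \<omega> - V \<omega>) + f \<omega> * V \<omega> \<partial>?N)"
        by (intro Bochner_Integration.integral_cong) (auto simp: algebra_simps)
      also have "\<dots> = (\<integral>\<omega>. f \<omega> * (W \<omega> - V \<omega>) \<partial>?N) + (\<integral>\<omega>. f \<omega> * V \<omega> \<partial>?N)"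
        using if' by (intro Bochner_Integration.integral_add) auto
      finally show ?thesis .
    qed
    also have "(\<integral>\<omega>. f \<omega> * V \<omega> \<partial>?N) = 0"
    proof -
      have VF: "(\<lambda>\<omega>. V \<omega> * indicator B \<omega>) \<in> borel_measurable (FY 0 (enat n))"
      proof -
        have "subalgebra (FY 0 (enat n)) (FY 0 (enat n0) :: (nat \<Rightarrow> 'e \<times> 'f) measure)"
          using FY_mono[OF n] by (simp add: subalgebra_def)
        from measurable_from_subalg[OF this V(1)] B show ?thesis by simp
      qed
      have Vb: "\<bar>V \<omega> * indicator B \<omega>\<bar> \<le> c" for \<omega> using lb(3)[of \<omega>] c0 by (auto split: split_indicator)
      have VBm: "(\<lambda>\<omega>. V \<omega> * indicator B \<omega>) \<in> borel_measurable ?N" by simp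
      have Km: "(\<lambda>\<omega>. measure (K n \<omega>) A) \<in> borel_measurable ?N"
        by (rule measurable_from_subalg[OF subalgebra_FY[OF P lam(1)] KO[OF Ap]])
      have "(\<integral>\<omega>. f \<omega> * V \<omega> \<partial>?N) = (\<integral>\<omega>. indicator A \<omega> * (V \<omega> * indicator B \<omega>) - measure (K n \<omega>) A * (V \<omega> * indicator B \<omega>) \<partial>?N)"
        by (intro Bochner_Integration.integral_cong) (auto simp: f_def algebra_simps)
      also have "\<dots> = (\<integral>\<omega>. indicator A \<omega> * (V \<omega> * indicator B \<omega>) \<partial>?N) - (\<integral>\<omega>. measure (K n \<omega>) A * (V \<omega> * indicator B \<omega>) \<partial>?N)"
      proof (rule Bochner_Integration.integral_diff)
        show "integrable ?N (\<lambda>\<omega>. indicator A \<omega> * (V \<omega> * indicator B \<omega>))"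
          by (rule prod_bd[OF _ VBm _ Vb]) (simp_all split: split_indicator)
        show "integrable ?N (\<lambda>\<omega>. measure (K n \<omega>) A * (V \<omega> * indicator B \<omega>))"
          by (rule prod_bd[OF Km VBm _ Vb]) (simp add: K1)
      qed
      also have "\<dots> = 0"
        using filter_version_integral[OF P lam(1) K Ap VF Vb] by (simp add: mult.commute)
      finally show ?thesis .
    qed
    finally have 1: "(\<integral>\<omega>. f \<omega> \<partial>?M) \<le> measure ?M B - (\<integral>\<omega>. indicator B \<omega> * \<Lambda> \<omega> \<partial>?N) + (\<integral>\<omega>. f \<omega> * (W \<omega> - V \<omega>) \<partial>?N)"
      by linarith
    have "(\<integral>\<omega>. f \<omega> * (W \<omega> - V \<omega>) \<partial>?N) \<le> (\<integral>\<omega>. indicator B \<omega> * \<bar>W \<omega> - V \<omega>\<bar> \<partial>?N)"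
    proof (rule integral_mono)
      show "f \<omega> * (W \<omega> - V \<omega>) \<le> indicator B \<omega> * \<bar>W \<omega> - V \<omega>\<bar>" for \<omega>
      proof -
        have "f \<omega> * (W \<omega> - V \<omega>) \<le> \<bar>f \<omega>\<bar> * \<bar>W \<omega> - V \<omega>\<bar>" by (metis abs_ge_self abs_mult)
        also have "\<dots> \<le> indicator B \<omega> * \<bar>W \<omega> - V \<omega>\<bar>" using fB by (intro mult_right_mono) auto
        finally show ?thesis .
      qed
    qed (fact iB if')+
    with 1 have "(\<integral>\<omega>. f \<omega> \<partial>?M) \<le> measure ?M B + ((\<integral>\<omega>. indicator B \<omega> * \<bar>W \<omega> - V \<omega>\<bar> \<partial>?N) - (\<integral>\<omega>. indicator B \<omega> * \<Lambda> \<omega> \<partial>?N))"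
      by linarith
    also have "(\<integral>\<omega>. indicator B \<omega> * \<bar>W \<omega> - V \<omega>\<bar> \<partial>?N) - (\<integral>\<omega>. indicator B \<omega> * \<Lambda> \<omega> \<partial>?N) = (\<integral>\<omega>. indicator B \<omega> * (\<bar>W \<omega> - V \<omega>\<bar> - \<Lambda> \<omega>) \<partial>?N)"
      using iB by (simp add: right_diff_distrib)
    finally have 2: "(\<integral>\<omega>. f \<omega> \<partial>?M) \<le> \<zeta> B" by (simp add: \<zeta>_def)
    have KM: "(\<lambda>\<omega>. measure (K n \<omega>) A) \<in> borel_measurable ?M" and LM: "(\<lambda>\<omega>. measure (L n \<omega>) A) \<in> borel_measurable ?M"
      by (rule measurable_from_subalg[OF subalgebra_FY[OF P \<mu>] KO[OF Ap]], rule measurable_from_subalg[OF subalgebra_FY[OF P \<mu>] LO[OF Ap]])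
    have i1: "integrable ?M (\<lambda>\<omega>. indicator B \<omega> * measure (L n \<omega>) A)" "integrable ?M (\<lambda>\<omega>. indicator B \<omega> * measure (K n \<omega>) A)"
      "integrable ?M (\<lambda>\<omega>. indicator B \<omega> * indicator A \<omega> :: real)"
      by (rule M.integrable_const_bound[of _ 1], use LM L1 in \<open>auto split: split_indicator\<close>)
        (rule M.integrable_const_bound[of _ 1], use KM K1 in \<open>auto split: split_indicator\<close>)+
    have "(\<integral>\<omega>. indicator B \<omega> * (measure (L n \<omega>) A - measure (K n \<omega>) A) \<partial>?M) =
      (\<integral>\<omega>. indicator B \<omega> * measure (L n \<omega>) A \<partial>?M) - (\<integral>\<omega>. indicator B \<omega> * measure (K n \<omega>) A \<partial>?M)"
      using i1 by (simp add: right_diff_distrib)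
    also have "(\<integral>\<omega>. indicator B \<omega> * measure (L n \<omega>) A \<partial>?M) = (\<integral>\<omega>. indicator B \<omega> * indicator A \<omega> \<partial>?M)"
      by (rule filter_version_integral[OF P \<mu> L Ap _ B1]) (use B in simp)
    also have "\<dots> - (\<integral>\<omega>. indicator B \<omega> * measure (K n \<omega>) A \<partial>?M) = (\<integral>\<omega>. f \<omega> \<partial>?M)"
      unfolding f_def using i1 by (simp add: right_diff_distrib)
    finally show ?thesis using 2 by simp
  qed
  obtain C' where C': "countable C'" "sets (tail m) = sigma_sets UNIV C'"
    using tail_generated[of m] by (elim exE conjE) (rule that)
  obtain \<C> where \<C>: "countable \<C>" "algebra UNIV \<C>" "sets (tail m) = sigma_sets UNIV \<C>"
    by (rule countable_generating_algebra[OF C'])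
  have \<C>ne: "\<C> \<noteq> {}" using \<C>(2) by (auto simp: algebra_iff_Un)
  define A where "A j = from_nat_into \<C> j" for j
  have A\<C>: "A j \<in> \<C>" for j unfolding A_def by (rule from_nat_into[OF \<C>ne])
  have At: "A j \<in> sets (tail m)" for j using A\<C> \<C>(3) by auto
  have Ap: "A j \<in> sets path_space" for j by (rule subsetD[OF tail_subset At])
  define S where "S n j = {\<omega>. \<kappa> < measure (L n \<omega>) (A j) - measure (K n \<omega>) (A j)}" for n j
  have SF: "S n j \<in> sets (FY 0 (enat n))" for n j
  proof -
    have "{\<omega> \<in> space (FY 0 (enat n)). \<kappa> < measure (L n \<omega>) (A j) - measure (K n \<omega>) (A j)} \<in> sets (FY 0 (enat n))"
      using LO[OF Ap, of n j] KO[OF Ap, of n j] by measurable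
    then show ?thesis by (simp add: S_def)
  qed
  have Sp: "S n j \<in> sets path_space" for n j by (rule subsetD[OF sets_FY_subset SF])
  (* pairs (n, j) enumerated with the time n as the leading digit in base J, so that earlier sets are observed earlier *)
  define G where "G J i = S (n0 + i div J) (i mod J)" for J i
  have Gp: "G J i \<in> sets path_space" for J i unfolding G_def by (rule Sp)
  have ind: "\<kappa> * measure ?M (\<Union>i<N. G J i) \<le> \<zeta> (\<Union>i<N. G J i)" for N J
  proof (induction N)
    case 0
    then show ?case by (simp add: \<zeta>_def)
  next
    case (Suc N)
    let ?U = "\<Union>i<N. G J i" and ?n = "n0 + N div J" and ?A = "A (N mod J)"
    define B where "B = G J N - ?U"
    have Up: "?U \<in> sets path_space" using Gp by auto
    have BF: "B \<in> sets (FY 0 (enat ?n))"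
    proof -
      have "G J i \<in> sets (FY 0 (enat ?n))" if "i \<le> N" for i
        using subsetD[OF FY_mono SF] that unfolding G_def by (simp add: div_le_mono)
      then show ?thesis unfolding B_def by (intro sets.Diff sets.finite_UN) auto
    qed
    have Bp: "B \<in> sets path_space" by (rule subsetD[OF sets_FY_subset BF])
    have "(\<Union>i<Suc N. G J i) = ?U \<union> B" by (auto simp: B_def lessThan_Suc)
    moreover have disj: "?U \<inter> B = {}" by (auto simp: B_def)
    moreover have "\<kappa> * measure ?M B \<le> \<zeta> B"
    proof -
      have BM: "B \<in> sets ?M" using Bp by (simp add: sM)
      have LM: "(\<lambda>\<omega>. measure (L ?n \<omega>) ?A) \<in> borel_measurable ?M" and KM: "(\<lambda>\<omega>. measure (K ?n \<omega>) ?A) \<in> borel_measurable ?M"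
        by (rule measurable_from_subalg[OF subalgebra_FY[OF P \<mu>] LO[OF Ap]], rule measurable_from_subalg[OF subalgebra_FY[OF P \<mu>] KO[OF Ap]])
      have "\<kappa> * measure ?M B = (\<integral>\<omega>. indicator B \<omega> * \<kappa> \<partial>?M)" using BM by simp
      also have "\<dots> \<le> (\<integral>\<omega>. indicator B \<omega> * (measure (L ?n \<omega>) ?A - measure (K ?n \<omega>) ?A) \<partial>?M)"
      proof (rule integral_mono)
        show "integrable ?M (\<lambda>\<omega>. indicator B \<omega> * \<kappa>)" using BM by (simp add: M.emeasure_eq_measure)
        show "integrable ?M (\<lambda>\<omega>. indicator B \<omega> * (measure (L ?n \<omega>) ?A - measure (K ?n \<omega>) ?A))"
        proof (rule M.integrable_const_bound[of _ 1])
          show "AE \<omega> in ?M. norm (indicator B \<omega> * (measure (L ?n \<omega>) ?A - measure (K ?n \<omega>) ?A)) \<le> 1"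
          proof (rule AE_I2)
            fix \<omega>
            show "norm (indicator B \<omega> * (measure (L ?n \<omega>) ?A - measure (K ?n \<omega>) ?A)) \<le> 1"
            proof -
              have "\<bar>measure (L ?n \<omega>) ?A - measure (K ?n \<omega>) ?A\<bar> \<le> 1"
                using K1[of ?n \<omega> ?A] L1[of ?n \<omega> ?A] by linarith
              then show ?thesis by (cases "\<omega> \<in> B") simp_all
            qed
          qed
        qed (use BM LM KM in simp)
        show "indicator B \<omega> * \<kappa> \<le> indicator B \<omega> * (measure (L ?n \<omega>) ?A - measure (K ?n \<omega>) ?A)" for \<omega>
          by (cases "\<omega> \<in> B") (simp_all add: B_def G_def S_def)
      qed
      also have "\<dots> \<le> \<zeta> B" by (rule claim1[OF _ BF At]) simp
      finally show ?thesis .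
    qed
    ultimately show ?case
      using Suc \<zeta>Un[OF Up Bp disj] M.finite_measure_Union[of ?U B] Up Bp by (simp add: sM distrib_left)
  qed
  have \<zeta>mono: "measure ?M (\<Union>i<N. G J i) \<le> \<delta>" for N J
  proof -
    let ?U = "\<Union>i<N. G J i"
    have Up: "?U \<in> sets path_space" using Gp by auto
    have Uc: "UNIV - ?U \<in> sets path_space" using sets.compl_sets[OF Up] by simp
    (* claim1 for the empty set shows that the error mass is nonnegative on observed events *)
    have "0 \<le> \<zeta> (UNIV - ?U)"
    proof -
      have TF: "\<kappa> * 0 \<le> \<zeta> (UNIV - ?U)"
      proof (cases N)
        case 0
        have "(\<integral>\<omega>. indicator UNIV \<omega> * (measure (L n0 \<omega>) UNIV - measure (K n0 \<omega>) UNIV) \<partial>?M) \<le> \<zeta> UNIV"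
          by (rule claim1[OF order_refl UNIV_in_FY]) (use sets.top[of "tail m"] in \<open>simp add: F0_def\<close>)
        moreover have "measure (L n0 \<omega>) UNIV = 1" "measure (K n0 \<omega>) UNIV = 1" for \<omega>
          using prob_space.prob_space[OF filter_version_facts(3)[OF P \<mu> L, of n0 \<omega>]]
            prob_space.prob_space[OF filter_version_facts(3)[OF P lam(1) K, of n0 \<omega>]]
            filter_version_facts(5)[OF P \<mu> L, of n0 \<omega>] filter_version_facts(5)[OF P lam(1) K, of n0 \<omega>] by simp_all
        ultimately show ?thesis using 0 by simp
      next
        case (Suc N')
        let ?n = "n0 + N div J"
        have UF: "?U \<in> sets (FY 0 (enat ?n))"
        proof -
          have "G J i \<in> sets (FY 0 (enat ?n))" if "i < N" for i
            using subsetD[OF FY_mono SF] that unfolding G_def by (simp add: div_le_mono)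
          then show ?thesis by (intro sets.finite_UN) auto
        qed
        have "UNIV - ?U \<in> sets (FY 0 (enat ?n))" using sets.compl_sets[OF UF] by simp
        from claim1[OF _ this sets.empty_sets] show ?thesis by simp
      qed
      then show ?thesis by simp
    qed
    moreover have "\<zeta> UNIV = \<zeta> ?U + \<zeta> (UNIV - ?U)" using \<zeta>Un[OF Up Uc] by (simp add: Un_absorb1)
    ultimately have "\<zeta> ?U \<le> \<delta> * \<kappa>" using \<zeta>top by linarith
    then have "\<kappa> * measure ?M ?U \<le> \<kappa> * \<delta>" using ind[of J N] by (simp add: mult.commute)
    then show ?thesis using \<kappa> by simp
  qed
  define E where "E J = (\<Union>i<J * J. G J i)" for J
  have Eeq: "E J = (\<Union>n\<in>{n0..<n0 + J}. \<Union>j<J. S n j)" for J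
  proof (intro subset_antisym subsetI)
    fix \<omega> assume "\<omega> \<in> E J"
    then obtain i where i: "i < J * J" "\<omega> \<in> S (n0 + i div J) (i mod J)" by (auto simp: E_def G_def)
    then have "0 < J" by (cases J) auto
    with i show "\<omega> \<in> (\<Union>n\<in>{n0..<n0 + J}. \<Union>j<J. S n j)"
      by (intro UN_I[of "n0 + i div J"] UN_I[of "i mod J"]) (auto simp: less_mult_imp_div_less)
  next
    fix \<omega> assume "\<omega> \<in> (\<Union>n\<in>{n0..<n0 + J}. \<Union>j<J. S n j)"
    then obtain n j where nj: "n0 \<le> n" "n < n0 + J" "j < J" "\<omega> \<in> S n j" by auto
    define i where "i = (n - n0) * J + j"
    have "i div J = n - n0" "i mod J = j" using nj by (simp_all add: i_def)
    moreover have "i < J * J"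
    proof -
      have "i < (n - n0) * J + J" using nj by (simp add: i_def)
      also have "\<dots> = Suc (n - n0) * J" by simp
      also have "\<dots> \<le> J * J" using nj by (intro mult_right_mono) auto
      finally show ?thesis .
    qed
    ultimately show "\<omega> \<in> E J" using nj unfolding E_def G_def by (intro UN_I[of i]) auto
  qed
  have EM: "E J \<in> sets ?M" for J unfolding E_def using Gp by (auto simp: sM)
  have "(\<lambda>J. measure ?M (E J)) \<longlonglongrightarrow> measure ?M (\<Union>J. E J)"
  proof (rule M.finite_Lim_measure_incseq)
    show "range E \<subseteq> sets ?M" using EM by auto
    show "incseq E" unfolding Eeq by (intro incseq_SucI UN_mono) auto
  qed
  then have mE: "measure ?M (\<Union>J. E J) \<le> \<delta>"
    by (rule LIMSEQ_le_const2) (auto simp: E_def \<zeta>mono)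
  have sE: "(\<Union>J. E J) \<in> sets path_space" using EM by (auto simp: sM)
  have tvE: "tv_norm (tail m) (L n \<omega>) (K n \<omega>) \<le> 2 * \<kappa>" if \<omega>: "\<omega> \<notin> (\<Union>J. E J)" and n: "n0 \<le> n" for \<omega> n
  proof (rule tv_norm_le_algebra[OF _ _ _ _ _ _ \<C>(2,3)])
    show "prob_space (L n \<omega>)" "space (L n \<omega>) = UNIV" "prob_space (K n \<omega>)" "space (K n \<omega>) = UNIV"
      by (rule filter_version_facts[OF P \<mu> L] filter_version_facts[OF P lam(1) K])+
    show "sets (tail m) \<subseteq> sets (L n \<omega>)" "sets (tail m) \<subseteq> sets (K n \<omega>)"
      unfolding filter_version_facts(4)[OF P \<mu> L] filter_version_facts(4)[OF P lam(1) K] by (rule tail_subset)+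
    (* one-sided bounds suffice because the algebra contains complements *)
    have up: "measure (L n \<omega>) C - measure (K n \<omega>) C \<le> \<kappa>" if C: "C \<in> \<C>" for C
    proof -
      obtain j where j: "C = A j" using from_nat_into_surj[OF \<C>(1) C] unfolding A_def by metis
      have "\<omega> \<notin> S n j"
      proof
        assume "\<omega> \<in> S n j"
        then have "\<omega> \<in> E (Suc (n + j))" unfolding Eeq using n by (intro UN_I[of n] UN_I[of j]) auto
        then show False using \<omega> by blast
      qed
      then show ?thesis by (simp add: S_def j not_less)
    qed
    fix C assume C: "C \<in> \<C>"
    interpret Ln: prob_space "L n \<omega>" by (rule filter_version_facts[OF P \<mu> L])
    interpret Kn: prob_space "K n \<omega>" by (rule filter_version_facts[OF P lam(1) K])
    have Cs: "C \<in> sets path_space" using C \<C>(3) tail_subset by (metis sigma_sets.Basic subsetD)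
    have Cc: "UNIV - C \<in> \<C>" using C \<C>(2) by (simp add: algebra_iff_Un)
    have "measure (L n \<omega>) (UNIV - C) = 1 - measure (L n \<omega>) C"
      by (rule Ln.prob_compl[unfolded filter_version_facts(4,5)[OF P \<mu> L], OF Cs])
    moreover have "measure (K n \<omega>) (UNIV - C) = 1 - measure (K n \<omega>) C"
      by (rule Kn.prob_compl[unfolded filter_version_facts(4,5)[OF P lam(1) K], OF Cs])
    ultimately show "\<bar>measure (L n \<omega>) C - measure (K n \<omega>) C\<bar> \<le> \<kappa>"
      using up[OF C] up[OF Cc] by (simp add: abs_le_iff)
  qed
  show ?thesis
    by (rule exI[of _ m], rule exI[of _ n0], rule exI[of _ "\<Union>J. E J"], intro conjI allI impI; fact sE mE tvE)
qed

text \<open>The local tails decrease, so the distance on the tail after time \<open>n - r\<close> is eventually at most the one on a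
  fixed tail, to which the maximal inequality applies.\<close>

theorem filter_stability:
  assumes \<mu>: "borel_prob \<mu>" and L: "filter_version P \<mu> L"
    and ac: "absolutely_continuous (distr lam borel snd) (distr \<mu> borel snd)"
    and conv: "AE \<omega> in chain_law P \<mu>. (\<lambda>m. tv_norm (tail m) (L 0 \<omega>) (K 0 \<omega>)) \<longlonglongrightarrow> 0"
  shows "AE \<omega> in chain_law P \<mu>. (\<lambda>n. tv_norm (tail (n - r)) (L n \<omega>) (K n \<omega>)) \<longlonglongrightarrow> 0"
proof -
  let ?M = "chain_law P \<mu>"
  interpret M: prob_space ?M by (rule chain_law_prob[OF P \<mu>])
  note sM = chain_law_prob(1)[OF P \<mu>]
  let ?X = "\<lambda>n \<omega>. tv_norm (tail (n - r)) (L n \<omega>) (K n \<omega>)"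
  have pr: "prob_space (L n \<omega>)" "prob_space (K n \<omega>)" for n \<omega>
    by (rule filter_version_facts[OF P \<mu> L] filter_version_facts[OF P lam(1) K])+
  have AEc: "AE \<omega> in ?M. \<exists>N. \<forall>n\<ge>N. ?X n \<omega> \<le> 2 * \<kappa>" if \<kappa>: "0 < \<kappa>" for \<kappa>
  proof -
    have "\<exists>E. E \<in> sets path_space \<and> measure ?M E \<le> 1 / real (Suc p) \<and> (\<forall>\<omega>. \<omega> \<notin> E \<longrightarrow> (\<exists>N. \<forall>n\<ge>N. ?X n \<omega> \<le> 2 * \<kappa>))" for p
    proof -
      have "0 < 1 / real (Suc p)" by simp
      from maximal_bound[OF \<mu> L ac conv \<kappa> this] obtain m n0 E where E: "E \<in> sets path_space" "measure ?M E \<le> 1 / real (Suc p)"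
        "\<And>\<omega> n. \<omega> \<notin> E \<Longrightarrow> n0 \<le> n \<Longrightarrow> tv_norm (tail m) (L n \<omega>) (K n \<omega>) \<le> 2 * \<kappa>" by blast
      have "?X n \<omega> \<le> 2 * \<kappa>" if "\<omega> \<notin> E" "max n0 (m + r) \<le> n" for \<omega> n
        using tv_norm_tail_antimono[OF pr, of m "n - r" n \<omega> n \<omega>] E(3)[OF that(1), of n] that(2) by fastforce
      then show ?thesis using E(1,2) by blast
    qed
    then have ex: "\<exists>E. \<forall>p. E p \<in> sets path_space \<and> measure ?M (E p) \<le> 1 / real (Suc p) \<and> (\<forall>\<omega>. \<omega> \<notin> E p \<longrightarrow> (\<exists>N. \<forall>n\<ge>N. ?X n \<omega> \<le> 2 * \<kappa>))"
      by (intro choice allI)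
    obtain E where E: "\<forall>p. E p \<in> sets path_space \<and> measure ?M (E p) \<le> 1 / real (Suc p) \<and> (\<forall>\<omega>. \<omega> \<notin> E p \<longrightarrow> (\<exists>N. \<forall>n\<ge>N. ?X n \<omega> \<le> 2 * \<kappa>))"
      using ex ..
    have Em: "E p \<in> sets ?M" for p using E by (simp add: sM)
    have Im: "(\<Inter>p. E p) \<in> sets ?M" by (rule sets.countable_INT) (use Em in auto)
    have "measure ?M (\<Inter>p. E p) \<le> 0"
    proof (rule field_le_epsilon)
      fix e :: real assume "0 < e"
      then obtain p where p: "1 / real (Suc p) < e" using nat_approx_posE by blast
      have "measure ?M (\<Inter>p. E p) \<le> measure ?M (E p)" using Em by (intro M.finite_measure_mono) auto
      also have "\<dots> \<le> 1 / real (Suc p)" using E by blast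
      finally show "measure ?M (\<Inter>p. E p) \<le> 0 + e" using p by linarith
    qed
    then have "measure ?M (\<Inter>p. E p) = 0" using measure_nonneg[of ?M "\<Inter>p. E p"] by linarith
    then have "(\<Inter>p. E p) \<in> null_sets ?M" using Im by (intro null_setsI) (simp_all add: M.emeasure_eq_measure)
    then show ?thesis by (rule AE_I') (use E in blast)
  qed
  have "AE \<omega> in ?M. \<forall>q::nat. \<exists>N. \<forall>n\<ge>N. ?X n \<omega> \<le> 2 * (1 / real (Suc q))"
    unfolding AE_all_countable by (intro allI AEc) simp
  then show ?thesis
  proof eventually_elim
    case (elim \<omega>)
    show ?case
    proof (rule LIMSEQ_I)
      fix e :: real assume "0 < e"
      then have "0 < e / 2" by simp
      then obtain q where q: "1 / real (Suc q) < e / 2" using nat_approx_posE by blast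
      from elim obtain N where N: "\<And>n. N \<le> n \<Longrightarrow> ?X n \<omega> \<le> 2 * (1 / real (Suc q))" by blast
      show "\<exists>N. \<forall>n\<ge>N. norm (?X n \<omega> - 0) < e"
      proof (intro exI[of _ N] allI impI)
        fix n assume "N \<le> n"
        from N[OF this] q tv_norm_nonneg[OF pr, of "tail (n - r)" n \<omega> n \<omega>] show "norm (?X n \<omega> - 0) < e"
          by simp
      qed
    qed
  qed
qed

text \<open>An event of the observations belongs to \<open>obs_tail m\<close> for every \<open>m\<close>, so \<open>singular_mass_tendsto_0\<close>, with the two laws
  exchanged, applies to the constant sequence.\<close>

lemma FY_infinity_null_transfer:
  assumes \<mu>: "borel_prob \<mu>" and L: "filter_version P \<mu> L"
    and ac: "absolutely_continuous (distr lam borel snd) (distr \<mu> borel snd)"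
    and ac': "absolutely_continuous (distr \<mu> borel snd) (distr lam borel snd)"
    and conv: "AE \<omega> in chain_law P \<mu>. (\<lambda>m. tv_norm (tail m) (L 0 \<omega>) (K 0 \<omega>)) \<longlonglongrightarrow> 0"
    and p: "Measurable.pred (FY 0 \<infinity>) p" and AE: "AE \<omega> in chain_law P \<mu>. p \<omega>"
  shows "AE \<omega> in chain_law P lam. p \<omega>"
proof -
  let ?M = "chain_law P \<mu>" and ?N = "chain_law P lam"
  interpret N: prob_space ?N by (rule chain_law_prob[OF P lam(1)])
  define S where "S = {\<omega>. \<not> p \<omega>}"
  have "{\<omega> \<in> space (FY 0 \<infinity>). \<not> p \<omega>} \<in> sets (FY 0 \<infinity>)" using p by measurable
  then have SF: "S \<in> sets (FY 0 \<infinity>)" by (simp add: S_def)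
  have Sp: "S \<in> sets path_space" by (rule subsetD[OF sets_FY_subset SF])
  have SO: "S \<in> sets (obs_tail m)" for m by (rule subsetD[OF FY_subset_obs_tail SF])
  have S0: "emeasure ?M S = 0"
    using AE Sp by (subst (asm) AE_iff_measurable[OF _ refl]) (auto simp: S_def chain_law_prob[OF P \<mu>] chain_law_space[OF P \<mu>])
  have tvF: "(\<lambda>\<omega>. tv_norm (tail m) (L 0 \<omega>) (K 0 \<omega>)) \<in> borel_measurable (FY 0 (enat 0))" for m
    by (rule tv_norm_tail_measurable[OF filter_version_facts(2)[OF P \<mu> L] filter_version_facts(2)[OF P lam(1) K]])
  have "AE \<omega> in restr_to_subalg ?M (FY 0 (enat 0)). (\<lambda>m. tv_norm (tail m) (L 0 \<omega>) (K 0 \<omega>)) \<longlonglongrightarrow> 0"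
  proof (rule AE_restr_to_subalg2[OF subalgebra_FY[OF P \<mu>] conv])
    show "Measurable.pred (FY 0 (enat 0)) (\<lambda>\<omega>. (\<lambda>m. tv_norm (tail m) (L 0 \<omega>) (K 0 \<omega>)) \<longlonglongrightarrow> 0)"
      by (rule measurable_limit[OF tvF])
  qed
  from AE_restr_to_subalg[OF subalgebra_FY[OF P lam(1)] AE_FY0_transfer[OF P lam(1) \<mu> ac' this]]
  have conv': "AE \<omega> in ?N. (\<lambda>m. tv_norm (tail m) (K 0 \<omega>) (L 0 \<omega>)) \<longlonglongrightarrow> 0"
    by (simp add: tv_norm_commute)
  have "(\<lambda>m::nat. measure ?N S) \<longlonglongrightarrow> 0"
    by (rule singular_mass_tendsto_0[OF lam(1) \<mu> K L ac' conv', where S="\<lambda>_. S", OF SO S0])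
  then have "measure ?N S = 0" by (simp add: LIMSEQ_const_iff)
  then have "S \<in> null_sets ?N" using Sp by (intro null_setsI) (simp_all add: N.emeasure_eq_measure chain_law_prob[OF P lam(1)])
  then show ?thesis by (rule AE_I') (auto simp: S_def)
qed

end

theorem theorem4p3:
  fixes P :: "'e::polish_space \<times> 'f::polish_space \<Rightarrow> ('e \<times> 'f) measure"
    and lam \<mu> :: "('e \<times> 'f) measure"
    and \<E> :: "'e set set"
    and Pi_mu Pi_lam :: "nat \<Rightarrow> (nat \<Rightarrow> 'e \<times> 'f) \<Rightarrow> (nat \<Rightarrow> 'e \<times> 'f) measure"
  assumes kernel: "markov_kernel P"
    and invariant: "borel_prob lam" "lam \<bind> P = lam"
    and sub_field: "sigma_algebra UNIV \<E>" "\<E> \<subseteq> sets borel"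
    and countably_generated: "\<exists>C. countable C \<and> \<E> = sigma_sets UNIV C"
    and ergodic: "local_ergodicity P lam \<E>"
    and nondeg: "nondegenerate P"
    and initial: "borel_prob \<mu>"
    and filters: "filter_version P \<mu> Pi_mu" "filter_version P lam Pi_lam"
    and marginal_ac: "absolutely_continuous (distr lam borel snd) (distr \<mu> borel snd)"
    and initial_filter: "AE \<omega> in chain_law P \<mu>.
      (\<lambda>n. tv_norm (F0 \<E> n \<infinity>) (Pi_mu 0 \<omega>) (Pi_lam 0 \<omega>)) \<longlonglongrightarrow> 0"
  shows "(\<forall>r. AE \<omega> in chain_law P \<mu>.
            (\<lambda>n. tv_norm (F0 \<E> (n - r) \<infinity>) (Pi_mu n \<omega>) (Pi_lam n \<omega>)) \<longlonglongrightarrow> 0)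
       \<and> (absolutely_continuous (distr \<mu> borel snd) (distr lam borel snd) \<longrightarrow>
            (\<forall>r. AE \<omega> in chain_law P lam.
               (\<lambda>n. tv_norm (F0 \<E> (n - r) \<infinity>) (Pi_mu n \<omega>) (Pi_lam n \<omega>)) \<longlonglongrightarrow> 0))"
proof -
  interpret ergodic_chain P \<E> lam Pi_lam
    using kernel nondeg sub_field(2) countably_generated invariant ergodic filters(2)
    by unfold_locales
  have stable: "AE \<omega> in chain_law P \<mu>. (\<lambda>n. tv_norm (F0 \<E> (n - r) \<infinity>) (Pi_mu n \<omega>) (Pi_lam n \<omega>)) \<longlonglongrightarrow> 0" for r
    by (rule filter_stability[OF initial filters(1) marginal_ac initial_filter])
  have "AE \<omega> in chain_law P lam. (\<lambda>n. tv_norm (F0 \<E> (n - r) \<infinity>) (Pi_mu n \<omega>) (Pi_lam n \<omega>)) \<longlonglongrightarrow> 0"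
    if ac: "absolutely_continuous (distr \<mu> borel snd) (distr lam borel snd)" for r
  proof (rule FY_infinity_null_transfer[OF initial filters(1) marginal_ac ac initial_filter _ stable[of r]])
    have "(\<lambda>\<omega>. tv_norm (F0 \<E> (n - r) \<infinity>) (Pi_mu n \<omega>) (Pi_lam n \<omega>)) \<in> borel_measurable (FY 0 \<infinity>)" for n
    proof (rule measurable_from_subalg)
      have "sets (coord_field {} {k. 0 \<le> k \<and> enat k \<le> enat n} {}) \<subseteq> sets (coord_field {} {k. 0 \<le> k \<and> enat k \<le> \<infinity>} {} :: (nat \<Rightarrow> 'e \<times> 'f) measure)"
        by (rule coord_field_mono) auto
      then show "subalgebra (FY 0 \<infinity>) (FY 0 (enat n) :: (nat \<Rightarrow> 'e \<times> 'f) measure)"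
        by (simp add: subalgebra_def FY_eq_coord_field[of _ _ "{}"])
      show "(\<lambda>\<omega>. tv_norm (F0 \<E> (n - r) \<infinity>) (Pi_mu n \<omega>) (Pi_lam n \<omega>)) \<in> borel_measurable (FY 0 (enat n))"
        by (rule tv_norm_tail_measurable[OF filter_version_facts(2)[OF kernel initial filters(1)]
              filter_version_facts(2)[OF kernel invariant(1) filters(2)]])
    qed
    then show "Measurable.pred (FY 0 \<infinity>) (\<lambda>\<omega>. (\<lambda>n. tv_norm (F0 \<E> (n - r) \<infinity>) (Pi_mu n \<omega>) (Pi_lam n \<omega>)) \<longlonglongrightarrow> 0)"
      by (rule measurable_limit)
  qed
  with stable show ?thesis by blast
qed

end
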